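(* Let $N\ge3$ be an integer, let $p=\frac N{N-2}$, and let $u^*$ be a singular positive solution of $$u''+\Big(\frac{N-1}{r}+\frac r2\Big)u'+\frac1{p-1}u+u^p=0,\qquad r>0.\qquad (E)$$ Define $w^*(x,t)=t^{-1/(p-1)}u^*(|x|/\sqrt t)$ for $x\in\mathbb R^N\setminus\{0\}$, $t>0$, and take any $t_0>0$. Then the Cauchy problem $$\partial_tw=\Delta w+w^{p}\ \ (x\in\mathbb R^N,\ t>0),\qquad w(x,0)=w_0(x)\ \ (x\in\mathbb R^N),\qquad (C)$$ with $p=N/(N-2)$ and $w_0(x)=w^*(x,t_0)$, has at least two solutions in $C([0,T];\mathcal L^{N/(N-2)}_{\rm ul}(\mathbb R^N))$ for some $T>0$. Specifically, one solution is $w(x,t)=w^*(x,t+t_0)$, which is singular at $x=0$ for all $t\ge0$ (i.e. $w(x,t)\to\infty$ as $x\to0$), and the other solution satisfies $(C)$ in the classical sense for $(x,t)\in\mathbb R^N\times(0,T)$.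
   Context: A singular positive solution of $(E)$ is a function $u\in C^2(0,\infty)$ with $u(r)>0$ for all $r>0$, satisfying $(E)$ for all $r>0$, and $u(r)\to\infty$ as $r\to0$. For $1\le q<\infty$, $L^q_{\rm ul}(\mathbb R^N)=\{u\in L^q_{\rm loc}(\mathbb R^N):\|u\|_{L^q_{\rm ul}}<\infty\}$, where $\|u\|_{L^q_{\rm ul}(\mathbb R^N)}=\sup_{y\in\mathbb R^N}\big(\int_{|x-y|<1}|u(x)|^q\,dx\big)^{1/q}$, and $\mathcal L^q_{\rm ul}(\mathbb R^N)$ is the closure in $L^q_{\rm ul}(\mathbb R^N)$ of the space $BUC(\mathbb R^N)$ of bounded uniformly continuous functions. A solution in $C([0,T];\mathcal L^{q}_{\rm ul}(\mathbb R^N))$ is a nonnegative function in this class which equals $w_0$ at $t=0$ and satisfies the differential equation for $0<t<T$; for the singular solution $w^*(x,t+t_0)$, which is defined for $x\neq0$ only, the differential equation is satisfied pointwise on $(\mathbb R^N\setminus\{0\})\times(0,T)$. *)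

theory Defs
  imports "HOL-Analysis.Analysis"
begin

definition C2_pos :: "(real \<Rightarrow> real) \<Rightarrow> bool" where
  "C2_pos u \<longleftrightarrow>
     (\<forall>r>0. u field_differentiable (at r) \<and> deriv u field_differentiable (at r)) \<and>
     continuous_on {0<..} (deriv (deriv u))"

text \<open>The dimension \<open>N\<close> is a real parameter here, since the equation uses it only as a coefficient.
  The value of \<open>u\<close> outside \<open>(0,\<infinity>)\<close> plays no role.\<close>

definition singular_positive_solution :: "real \<Rightarrow> real \<Rightarrow> (real \<Rightarrow> real) \<Rightarrow> bool" where
  "singular_positive_solution N p u \<longleftrightarrow>
     C2_pos u \<and> (\<forall>r>0. u r > 0) \<and>
     (\<forall>r>0. deriv (deriv u) r + ((N - 1) / r + r / 2) * deriv u r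
              + 1 / (p - 1) * u r + u r powr p = 0) \<and>
     filterlim u at_top (at_right 0)"

definition wstar :: "real \<Rightarrow> (real \<Rightarrow> real) \<Rightarrow> real ^ 'n \<Rightarrow> real \<Rightarrow> real" where
  "wstar p u x t = t powr (- 1 / (p - 1)) * u (norm x / sqrt t)"

text \<open>Elements of the Lebesgue-type spaces are represented by functions; two functions
  that agree almost everywhere represent the same element.\<close>

definition Lq_loc :: "real \<Rightarrow> (real ^ 'n \<Rightarrow> real) set" where
  "Lq_loc q = {f. f \<in> borel_measurable lebesgue \<and>
     (\<forall>K. compact K \<longrightarrow> set_integrable lebesgue K (\<lambda>x. \<bar>f x\<bar> powr q))}"

definition ul_ball_norm :: "real \<Rightarrow> (real ^ 'n \<Rightarrow> real) \<Rightarrow> real ^ 'n \<Rightarrow> real" where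
  "ul_ball_norm q f y = (LINT x : ball y 1 | lebesgue. \<bar>f x\<bar> powr q) powr (1 / q)"

text \<open>The supremum is taken in the reals, so it is the intended norm only on \<open>Lq_ul q\<close>, where
  finiteness of the norm is expressed by \<open>bdd_above\<close>.\<close>

definition ul_norm :: "real \<Rightarrow> (real ^ 'n \<Rightarrow> real) \<Rightarrow> real" where
  "ul_norm q f = (SUP y. ul_ball_norm q f y)"

definition Lq_ul :: "real \<Rightarrow> (real ^ 'n \<Rightarrow> real) set" where
  "Lq_ul q = {f \<in> Lq_loc q. bdd_above (range (ul_ball_norm q f))}"

definition BUC :: "(real ^ 'n \<Rightarrow> real) set" where
  "BUC = {g. bounded (range g) \<and> uniformly_continuous_on UNIV g}"

definition calLq_ul :: "real \<Rightarrow> (real ^ 'n \<Rightarrow> real) set" where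
  "calLq_ul q = {f \<in> Lq_ul q. \<forall>e>0. \<exists>g\<in>BUC. ul_norm q (\<lambda>x. f x - g x) < e}"

definition C_calLq_ul :: "real \<Rightarrow> real \<Rightarrow> (real ^ 'n \<Rightarrow> real \<Rightarrow> real) set" where
  "C_calLq_ul T q = {w. (\<forall>t\<in>{0..T}. (\<lambda>x. w x t) \<in> calLq_ul q) \<and>
     (\<forall>t\<in>{0..T}. \<forall>e>0. \<exists>d>0. \<forall>s\<in>{0..T}. \<bar>s - t\<bar> < d \<longrightarrow>
        ul_norm q (\<lambda>x. w x s - w x t) < e)}"

definition partial :: "'n::finite \<Rightarrow> (real ^ 'n \<Rightarrow> real) \<Rightarrow> real ^ 'n \<Rightarrow> real" where
  "partial i f x = deriv (\<lambda>h. f (x + h *\<^sub>R axis i 1)) 0"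

definition has_partial :: "'n::finite \<Rightarrow> (real ^ 'n \<Rightarrow> real) \<Rightarrow> real ^ 'n \<Rightarrow> bool" where
  "has_partial i f x \<longleftrightarrow> (\<lambda>h. f (x + h *\<^sub>R axis i 1)) field_differentiable (at 0)"

definition laplacian :: "(real ^ 'n \<Rightarrow> real) \<Rightarrow> real ^ 'n \<Rightarrow> real" where
  "laplacian f x = (\<Sum>i\<in>UNIV. partial i (partial i f) x)"

text \<open>The class \<open>C\<^sup>2\<^sup>,\<^sup>1\<close> on \<open>D \<times> I\<close> for open \<open>D\<close> and \<open>I\<close>: twice in space, once in time.\<close>

definition C21_on :: "(real ^ 'n) set \<Rightarrow> real set \<Rightarrow> (real ^ 'n \<Rightarrow> real \<Rightarrow> real) \<Rightarrow> bool" where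
  "C21_on D I w \<longleftrightarrow>
     (\<forall>x\<in>D. \<forall>t\<in>I. w x field_differentiable (at t)) \<and>
     (\<forall>x\<in>D. \<forall>t\<in>I. \<forall>i. has_partial i (\<lambda>y. w y t) x) \<and>
     (\<forall>x\<in>D. \<forall>t\<in>I. \<forall>i j. has_partial j (partial i (\<lambda>y. w y t)) x) \<and>
     continuous_on (D \<times> I) (\<lambda>(x, t). w x t) \<and>
     continuous_on (D \<times> I) (\<lambda>(x, t). deriv (w x) t) \<and>
     (\<forall>i. continuous_on (D \<times> I) (\<lambda>(x, t). partial i (\<lambda>y. w y t) x)) \<and>
     (\<forall>i j. continuous_on (D \<times> I) (\<lambda>(x, t). partial j (partial i (\<lambda>y. w y t)) x))"

definition classical_solution_on ::
    "real \<Rightarrow> (real ^ 'n) set \<Rightarrow> real set \<Rightarrow> (real ^ 'n \<Rightarrow> real \<Rightarrow> real) \<Rightarrow> bool" where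
  "classical_solution_on p D I w \<longleftrightarrow> C21_on D I w \<and>
     (\<forall>x\<in>D. \<forall>t\<in>I. deriv (w x) t = laplacian (\<lambda>y. w y t) x + w x t powr p)"

text \<open>Nonnegative solutions of the Cauchy problem in \<open>C([0,T]; \<L>\<^sup>q\<^sub>u\<^sub>l)\<close> that satisfy the
  differential equation on \<open>D \<times> (0,T)\<close>. The initial datum \<open>w0\<close> is required away from the origin
  only, because the datum of interest is singular (hence undefined) there. Nonnegativity on \<open>D\<close>
  makes \<open>powr\<close> the intended power.\<close>

definition cauchy_solution :: "real \<Rightarrow> real \<Rightarrow> real \<Rightarrow> (real ^ 'n) set \<Rightarrow>
    (real ^ 'n \<Rightarrow> real) \<Rightarrow> (real ^ 'n \<Rightarrow> real \<Rightarrow> real) \<Rightarrow> bool" where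
  "cauchy_solution p q T D w0 w \<longleftrightarrow>
     w \<in> C_calLq_ul T q \<and>
     (\<forall>x\<in>D. \<forall>t\<in>{0..T}. 0 \<le> w x t) \<and>
     (\<forall>x. x \<noteq> 0 \<longrightarrow> w x 0 = w0 x) \<and>
     classical_solution_on p D {0<..<T} w"

end

theory Submission
  imports Defs "HOL-Probability.Probability"
begin

text \<open>The flux \<open>J(r) = - r\<^sup>N\<^sup>-\<^sup>1 exp(r\<^sup>2/4) u'(r)\<close> of a singular profile is increasing and positive. Hence \<open>u\<close>
  decreases, and comparing \<open>u\<^sup>p\<close> with the increments of \<open>J\<close> over dyadic shells shows that
  \<open>u(\<bar>x\<bar>)\<^sup>p\<close> is integrable at the origin, which places the singular solution in the uniformly local space.

  For the second solution let \<open>S\<close> be the heat semigroup and \<open>\<phi>(t) = S(t) w\<^sub>0\<^sup>p\<close>. Since \<open>w\<^sub>0\<^sup>p\<close> is the sum of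
  an arbitrarily small integrable function and a bounded one, \<open>t\<^sup>N\<^sup>/\<^sup>2 \<phi>(t)\<close> tends to \<open>0\<close> uniformly as \<open>t \<rightarrow> 0\<close>.
  Because \<open>(p - 1)/p = 2/N\<close>, this makes \<open>2 \<phi>\<^sup>1\<^sup>/\<^sup>p\<close> a supersolution of the Duhamel equation for small
  times: \<open>S(t) w\<^sub>0 \<le> \<phi>\<^sup>1\<^sup>/\<^sup>p\<close> by Jensen's inequality, and the Duhamel term is at most \<open>2\<^sup>p t \<phi>(t)\<close> by the semigroup
  property. The monotone Picard iteration converges below this supersolution to a mild solution that is
  bounded for \<open>t > 0\<close>. Boundedness makes it classical, so it differs from the singular solution.\<close>


text \<open>The space has exponent \<open>p\<close>, which for \<open>p = N / (N - 2)\<close> equals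
  the scale-invariant exponent \<open>N * (p - 1) / 2\<close>. At this doubly critical exponent
  scaling leaves no positive power of \<open>t\<close> that would make a Duhamel term small, so the
  smallness has to come from the datum. The factor 2 in the supersolution is shared evenly: one half
  bounds the heat flow of the datum, the other half the Duhamel term, as soon as
  \<open>t * \<phi> t x powr ((p - 1) / p) \<le> 2 powr (- p)\<close>. The source may blow up as
  \<open>t\<close> tends to 0. The construction therefore runs in extended nonnegative integrals,
  where Tonelli and monotone convergence apply without finiteness, and regularity is derived from
  the mild equation restarted at positive times, from where on everything is bounded. Two space
  derivatives on the kernel would produce the nonintegrable singularity \<open>1 / t\<close> in the
  Duhamel integral. One derivative stays on the kernel, at the integrable price
  \<open>t powr (- 1/2)\<close>, and the other is moved to the source.\<close>

section \<open>Limits and derivatives under the integral sign\<close>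

text \<open>First countability reduces the limit to sequences, to which dominated convergence
  applies. Convergence is asked almost everywhere only, because in
  \<open>continuous_on_duhamel\<close> a moving cutoff jumps at one point.\<close>

lemma tendsto_integral_dominated:
  fixes F :: "'b::first_countable_topology \<Rightarrow> 'a \<Rightarrow> real"
  assumes meas: "\<And>x. x \<in> U \<Longrightarrow> F x \<in> borel_measurable M"
    and x0: "x0 \<in> U"
    and lim: "AE y in M. ((\<lambda>x. F x y) \<longlongrightarrow> F x0 y) (at x0 within U)"
    and bnd: "eventually (\<lambda>x. \<forall>y\<in>space M. \<bar>F x y\<bar> \<le> B y) (at x0 within U)"
    and B: "integrable M B"
  shows "((\<lambda>x. \<integral>y. F x y \<partial>M) \<longlongrightarrow> (\<integral>y. F x0 y \<partial>M)) (at x0 within U)"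
proof (subst tendsto_at_iff_sequentially, intro allI impI)
  fix X :: "nat \<Rightarrow> 'b"
  assume X: "\<forall>i. X i \<in> U - {x0}" and Xl: "X \<longlonglongrightarrow> x0"
  have fl: "filterlim X (at x0 within U) sequentially"
    using X Xl by (simp add: filterlim_at)
  have "eventually (\<lambda>i. \<forall>y\<in>space M. \<bar>F (X i) y\<bar> \<le> B y) sequentially"
    using bnd fl by (rule eventually_compose_filterlim)
  then obtain k where k: "\<And>i y. i \<ge> k \<Longrightarrow> y \<in> space M \<Longrightarrow> \<bar>F (X i) y\<bar> \<le> B y"
    by (auto simp: eventually_sequentially)
  have "(\<lambda>i. \<integral>y. F (X (i + k)) y \<partial>M) \<longlonglongrightarrow> (\<integral>y. F x0 y \<partial>M)"
  proof (rule integral_dominated_convergence[where w = B])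
    show "F x0 \<in> borel_measurable M" using meas x0 .
    show "\<And>i. F (X (i + k)) \<in> borel_measurable M" using meas X by blast
    show "integrable M B" by fact
    show "AE x in M. (\<lambda>i. F (X (i + k)) x) \<longlonglongrightarrow> F x0 x"
      using lim
    proof eventually_elim
      case (elim y)
      have "filterlim (\<lambda>i. X (i + k)) (at x0 within U) sequentially"
        using filterlim_compose[OF fl filterlim_add_const_nat_at_top] .
      with elim show ?case by (rule filterlim_compose)
    qed
    show "\<And>i. AE x in M. norm (F (X (i + k)) x) \<le> B x"
      using k by (intro AE_I2) auto
  qed
  then show "((\<lambda>x. \<integral>y. F x y \<partial>M) \<circ> X) \<longlonglongrightarrow> (\<integral>y. F x0 y \<partial>M)"
    unfolding comp_def by (rule LIMSEQ_offset)
qed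

text \<open>By the mean value theorem the bound on \<open>F'\<close> is also a bound on the
  difference quotients \<open>Q\<close>, which then converge under the integral. Measurability of
  \<open>F' a\<close> is obtained on the way, as that of a pointwise limit of difference
  quotients.\<close>

lemma has_derivative_integral_dominated:
  fixes F F' :: "real \<Rightarrow> 'a \<Rightarrow> real"
  assumes "d > 0"
    and int: "\<And>h. \<bar>h - a\<bar> < d \<Longrightarrow> integrable M (F h)"
    and der: "\<And>h y. \<bar>h - a\<bar> < d \<Longrightarrow> y \<in> space M \<Longrightarrow> ((\<lambda>h. F h y) has_real_derivative F' h y) (at h)"
    and bnd: "\<And>h y. \<bar>h - a\<bar> < d \<Longrightarrow> y \<in> space M \<Longrightarrow> \<bar>F' h y\<bar> \<le> B y"
    and B: "integrable M B"
  shows "((\<lambda>h. \<integral>y. F h y \<partial>M) has_real_derivative (\<integral>y. F' a y \<partial>M)) (at a)"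
proof -
  let ?U = "{h. \<bar>h - a\<bar> < d}"
  define Q where "Q h y = (if h = a then F' a y else (F h y - F a y) / (h - a))" for h y
  have aU: "a \<in> ?U" using \<open>d > 0\<close> by simp
  have oU: "open ?U"
    by (rule open_Collect_less) (auto intro!: continuous_intros)
  have Qlim: "((\<lambda>h. Q h y) \<longlongrightarrow> F' a y) (at a)" if "y \<in> space M" for y
  proof -
    have "((\<lambda>h. (F h y - F a y) / (h - a)) \<longlongrightarrow> F' a y) (at a)"
      using der[of a y] that \<open>d > 0\<close> by (simp add: has_field_derivative_iff)
    then show ?thesis
      by (rule Lim_transform_eventually) (auto simp: Q_def eventually_at_filter)
  qed
  have Qm: "Q h \<in> borel_measurable M" if h: "h \<in> ?U" for h
  proof (cases "h = a")
    case False
    have "F h \<in> borel_measurable M" "F a \<in> borel_measurable M"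
      using int h aU by auto
    then have "(\<lambda>y. (F h y - F a y) / (h - a)) \<in> borel_measurable M" by measurable
    then show ?thesis using False by (simp add: Q_def[abs_def])
  next
    case True
    have "F' a \<in> borel_measurable M"
    proof (rule borel_measurable_LIMSEQ_real)
      \<comment> \<open>The increments \<open>d / (real i + 2)\<close> are nonzero and smaller than
        \<open>d\<close> from \<open>i = 0\<close> on.\<close>
      let ?x = "\<lambda>i::nat. a + d / (real i + 2)"
      have in_U: "\<bar>?x i - a\<bar> < d" for i using \<open>d > 0\<close> by (simp add: field_simps add_pos_nonneg)
      show "(\<lambda>y. Q (?x i) y) \<in> borel_measurable M" for i
      proof -
        have "F (?x i) \<in> borel_measurable M" "F a \<in> borel_measurable M"
          using int in_U aU by auto
        then have "(\<lambda>y. (F (?x i) y - F a y) / (?x i - a)) \<in> borel_measurable M" by measurable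
        then show ?thesis using \<open>d > 0\<close> by (simp add: Q_def[abs_def])
      qed
      show "(\<lambda>i. Q (?x i) y) \<longlonglongrightarrow> F' a y" if "y \<in> space M" for y
      proof (rule filterlim_compose[OF Qlim[OF that]])
        have "(\<lambda>i::nat. d / (real i + 2)) \<longlonglongrightarrow> 0"
          by real_asymp
        then have "?x \<longlonglongrightarrow> a + 0" by (intro tendsto_intros)
        then show "filterlim ?x (at a) sequentially"
          using \<open>d > 0\<close> by (simp add: filterlim_at add_nonneg_eq_0_iff)
      qed
    qed
    then show ?thesis using True by (simp add: Q_def[abs_def])
  qed
  have Qb: "\<bar>Q h y\<bar> \<le> B y" if h: "h \<in> ?U" and y: "y \<in> space M" for h y
  proof (cases "h = a")
    case True then show ?thesis using bnd[of a y] y aU by (simp add: Q_def)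
  next
    case False
    have "norm (F h y - F a y) \<le> B y * norm (h - a)"
    proof (rule field_differentiable_bound[where S = ?U and f = "\<lambda>h. F h y" and f' = "\<lambda>h. F' h y"])
      show "convex ?U"
      proof -
        have "?U = {a - d <..< a + d}" by (auto simp: abs_if split: if_splits)
        then show ?thesis by simp
      qed
      show "((\<lambda>h. F h y) has_field_derivative F' z y) (at z within ?U)" if "z \<in> ?U" for z
        using der[of z y] that y by (auto intro: has_field_derivative_at_within)
    qed (use bnd y h aU in auto)
    then show ?thesis using False by (simp add: Q_def divide_le_eq)
  qed
  have "((\<lambda>h. \<integral>y. Q h y \<partial>M) \<longlongrightarrow> (\<integral>y. Q a y \<partial>M)) (at a within ?U)"
  proof (rule tendsto_integral_dominated[OF Qm aU _ _ B])
    show "AE y in M. ((\<lambda>h. Q h y) \<longlongrightarrow> Q a y) (at a within ?U)"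
    proof (rule AE_I2)
      fix y assume "y \<in> space M"
      then have "((\<lambda>h. Q h y) \<longlongrightarrow> Q a y) (at a)" using Qlim[of y] by (simp add: Q_def[of a])
      then show "((\<lambda>h. Q h y) \<longlongrightarrow> Q a y) (at a within ?U)" by (rule tendsto_within_subset) auto
    qed
    show "\<forall>\<^sub>F h in at a within ?U. \<forall>y\<in>space M. \<bar>Q h y\<bar> \<le> B y"
      using Qb by (auto simp: eventually_at_filter)
  qed
  then have "((\<lambda>h. \<integral>y. Q h y \<partial>M) \<longlongrightarrow> (\<integral>y. F' a y \<partial>M)) (at a)"
    using at_within_open[OF aU oU] by (simp add: Q_def[of a])
  then have "((\<lambda>h. ((\<integral>y. F h y \<partial>M) - (\<integral>y. F a y \<partial>M)) / (h - a)) \<longlongrightarrow> (\<integral>y. F' a y \<partial>M)) (at a)"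
  proof (rule Lim_transform_eventually)
    show "\<forall>\<^sub>F h in at a. (\<integral>y. Q h y \<partial>M) = ((\<integral>y. F h y \<partial>M) - (\<integral>y. F a y \<partial>M)) / (h - a)"
      using eventually_at_in_open[OF oU aU]
    proof eventually_elim
      case (elim h)
      then have "integrable M (F h)" "integrable M (F a)" "h \<noteq> a" using int aU by auto
      then show "(\<integral>y. Q h y \<partial>M) = ((\<integral>y. F h y \<partial>M) - (\<integral>y. F a y \<partial>M)) / (h - a)"
        by (simp add: Q_def Bochner_Integration.integral_diff)
    qed
  qed
  then show ?thesis by (simp add: has_field_derivative_iff)
qed

subsection \<open>The heat kernel\<close>

definition heat_kernel :: "real \<Rightarrow> 'a::euclidean_space \<Rightarrow> real" where
  "heat_kernel t z = (4 * pi * t) powr (- real DIM('a) / 2) * exp (- (norm z)\<^sup>2 / (4 * t))"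

lemma heat_kernel_nonneg [simp]: "0 \<le> heat_kernel t z"
  by (simp add: heat_kernel_def)

lemma heat_kernel_pos: "t > 0 \<Longrightarrow> 0 < heat_kernel t z"
  by (simp add: heat_kernel_def)

lemma heat_kernel_minus_commute: "heat_kernel t (x - y) = heat_kernel t (y - x)"
  by (simp add: heat_kernel_def norm_minus_commute)

lemma heat_kernel_le: "t > 0 \<Longrightarrow> heat_kernel t (z::'a::euclidean_space) \<le> (4 * pi * t) powr (- real DIM('a) / 2)"
  by (simp add: heat_kernel_def mult_left_le)

lemma borel_measurable_heat_kernel [measurable]:
  "(\<lambda>x. heat_kernel (f x) (g x :: 'a::euclidean_space)) \<in> borel_measurable M"
  if [measurable]: "f \<in> borel_measurable M" "g \<in> borel_measurable M"
  unfolding heat_kernel_def by measurable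

lemma continuous_on_heat_kernel [continuous_intros]:
  "continuous_on S f \<Longrightarrow> continuous_on S g \<Longrightarrow> (\<And>x. x \<in> S \<Longrightarrow> f x > 0) \<Longrightarrow>
     continuous_on S (\<lambda>x. heat_kernel (f x) (g x :: 'a::euclidean_space))"
  unfolding heat_kernel_def by (intro continuous_intros) (simp_all add: less_imp_neq[symmetric])

text \<open>The kernel is a product of centred normal densities of variance \<open>2 * t\<close>, so
  its total mass follows from the one-dimensional case by Fubini.\<close>

lemma heat_kernel_prod_normal:
  assumes "t > 0"
  shows "heat_kernel t (z::'a::euclidean_space) = (\<Prod>b\<in>Basis. normal_density 0 (sqrt (2 * t)) (z \<bullet> b))"
proof -
  have "(\<Prod>b\<in>Basis. normal_density 0 (sqrt (2 * t)) (z \<bullet> b))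
      = (\<Prod>b\<in>(Basis::'a set). 1 / sqrt (4 * pi * t)) * (\<Prod>b\<in>Basis. exp (- (z \<bullet> b)\<^sup>2 / (4 * t)))"
    using assms by (simp add: normal_density_def prod.distrib[symmetric] mult_ac del: prod_constant)
  also have "(\<Prod>b\<in>Basis. exp (- (z \<bullet> b)\<^sup>2 / (4 * t))) = exp (- (norm z)\<^sup>2 / (4 * t))"
    by (simp add: exp_sum[symmetric] sum_divide_distrib[symmetric] sum_negf power2_norm_eq_inner
        euclidean_inner[of z z]) (simp add: power2_eq_square)
  also have "(\<Prod>b\<in>(Basis::'a set). 1 / sqrt (4 * pi * t)) = (4 * pi * t) powr (- real DIM('a) / 2)"
  proof -
    have "1 / sqrt (4 * pi * t) = (4 * pi * t) powr (- 1/2)"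
      using assms by (simp add: powr_half_sqrt powr_minus_divide)
    then show ?thesis using assms by (simp add: powr_power)
  qed
  finally show ?thesis by (simp add: heat_kernel_def)
qed

lemma nn_integral_heat_kernel:
  assumes "t > 0"
  shows "(\<integral>\<^sup>+z. ennreal (heat_kernel t (z::'a::euclidean_space)) \<partial>lborel) = 1"
proof -
  have s: "sqrt (2 * t) > 0" using assms by simp
  interpret prob_space "density lborel (normal_density 0 (sqrt (2 * t)))"
    using prob_space_normal_density[OF s] .
  have 1: "(\<integral>\<^sup>+x. ennreal (normal_density 0 (sqrt (2 * t)) x) \<partial>lborel) = 1"
    using emeasure_space_1 by (simp add: emeasure_density)
  show ?thesis
    using assms nn_integral_lborel_prod[of "\<lambda>b. normal_density 0 (sqrt (2 * t))"]
    by (simp add: heat_kernel_prod_normal 1 prod_ennreal prod_nonneg)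
qed

lemma nn_integral_lborel_reflect:
  assumes [measurable]: "f \<in> borel_measurable borel"
  shows "(\<integral>\<^sup>+y. f (x - y) \<partial>lborel) = (\<integral>\<^sup>+y. f (y::'a::euclidean_space) \<partial>lborel)"
proof -
  have "(\<integral>\<^sup>+y. f y \<partial>lborel) = (\<integral>\<^sup>+y. f y \<partial>(density (distr lborel borel (\<lambda>y. x + (- 1) *\<^sub>R y)) (\<lambda>_. \<bar>- 1 :: real\<bar> ^ DIM('a))))"
    by (subst lborel_affine[of "- 1" x]) auto
  also have "\<dots> = (\<integral>\<^sup>+y. f (x - y) \<partial>lborel)"
    by (simp add: nn_integral_density nn_integral_distr)
  finally show ?thesis by simp
qed

lemma nn_integral_heat_kernel_shift:
  assumes "t > 0"
  shows "(\<integral>\<^sup>+y. ennreal (heat_kernel t (x - y :: 'a::euclidean_space)) \<partial>lborel) = 1"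
  using assms nn_integral_lborel_reflect[of "\<lambda>z. ennreal (heat_kernel t z)" x]
  by (simp add: nn_integral_heat_kernel)

text \<open>Completing the square.\<close>

lemma heat_kernel_mult:
  fixes x y z :: "'a::euclidean_space"
  assumes "t > 0" "s > 0"
  shows "heat_kernel t (x - y) * heat_kernel s (y - z) =
    heat_kernel (t + s) (x - z) * heat_kernel (t * s / (t + s)) ((s / (t + s)) *\<^sub>R x + (t / (t + s)) *\<^sub>R z - y)"
proof -
  let ?m = "(s / (t + s)) *\<^sub>R x + (t / (t + s)) *\<^sub>R z"
  have ts: "t + s \<noteq> 0" using assms by simp
  have e: "(norm (x - y))\<^sup>2 / t + (norm (y - z))\<^sup>2 / s =
     (norm (x - z))\<^sup>2 / (t + s) + (norm (?m - y))\<^sup>2 * ((t + s) / (t * s))"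
  proof -
    have n: "(norm (a - b))\<^sup>2 = a \<bullet> a - 2 * (a \<bullet> b) + b \<bullet> b" for a b :: 'a
      by (simp add: power2_norm_eq_inner inner_diff_left inner_diff_right inner_commute)
    define xx yy zz xy xz yz where "xx = x \<bullet> x" "yy = y \<bullet> y" "zz = z \<bullet> z" "xy = x \<bullet> y" "xz = x \<bullet> z" "yz = y \<bullet> z"
    note d = this
    \<comment> \<open>These are the weights of the barycentre \<open>?m\<close>. With
      \<open>a + b = 1\<close> the identity to be shown becomes polynomial.\<close>
    define a b where "a = s / (t + s)" "b = t / (t + s)"
    note ab = this
    have ab1: "a + b = 1" using ts by (simp add: ab add_divide_distrib[symmetric])
    have sa: "s = a * (t + s)" and tb: "t = b * (t + s)" using ts by (simp_all add: ab)
    have ab0: "a > 0" "b > 0" using assms by (simp_all add: ab)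
    have m: "(norm (?m - y))\<^sup>2 = a\<^sup>2 * xx + 2 * a * b * xz + b\<^sup>2 * zz - 2 * (a * xy + b * yz) + yy"
      unfolding n ab(1)[symmetric] ab(2)[symmetric]
      by (simp add: inner_add_left inner_add_right d inner_commute power2_eq_square algebra_simps)
    have "(xx - 2 * xy + yy) * a + (yy - 2 * yz + zz) * b =
       (xx - 2 * xz + zz) * (a * b) + (a\<^sup>2 * xx + 2 * a * b * xz + b\<^sup>2 * zz - 2 * (a * xy + b * yz) + yy)"
      using ab1 by algebra
    then have "((xx - 2 * xy + yy) * a + (yy - 2 * yz + zz) * b) / (a * b) =
       (xx - 2 * xz + zz) + (norm (?m - y))\<^sup>2 / (a * b)"
      using ab0 unfolding m by (simp add: add_divide_distrib)
    then have *: "((xx - 2 * xy + yy) / b + (yy - 2 * yz + zz) / a) / (t + s) =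
       ((xx - 2 * xz + zz) + (norm (?m - y))\<^sup>2 / (a * b)) / (t + s)"
      using ab0 by (simp add: add_divide_distrib)
    have "(norm (x - y))\<^sup>2 / t + (norm (y - z))\<^sup>2 / s = (xx - 2 * xy + yy) / t + (yy - 2 * yz + zz) / s"
      by (simp add: n d)
    also have "\<dots> = ((xx - 2 * xy + yy) / b + (yy - 2 * yz + zz) / a) / (t + s)"
      by (subst tb, subst sa) (simp add: add_divide_distrib mult.commute)
    also have "\<dots> = (xx - 2 * xz + zz) / (t + s) + (norm (?m - y))\<^sup>2 / (a * b * (t + s))"
      unfolding * by (simp add: add_divide_distrib)
    also have "a * b * (t + s) = t * s / (t + s)"
      using ts by (simp add: ab)
    also have "(xx - 2 * xz + zz) / (t + s) + (norm (?m - y))\<^sup>2 / (t * s / (t + s))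
       = (norm (x - z))\<^sup>2 / (t + s) + (norm (?m - y))\<^sup>2 * ((t + s) / (t * s))"
      by (simp add: n[of x z] d)
    finally show ?thesis .
  qed
  have "exp (- (norm (x - y))\<^sup>2 / (4 * t)) * exp (- (norm (y - z))\<^sup>2 / (4 * s))
     = exp (- ((norm (x - y))\<^sup>2 / t + (norm (y - z))\<^sup>2 / s) / 4)"
    by (simp add: exp_add[symmetric] add_divide_distrib)
  also have "\<dots> = exp (- (norm (x - z))\<^sup>2 / (4 * (t + s))) * exp (- (norm (?m - y))\<^sup>2 / (4 * (t * s / (t + s))))"
  proof -
    have "- (A / (t + s) + B * ((t + s) / (t * s))) / 4 = - A / (4 * (t + s)) + - B / (4 * (t * s / (t + s)))" for A B
      using assms ts by (simp add: divide_simps) algebra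
    from this[of "(norm (x - z))\<^sup>2" "(norm (?m - y))\<^sup>2"] show ?thesis
      unfolding e exp_add[symmetric] by (rule arg_cong[where f = exp])
  qed
  finally have E: "exp (- (norm (x - y))\<^sup>2 / (4 * t)) * exp (- (norm (y - z))\<^sup>2 / (4 * s)) =
    exp (- (norm (x - z))\<^sup>2 / (4 * (t + s))) * exp (- (norm (?m - y))\<^sup>2 / (4 * (t * s / (t + s))))" .
  have P: "(4 * pi * t) powr (- real DIM('a) / 2) * (4 * pi * s) powr (- real DIM('a) / 2)
     = (4 * pi * (t + s)) powr (- real DIM('a) / 2) * (4 * pi * (t * s / (t + s))) powr (- real DIM('a) / 2)"
  proof -
    have "(4 * pi * t) * (4 * pi * s) = (4 * pi * (t + s)) * (4 * pi * (t * s / (t + s)))"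
    proof -
      have "(t + s) * (t * s / (t + s)) = t * s" using ts by simp
      then show ?thesis by algebra
    qed
    moreover have "X powr c * Y powr c = (X * Y) powr c" if "X > 0" "Y > 0" for X Y c :: real
      using that by (simp add: powr_mult)
    ultimately show ?thesis using assms by (metis add_pos_pos divide_pos_pos mult_pos_pos pi_gt_zero zero_less_numeral)
  qed
  have "(P * E) * (Q * F) = (P' * E') * (Q' * F')" if "E * F = E' * F'" "P * Q = P' * Q'"
    for P Q E F P' Q' E' F' :: real
  proof -
    have "(P * E) * (Q * F) = (P * Q) * (E * F)" by (simp only: mult_ac)
    also have "\<dots> = (P' * E') * (Q' * F')" unfolding that by (simp only: mult_ac)
    finally show ?thesis .
  qed
  from this[OF E P] show ?thesis unfolding heat_kernel_def .
qed

text \<open>The Chapman-Kolmogorov identity: as a function of \<open>y\<close> the product is a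
  constant times a shifted heat kernel, which has unit mass.\<close>

lemma nn_integral_heat_kernel_mult:
  fixes x z :: "'a::euclidean_space"
  assumes "t > 0" "s > 0"
  shows "(\<integral>\<^sup>+y. ennreal (heat_kernel t (x - y)) * ennreal (heat_kernel s (y - z)) \<partial>lborel)
    = ennreal (heat_kernel (t + s) (x - z))"
  using assms by (simp add: ennreal_mult'[symmetric] heat_kernel_mult[OF assms])
    (simp add: ennreal_mult' nn_integral_cmult nn_integral_heat_kernel_shift)

section \<open>The heat semigroup on nonnegative functions\<close>

text \<open>Values in \<open>ennreal\<close> let Tonelli and monotone convergence act before
  anything is known to be finite, as in the Picard iteration below.\<close>

definition nn_heat :: "real \<Rightarrow> ('a::euclidean_space \<Rightarrow> ennreal) \<Rightarrow> 'a \<Rightarrow> ennreal" where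
  "nn_heat t f x = (\<integral>\<^sup>+y. ennreal (heat_kernel t (x - y)) * f y \<partial>lborel)"

lemma borel_measurable_nn_heat:
  fixes F :: "'a::euclidean_space \<Rightarrow> 'b \<Rightarrow> ennreal"
  assumes [measurable]: "(\<lambda>(y, z). F y z) \<in> borel_measurable (borel \<Otimes>\<^sub>M M)"
    "f \<in> borel_measurable M" "g \<in> borel_measurable M"
  shows "(\<lambda>z. nn_heat (f z) (\<lambda>y. F y z) (g z)) \<in> borel_measurable M"
proof -
  have [measurable]: "(\<lambda>(z, y). F y z) \<in> borel_measurable (M \<Otimes>\<^sub>M borel)"
    by (subst measurable_pair_swap_iff) simp
  show ?thesis unfolding nn_heat_def
    by (rule sigma_finite_measure.borel_measurable_nn_integral[OF sigma_finite_lborel]) measurable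
qed

lemma borel_measurable_nn_heat' [measurable]:
  assumes [measurable]: "F \<in> borel_measurable borel"
  shows "nn_heat t F \<in> borel_measurable borel"
  by (rule borel_measurable_nn_heat[where F = "\<lambda>y z. F y" and f = "\<lambda>_. t" and g = "\<lambda>x. x"]) measurable

lemma nn_heat_mono: "(\<And>y. f y \<le> g y) \<Longrightarrow> nn_heat t f x \<le> nn_heat t g x"
  unfolding nn_heat_def by (intro nn_integral_mono mult_left_mono) auto

lemma nn_heat_const: "t > 0 \<Longrightarrow> nn_heat t (\<lambda>_. c) x = c"
  unfolding nn_heat_def by (simp add: nn_integral_multc nn_integral_heat_kernel_shift)

lemma nn_heat_cmult:
  assumes [measurable]: "f \<in> borel_measurable borel"
  shows "nn_heat t (\<lambda>y. c * f y) x = c * nn_heat t f x"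
  unfolding nn_heat_def by (subst nn_integral_cmult[symmetric]) (auto simp: mult_ac)

lemma nn_heat_add:
  assumes [measurable]: "f \<in> borel_measurable borel" "g \<in> borel_measurable borel"
  shows "nn_heat t (\<lambda>y. f y + g y) x = nn_heat t f x + nn_heat t g x"
  unfolding nn_heat_def by (simp add: distrib_left nn_integral_add)

lemma nn_heat_nn_heat:
  fixes x :: "'a::euclidean_space"
  assumes "t > 0" "s > 0" and [measurable]: "f \<in> borel_measurable borel"
  shows "nn_heat t (nn_heat s f) x = nn_heat (t + s) f x"
proof -
  have "nn_heat t (nn_heat s f) x =
      (\<integral>\<^sup>+y. \<integral>\<^sup>+z. ennreal (heat_kernel t (x - y)) * (ennreal (heat_kernel s (y - z)) * f z) \<partial>lborel \<partial>lborel)"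
    unfolding nn_heat_def by (intro nn_integral_cong nn_integral_cmult[symmetric]) measurable
  also have "\<dots> = (\<integral>\<^sup>+z. \<integral>\<^sup>+y. ennreal (heat_kernel t (x - y)) * (ennreal (heat_kernel s (y - z)) * f z) \<partial>lborel \<partial>lborel)"
    by (rule lborel_pair.Fubini') measurable
  also have "\<dots> = (\<integral>\<^sup>+z. (\<integral>\<^sup>+y. ennreal (heat_kernel t (x - y)) * ennreal (heat_kernel s (y - z)) \<partial>lborel) * f z \<partial>lborel)"
  proof (rule nn_integral_cong)
    fix z
    show "(\<integral>\<^sup>+y. ennreal (heat_kernel t (x - y)) * (ennreal (heat_kernel s (y - z)) * f z) \<partial>lborel)
      = (\<integral>\<^sup>+y. ennreal (heat_kernel t (x - y)) * ennreal (heat_kernel s (y - z)) \<partial>lborel) * f z"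
      by (subst nn_integral_multc[symmetric]) (measurable, simp only: mult.assoc)
  qed
  also have "\<dots> = nn_heat (t + s) f x"
    unfolding nn_heat_def using assms by (simp add: nn_integral_heat_kernel_mult)
  finally show ?thesis .
qed

text \<open>Conservation of mass, from the symmetry of the kernel. It carries smallness of the part
  of the datum above a high level to all positive times at once.\<close>

lemma nn_integral_nn_heat:
  fixes f :: "'a::euclidean_space \<Rightarrow> ennreal"
  assumes "t > 0" and [measurable]: "f \<in> borel_measurable borel"
  shows "(\<integral>\<^sup>+x. nn_heat t f x \<partial>lborel) = (\<integral>\<^sup>+x. f x \<partial>lborel)"
proof -
  have "(\<integral>\<^sup>+x. nn_heat t f x \<partial>lborel) = (\<integral>\<^sup>+y. \<integral>\<^sup>+x. ennreal (heat_kernel t (x - y)) * f y \<partial>lborel \<partial>lborel)"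
    unfolding nn_heat_def by (rule lborel_pair.Fubini') measurable
  also have "\<dots> = (\<integral>\<^sup>+y. f y \<partial>lborel)"
  proof (rule nn_integral_cong)
    fix y
    have "(\<integral>\<^sup>+x. ennreal (heat_kernel t (x - y)) * f y \<partial>lborel) = (\<integral>\<^sup>+x. ennreal (heat_kernel t (y - x)) * f y \<partial>lborel)"
      by (intro nn_integral_cong) (metis heat_kernel_minus_commute)
    also have "\<dots> = f y"
      using assms by (simp add: nn_integral_multc nn_integral_heat_kernel_shift)
    finally show "(\<integral>\<^sup>+x. ennreal (heat_kernel t (x - y)) * f y \<partial>lborel) = f y" .
  qed
  finally show ?thesis .
qed

section \<open>Convolution with kernels under Gaussian bounds\<close>

definition kernel_conv :: "(real \<Rightarrow> 'a \<Rightarrow> real) \<Rightarrow> ('a::euclidean_space \<Rightarrow> real) \<Rightarrow> real \<Rightarrow> 'a \<Rightarrow> real" where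
  "kernel_conv K f t x = (\<integral>y. K t (x - y) * f y \<partial>lborel)"

text \<open>One Gaussian bound for each compact interval of positive times holds for the heat kernel
  and for its first and second derivatives alike, and it supplies the dominating functions for all
  limits under the integral.\<close>

definition gaussian_kernel :: "(real \<Rightarrow> 'a::euclidean_space \<Rightarrow> real) \<Rightarrow> bool" where
  "gaussian_kernel K \<longleftrightarrow> (\<lambda>(t, z). K t z) \<in> borel_measurable (borel \<Otimes>\<^sub>M borel) \<and>
     continuous_on ({0<..} \<times> UNIV) (\<lambda>(t, z). K t z) \<and>
     (\<forall>a b. 0 < a \<longrightarrow> (\<exists>C c. c > 0 \<and> (\<forall>t\<in>{a..b}. \<forall>z. \<bar>K t z\<bar> \<le> C * exp (- c * (norm z)\<^sup>2))))"

lemma gaussian_kernel_measurable: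
  "gaussian_kernel K \<Longrightarrow> (\<lambda>(t, z). K t z) \<in> borel_measurable (borel \<Otimes>\<^sub>M borel)"
  by (simp add: gaussian_kernel_def)

lemma gaussian_kernel_bound:
  assumes "gaussian_kernel K" "0 < a"
  obtains C c where "C \<ge> 0" "c > 0" "\<And>t z. t \<in> {a..b} \<Longrightarrow> \<bar>K t z\<bar> \<le> C * exp (- c * (norm z)\<^sup>2)"
proof -
  obtain C c where *: "c > 0" "\<forall>t\<in>{a..b}. \<forall>z. \<bar>K t z\<bar> \<le> C * exp (- c * (norm z)\<^sup>2)"
    using assms unfolding gaussian_kernel_def by blast
  have "\<bar>K t z\<bar> \<le> max C 0 * exp (- c * (norm z)\<^sup>2)" if "t \<in> {a..b}" for t z
    using *(2)[rule_format, OF that, of z] by (rule order_trans) (simp add: mult_right_mono)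
  then show thesis using that[of "max C 0" c] * by auto
qed

text \<open>Up to a constant this Gaussian is the heat kernel at time
  \<open>1 / (4 * c)\<close>.\<close>

lemma integrable_gaussian:
  assumes "c > 0"
  shows "integrable lborel (\<lambda>z::'a::euclidean_space. exp (- c * (norm z)\<^sup>2))"
proof -
  let ?t = "1 / (4 * c)"
  have t: "?t > 0" using assms by simp
  have "integrable lborel (\<lambda>z::'a. heat_kernel ?t z)"
    by (rule integrableI_nonneg) (use t in \<open>auto simp: nn_integral_heat_kernel\<close>)
  then have "integrable lborel (\<lambda>z::'a. (4 * pi * ?t) powr (real DIM('a) / 2) * heat_kernel ?t z)"
    by simp
  moreover have "(4 * pi * ?t) powr (real DIM('a) / 2) * heat_kernel ?t (z::'a) = exp (- c * (norm z)\<^sup>2)" for z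
  proof -
    have "(4 * pi * ?t) powr (real DIM('a) / 2) * (4 * pi * ?t) powr (- real DIM('a) / 2) = 1"
      using assms by (simp add: powr_add[symmetric])
    then show ?thesis unfolding heat_kernel_def mult.assoc[symmetric] using assms by simp
  qed
  ultimately show ?thesis by (simp only:)
qed

text \<open>From \<open>(norm y)\<^sup>2 \<le> 2 * (norm (x - y))\<^sup>2 + 2 * (norm
  x)\<^sup>2\<close>: half of the rate is the price for a bound that is independent of the bounded
  shift \<open>x\<close>.\<close>

lemma gaussian_shift:
  assumes "c > 0" "norm x \<le> R"
  shows "exp (- c * (norm (x - y))\<^sup>2) \<le> exp (c * R\<^sup>2) * exp (- (c / 2) * (norm (y::'a::euclidean_space))\<^sup>2)"
proof -
  have "norm y \<le> norm (x - y) + norm x" by (metis norm_minus_commute norm_triangle_sub add.commute)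
  then have "(norm y)\<^sup>2 \<le> (norm (x - y) + norm x)\<^sup>2" by (simp add: power_mono)
  also have "\<dots> \<le> 2 * (norm (x - y))\<^sup>2 + 2 * (norm x)\<^sup>2"
    using zero_le_power2[of "norm (x - y) - norm x"] by (simp add: power2_eq_square algebra_simps)
  also have "\<dots> \<le> 2 * (norm (x - y))\<^sup>2 + 2 * R\<^sup>2"
    using assms by (simp add: power_mono)
  finally have "c * (norm y)\<^sup>2 \<le> c * (2 * (norm (x - y))\<^sup>2 + 2 * R\<^sup>2)"
    using assms by simp
  then have "- c * (norm (x - y))\<^sup>2 \<le> c * R\<^sup>2 + - (c / 2) * (norm y)\<^sup>2"
    by (simp add: algebra_simps)
  then show ?thesis by (simp add: exp_add[symmetric])
qed

lemma gaussian_kernel_dominated: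
  assumes K: "gaussian_kernel (K :: real \<Rightarrow> 'a::euclidean_space \<Rightarrow> real)" and a: "0 < a"
    and f: "f \<in> borel_measurable borel" "\<And>y. \<bar>f y\<bar> \<le> M"
  obtains B where "integrable lborel B"
    "\<And>t x y. t \<in> {a..b} \<Longrightarrow> norm x \<le> R \<Longrightarrow> \<bar>K t (x - y) * f y\<bar> \<le> B y"
proof -
  obtain C c where C: "C \<ge> 0" "c > 0" "\<And>t z. t \<in> {a..b} \<Longrightarrow> \<bar>K t z\<bar> \<le> C * exp (- c * (norm z)\<^sup>2)"
    using gaussian_kernel_bound[OF K a] by metis
  let ?B = "\<lambda>y. (C * exp (c * R\<^sup>2) * M) * exp (- (c / 2) * (norm y)\<^sup>2)"
  have M: "M \<ge> 0" using f(2)[of 0] by simp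
  have "integrable lborel ?B" using integrable_gaussian[of "c / 2"] C(2) by (intro integrable_mult_right) auto
  moreover have "\<bar>K t (x - y) * f y\<bar> \<le> ?B y" if "t \<in> {a..b}" "norm x \<le> R" for t x y
  proof -
    have "\<bar>K t (x - y)\<bar> \<le> C * (exp (c * R\<^sup>2) * exp (- (c / 2) * (norm y)\<^sup>2))"
      using C(3)[OF that(1), of "x - y"] mult_left_mono[OF gaussian_shift[OF C(2) that(2), of y] C(1)] by (rule order_trans)
    then have "\<bar>K t (x - y)\<bar> * \<bar>f y\<bar> \<le> C * (exp (c * R\<^sup>2) * exp (- (c / 2) * (norm y)\<^sup>2)) * M"
      using C(1) f(2)[of y] by (intro mult_mono) auto
    then show ?thesis by (simp add: abs_mult mult_ac)
  qed
  ultimately show thesis by (rule that)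
qed

lemma integrable_kernel_conv:
  assumes K: "gaussian_kernel (K :: real \<Rightarrow> 'a::euclidean_space \<Rightarrow> real)" and t: "0 < t"
    and f: "f \<in> borel_measurable borel" "\<And>y. \<bar>f y\<bar> \<le> M"
  shows "integrable lborel (\<lambda>y. K t (x - y) * f y)"
proof -
  obtain B where B: "integrable lborel B"
    "\<And>s x' y. s \<in> {t..t} \<Longrightarrow> norm x' \<le> norm x \<Longrightarrow> \<bar>K s (x' - y) * f y\<bar> \<le> B y"
    using gaussian_kernel_dominated[OF K t f, where b = t and R = "norm x"] by metis
  note [measurable] = f(1) gaussian_kernel_measurable[OF K]
  show ?thesis
    by (rule Bochner_Integration.integrable_bound[OF B(1)])
      (measurable, use B(2)[of t x] in \<open>auto intro!: AE_I2 intro: order_trans[OF _ abs_ge_self]\<close>)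
qed

lemma continuous_on_kernel_conv:
  assumes K: "gaussian_kernel (K :: real \<Rightarrow> 'a::euclidean_space \<Rightarrow> real)"
    and f: "f \<in> borel_measurable borel" "\<And>y. \<bar>f y\<bar> \<le> M"
  shows "continuous_on (UNIV \<times> {0<..}) (\<lambda>(x, t). kernel_conv K f t x)"
  unfolding continuous_on_def
proof
  fix z :: "'a \<times> real" assume z: "z \<in> UNIV \<times> {0<..}"
  obtain x0 t0 where z0: "z = (x0, t0)" by (cases z)
  with z have t0: "t0 > 0" by simp
  note [measurable] = f(1) gaussian_kernel_measurable[OF K]
  obtain B where B: "integrable lborel B"
    "\<And>t x y. t \<in> {t0/2..2*t0} \<Longrightarrow> norm x \<le> norm x0 + 1 \<Longrightarrow> \<bar>K t (x - y) * f y\<bar> \<le> B y"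
    using gaussian_kernel_dominated[OF K, of "t0/2" f M "2*t0" "norm x0 + 1"] t0 f by (metis half_gt_zero)
  let ?F = "\<lambda>p y. K (snd p) (fst p - y) * f y"
  have "((\<lambda>p. \<integral>y. ?F p y \<partial>lborel) \<longlongrightarrow> (\<integral>y. ?F z y \<partial>lborel)) (at z within UNIV \<times> {0<..})"
  proof (rule tendsto_integral_dominated[OF _ z _ _ B(1)])
    show "?F p \<in> borel_measurable lborel" for p by measurable
    show "AE y in lborel. ((\<lambda>p. ?F p y) \<longlongrightarrow> ?F z y) (at z within UNIV \<times> {0<..})"
    proof (rule AE_I2)
      fix y
      have "continuous_on (UNIV \<times> {0<..}) (\<lambda>p. (\<lambda>(t, z). K t z) (snd p, fst p - y))"
        by (rule continuous_on_compose2[of "{0<..} \<times> UNIV"])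
          (use K in \<open>auto simp: gaussian_kernel_def intro!: continuous_intros\<close>)
      then have "continuous_on (UNIV \<times> {0<..}) (\<lambda>p. ?F p y)"
        by (auto intro!: continuous_intros)
      then show "((\<lambda>p. ?F p y) \<longlongrightarrow> ?F z y) (at z within UNIV \<times> {0<..})"
        using z unfolding continuous_on_def by blast
    qed
    have "eventually (\<lambda>p. p \<in> ball x0 1 \<times> {t0/2<..<2*t0}) (nhds z)"
      by (rule eventually_nhds_in_open) (use t0 in \<open>auto simp: z0 intro: open_Times\<close>)
    then have "eventually (\<lambda>p. p \<in> ball x0 1 \<times> {t0/2<..<2*t0}) (at z within UNIV \<times> {0<..})"
      by (simp add: eventually_at_filter eventually_mono)
    then show "\<forall>\<^sub>F p in at z within UNIV \<times> {0<..}. \<forall>y\<in>space lborel. \<bar>?F p y\<bar> \<le> B y"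
    proof eventually_elim
      case (elim p)
      have "norm (fst p) \<le> norm x0 + 1"
        using elim norm_triangle_ineq2[of "fst p" x0] by (auto simp: dist_norm norm_minus_commute)
      then show ?case using elim by (intro ballI B(2)) auto
    qed
  qed
  then show "((\<lambda>(x, t). kernel_conv K f t x) \<longlongrightarrow> (case z of (x, t) \<Rightarrow> kernel_conv K f t x)) (at z within UNIV \<times> {0<..})"
    by (simp add: kernel_conv_def case_prod_unfold)
qed

lemma kernel_conv_space_derivative:
  assumes K: "gaussian_kernel (K :: real \<Rightarrow> 'a::euclidean_space \<Rightarrow> real)" and K': "gaussian_kernel K'"
    and d: "\<And>z h. ((\<lambda>h. K t (z + h *\<^sub>R b)) has_real_derivative K' t (z + h *\<^sub>R b)) (at h)"
    and f: "f \<in> borel_measurable borel" "\<And>y. \<bar>f y\<bar> \<le> M" and t: "t > 0"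
  shows "((\<lambda>h. kernel_conv K f t (x + h *\<^sub>R b)) has_real_derivative kernel_conv K' f t (x + a *\<^sub>R b)) (at a)"
proof -
  let ?R = "norm x + (\<bar>a\<bar> + 1) * norm b"
  obtain B where B: "integrable lborel B"
    "\<And>s x' y. s \<in> {t..t} \<Longrightarrow> norm x' \<le> ?R \<Longrightarrow> \<bar>K' s (x' - y) * f y\<bar> \<le> B y"
    using gaussian_kernel_dominated[OF K' t f, where b = t and R = ?R] by metis
  show ?thesis unfolding kernel_conv_def
  proof (rule has_derivative_integral_dominated[where d = 1 and B = B
        and F' = "\<lambda>h y. K' t (x + h *\<^sub>R b - y) * f y" and F = "\<lambda>h y. K t (x + h *\<^sub>R b - y) * f y"])
    show "integrable lborel (\<lambda>y. K t (x + h *\<^sub>R b - y) * f y)" for h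
      by (rule integrable_kernel_conv[OF K t f])
    show "((\<lambda>h. K t (x + h *\<^sub>R b - y) * f y) has_real_derivative K' t (x + h *\<^sub>R b - y) * f y) (at h)" for h y
      using DERIV_cmult_right[OF d[of "x - y" h], of "f y"] by (simp add: algebra_simps)
    show "\<bar>K' t (x + h *\<^sub>R b - y) * f y\<bar> \<le> B y" if "\<bar>h - a\<bar> < 1" for h y
    proof (rule B(2))
      have "\<bar>h\<bar> \<le> \<bar>a\<bar> + 1" using that by linarith
      then have "norm (h *\<^sub>R b) \<le> (\<bar>a\<bar> + 1) * norm b" by (simp add: mult_right_mono)
      then show "norm (x + h *\<^sub>R b) \<le> ?R" using norm_triangle_ineq[of x "h *\<^sub>R b"] by linarith
    qed simp
  qed (use B in auto)
qed

lemma kernel_conv_time_derivative: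
  assumes K: "gaussian_kernel (K :: real \<Rightarrow> 'a::euclidean_space \<Rightarrow> real)" and K': "gaussian_kernel K'"
    and d: "\<And>t z. t > 0 \<Longrightarrow> ((\<lambda>t. K t z) has_real_derivative K' t z) (at t)"
    and f: "f \<in> borel_measurable borel" "\<And>y. \<bar>f y\<bar> \<le> M" and t: "t > 0"
  shows "((\<lambda>t. kernel_conv K f t x) has_real_derivative kernel_conv K' f t x) (at t)"
proof -
  obtain B where B: "integrable lborel B"
    "\<And>s x' y. s \<in> {t/2..2*t} \<Longrightarrow> norm x' \<le> norm x \<Longrightarrow> \<bar>K' s (x' - y) * f y\<bar> \<le> B y"
    using gaussian_kernel_dominated[OF K', of "t/2" f M "2*t" "norm x"] t f by (metis half_gt_zero)
  show ?thesis unfolding kernel_conv_def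
  proof (rule has_derivative_integral_dominated[where d = "t/2" and B = B])
    show "integrable lborel (\<lambda>y. K s (x - y) * f y)" if "\<bar>s - t\<bar> < t/2" for s
      by (rule integrable_kernel_conv[OF K _ f]) (use that in linarith)
    show "((\<lambda>s. K s (x - y) * f y) has_real_derivative K' s (x - y) * f y) (at s)" if "\<bar>s - t\<bar> < t/2" for s y
      by (rule DERIV_cmult_right[OF d]) (use that in linarith)
    show "\<bar>K' s (x - y) * f y\<bar> \<le> B y" if "\<bar>s - t\<bar> < t/2" for s y
      by (rule B(2)) (use that in \<open>auto simp: abs_if split: if_splits\<close>)
  qed (use B t in auto)
qed

text \<open>A quadratic factor is absorbed by giving up half of the Gaussian decay. All derivatives
  of the heat kernel that occur here have this form.\<close>

lemma gaussian_kernel_polynomial_times_heat: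
  fixes P :: "real \<Rightarrow> 'a::euclidean_space \<Rightarrow> real"
  assumes [measurable]: "(\<lambda>(t, z). P t z) \<in> borel_measurable (borel \<Otimes>\<^sub>M borel)"
    and cont: "continuous_on ({0<..} \<times> UNIV) (\<lambda>(t, z). P t z)"
    and bnd: "\<And>a. 0 < a \<Longrightarrow> \<exists>C. \<forall>t\<ge>a. \<forall>z. \<bar>P t z\<bar> \<le> C * (1 + (norm z)\<^sup>2)"
  shows "gaussian_kernel (\<lambda>t z. P t z * heat_kernel t z)"
  unfolding gaussian_kernel_def
proof (intro conjI allI impI)
  show "(\<lambda>(t, z). P t z * heat_kernel t z) \<in> borel_measurable (borel \<Otimes>\<^sub>M borel)"
    by measurable
  have "continuous_on ({0<..} \<times> UNIV) (\<lambda>p. P (fst p) (snd p) * heat_kernel (fst p) (snd p :: 'a))"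
    using cont by (intro continuous_intros) (auto simp: case_prod_beta)
  then show "continuous_on ({0<..} \<times> UNIV) (\<lambda>(t, z). P t z * heat_kernel t (z::'a))"
    by (simp add: case_prod_beta)
  fix a b :: real assume a: "0 < a"
  obtain C where C: "\<forall>t\<ge>a. \<forall>z. \<bar>P t z\<bar> \<le> C * (1 + (norm z)\<^sup>2)" using bnd[OF a] by blast
  have C0: "C \<ge> 0" using C[rule_format, of a 0] a by simp
  \<comment> \<open>For \<open>t \<le> max a b\<close> the kernel decays at least at rate
    \<open>2 * c\<close>. One \<open>c\<close> absorbs the quadratic factor and the other
    remains.\<close>
  define c where "c = 1 / (8 * max a b)"
  have c: "c > 0" using a by (simp add: c_def)
  define D where "D = (4 * pi * a) powr (- real DIM('a) / 2)"
  have "\<bar>P t z * heat_kernel t z\<bar> \<le> C * max 1 (1/c) * D * exp (- c * (norm z)\<^sup>2)" if "t \<in> {a..b}" for t z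
  proof -
    have t: "t > 0" "t \<le> max a b" "t \<ge> a" using that a by auto
    have "1 + (norm z)\<^sup>2 \<le> max 1 (1/c) * (1 + c * (norm z)\<^sup>2)"
    proof -
      have "(norm z)\<^sup>2 = (1/c) * (c * (norm z)\<^sup>2)" using c by simp
      also have "\<dots> \<le> max 1 (1/c) * (c * (norm z)\<^sup>2)" using c by (intro mult_right_mono) auto
      finally show ?thesis unfolding distrib_left by (simp add: add_mono)
    qed
    also have "\<dots> \<le> max 1 (1/c) * exp (c * (norm z)\<^sup>2)"
      by (intro mult_left_mono exp_ge_add_one_self) auto
    finally have 1: "1 + (norm z)\<^sup>2 \<le> max 1 (1/c) * exp (c * (norm z)\<^sup>2)" .
    have 2: "heat_kernel t z \<le> D * exp (- 2 * c * (norm z)\<^sup>2)"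
    proof -
      have "(4 * pi * t) powr (- real DIM('a) / 2) \<le> D"
        unfolding D_def using t a by (intro powr_mono2') auto
      moreover have "exp (- (norm z)\<^sup>2 / (4 * t)) \<le> exp (- 2 * c * (norm z)\<^sup>2)"
      proof -
        have "2 * c \<le> 1 / (4 * t)" using t a by (simp add: c_def frac_le)
        then have "2 * c * (norm z)\<^sup>2 \<le> 1 / (4 * t) * (norm z)\<^sup>2" by (rule mult_right_mono) simp
        then show ?thesis by simp
      qed
      ultimately show ?thesis unfolding heat_kernel_def by (intro mult_mono) (auto simp: D_def)
    qed
    have "\<bar>P t z * heat_kernel t z\<bar> = \<bar>P t z\<bar> * heat_kernel t z" by (simp add: abs_mult)
    also have "\<dots> \<le> (C * (max 1 (1/c) * exp (c * (norm z)\<^sup>2))) * (D * exp (- 2 * c * (norm z)\<^sup>2))"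
      using C[rule_format, OF t(3), of z] mult_left_mono[OF 1 C0] 2 C0 by (intro mult_mono) (auto simp: D_def)
    also have "\<dots> = C * max 1 (1/c) * D * (exp (c * (norm z)\<^sup>2) * exp (- 2 * c * (norm z)\<^sup>2))" by (simp only: mult_ac)
    also have "exp (c * (norm z)\<^sup>2) * exp (- 2 * c * (norm z)\<^sup>2) = exp (- c * (norm z)\<^sup>2)"
      unfolding exp_add[symmetric] by simp
    finally show ?thesis .
  qed
  with c show "\<exists>C c. c > 0 \<and> (\<forall>t\<in>{a..b}. \<forall>z. \<bar>P t z * heat_kernel t z\<bar> \<le> C * exp (- c * (norm z)\<^sup>2))"
    by blast
qed

section \<open>Derivatives of the heat kernel in space and time\<close>

text \<open>This formula and the next one are the first and second derivative of the kernel along a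
  basis vector \<open>b\<close>. They are given in closed form so that measurability and Gaussian
  bounds can be read off.\<close>

definition heat_kernel_d :: "'a \<Rightarrow> real \<Rightarrow> 'a::euclidean_space \<Rightarrow> real" where
  "heat_kernel_d b t z = - (z \<bullet> b) / (2 * t) * heat_kernel t z"

definition heat_kernel_dd :: "'a \<Rightarrow> real \<Rightarrow> 'a::euclidean_space \<Rightarrow> real" where
  "heat_kernel_dd b t z = ((z \<bullet> b)\<^sup>2 / (4 * t\<^sup>2) - 1 / (2 * t)) * heat_kernel t z"

lemma gaussian_kernel_heat: "gaussian_kernel heat_kernel"
proof -
  have "gaussian_kernel (\<lambda>t z. 1 * heat_kernel t (z::'a))"
    by (rule gaussian_kernel_polynomial_times_heat) (auto intro!: exI[of _ 1] continuous_intros)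
  then show ?thesis by simp
qed

lemma gaussian_kernel_heat_d:
  assumes "b \<in> Basis" shows "gaussian_kernel (heat_kernel_d b)"
  unfolding heat_kernel_d_def
proof (rule gaussian_kernel_polynomial_times_heat)
  show "continuous_on ({0<..} \<times> UNIV) (\<lambda>(t, z). - (z \<bullet> b) / (2 * t))"
    unfolding case_prod_beta by (intro continuous_intros) auto
  fix a :: real assume a: "0 < a"
  have "\<bar>- (z \<bullet> b) / (2 * t)\<bar> \<le> 1 / a * (1 + (norm z)\<^sup>2)" if "t \<ge> a" for t z
  proof -
    have "\<bar>z \<bullet> b\<bar> \<le> norm z" using assms by (simp add: Basis_le_norm)
    also have "\<dots> \<le> 1 + (norm z)\<^sup>2"
    proof -
      have "2 * norm z \<le> (norm z)\<^sup>2 + 1" using zero_le_power2[of "norm z - 1"] by (simp add: power2_diff)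
      then show ?thesis using norm_ge_zero[of z] by linarith
    qed
    finally have "\<bar>z \<bullet> b\<bar> * (1 / (2 * t)) \<le> (1 + (norm z)\<^sup>2) * (1 / a)"
      using that a by (intro mult_mono) (auto simp: frac_le)
    then show ?thesis using that a by (simp add: abs_divide mult.commute)
  qed
  then show "\<exists>C. \<forall>t\<ge>a. \<forall>z. \<bar>- (z \<bullet> b) / (2 * t)\<bar> \<le> C * (1 + (norm z)\<^sup>2)" by blast
qed measurable

lemma heat_kernel_dd_coeff_bound:
  assumes b: "b \<in> Basis" and a: "0 < a" and that: "t \<ge> a"
  shows "\<bar>(z \<bullet> b)\<^sup>2 / (4 * t\<^sup>2) - 1 / (2 * t)\<bar> \<le> (1 / a\<^sup>2 + 1 / a) * (1 + (norm (z::'a::euclidean_space))\<^sup>2)"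
proof -
  have "\<bar>z \<bullet> b\<bar>\<^sup>2 \<le> (norm z)\<^sup>2" using b by (intro power_mono) (auto simp: Basis_le_norm)
  then have "(z \<bullet> b)\<^sup>2 / (4 * t\<^sup>2) \<le> (norm z)\<^sup>2 / a\<^sup>2"
  proof (intro frac_le)
    show "a\<^sup>2 \<le> 4 * t\<^sup>2" using that a power_mono[of a t 2] zero_le_power2[of t] by linarith
  qed (use a in auto)
  moreover have "1 / (2 * t) \<le> 1 / a" using that a by (simp add: frac_le)
  moreover have "0 \<le> (z \<bullet> b)\<^sup>2 / (4 * t\<^sup>2)" "0 \<le> 1 / (2 * t)" using that a by auto
  moreover have "(1 / a\<^sup>2 + 1 / a) * (1 + (norm z)\<^sup>2) = (norm z)\<^sup>2 / a\<^sup>2 + 1 / a + 1 / a\<^sup>2 + (norm z)\<^sup>2 / a"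
    by (simp add: algebra_simps)
  moreover have "0 \<le> 1 / a\<^sup>2 + (norm z)\<^sup>2 / a" using a by simp
  ultimately show ?thesis by linarith
qed

lemma gaussian_kernel_heat_dd:
  assumes "b \<in> Basis" shows "gaussian_kernel (heat_kernel_dd b)"
  unfolding heat_kernel_dd_def
proof (rule gaussian_kernel_polynomial_times_heat)
  show "continuous_on ({0<..} \<times> UNIV) (\<lambda>(t, z). (z \<bullet> b)\<^sup>2 / (4 * t\<^sup>2) - 1 / (2 * t))"
    unfolding case_prod_beta by (intro continuous_intros) auto
  fix a :: real assume a: "0 < a"
  show "\<exists>C. \<forall>t\<ge>a. \<forall>z. \<bar>(z \<bullet> b)\<^sup>2 / (4 * t\<^sup>2) - 1 / (2 * t)\<bar> \<le> C * (1 + (norm z)\<^sup>2)"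
    using heat_kernel_dd_coeff_bound[OF assms a] by blast
qed measurable

lemma heat_kernel_space_derivative:
  assumes b: "b \<in> Basis"
  shows "((\<lambda>h. heat_kernel t (z + h *\<^sub>R b)) has_real_derivative heat_kernel_d b t (z + h *\<^sub>R b)) (at h)"
proof -
  have n: "(norm (z + h *\<^sub>R b))\<^sup>2 = z \<bullet> z + 2 * h * (z \<bullet> b) + h\<^sup>2" for h
    unfolding power2_norm_eq_inner using b
    by (simp add: inner_add_left inner_add_right inner_commute power2_eq_square algebra_simps)
  have i: "(z + h *\<^sub>R b) \<bullet> b = z \<bullet> b + h" using b by (simp add: inner_add_left)
  show ?thesis unfolding heat_kernel_def heat_kernel_d_def n i
    by (cases "t = 0") (auto intro!: derivative_eq_intros simp: field_simps)
qed

lemma heat_kernel_d_space_derivative: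
  assumes b: "b \<in> Basis"
  shows "((\<lambda>h. heat_kernel_d b t (z + h *\<^sub>R b)) has_real_derivative heat_kernel_dd b t (z + h *\<^sub>R b)) (at h)"
proof -
  have i: "(z + h *\<^sub>R b) \<bullet> b = z \<bullet> b + h" for h using b by (simp add: inner_add_left)
  show ?thesis unfolding heat_kernel_d_def heat_kernel_dd_def i
    by (cases "t = 0") (auto intro!: derivative_eq_intros heat_kernel_space_derivative[OF b]
        simp: heat_kernel_d_def i field_simps power2_eq_square)
qed

text \<open>The heat equation for the kernel. The right hand side is left as a sum over
  \<open>Basis\<close>, ready to be split by linearity of the convolution.\<close>

lemma heat_kernel_time_derivative:
  assumes t: "t > 0"
  shows "((\<lambda>t. heat_kernel t z) has_real_derivative (\<Sum>b\<in>Basis. heat_kernel_dd b t (z::'a::euclidean_space))) (at t)"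
proof -
  have "(\<Sum>b\<in>Basis. heat_kernel_dd b t z) = ((norm z)\<^sup>2 / (4 * t\<^sup>2) - real DIM('a) / (2 * t)) * heat_kernel t z"
    by (simp add: heat_kernel_dd_def sum_distrib_right[symmetric] sum_subtractf sum_divide_distrib[symmetric]
        power2_norm_eq_inner euclidean_inner[of z z]) (simp add: power2_eq_square)
  moreover have "((\<lambda>t. heat_kernel t z) has_real_derivative
      ((norm z)\<^sup>2 / (4 * t\<^sup>2) - real DIM('a) / (2 * t)) * heat_kernel t z) (at t)"
  proof -
    have 1: "((\<lambda>t. (4 * pi * t) powr (- real DIM('a) / 2)) has_real_derivative
        (- real DIM('a) / (2 * t)) * (4 * pi * t) powr (- real DIM('a) / 2)) (at t)"
    proof -
      have "((\<lambda>t. (4 * pi * t) powr (- real DIM('a) / 2)) has_real_derivative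
          (- real DIM('a) / 2) * (4 * pi * t) powr (- real DIM('a) / 2 - 1) * (4 * pi)) (at t)"
        using t by (auto intro!: derivative_eq_intros)
      moreover have "(- real DIM('a) / 2) * (4 * pi * t) powr (- real DIM('a) / 2 - 1) * (4 * pi)
         = (- real DIM('a) / (2 * t)) * (4 * pi * t) powr (- real DIM('a) / 2)"
        unfolding powr_diff using t by simp
      ultimately show ?thesis by (rule DERIV_cong)
    qed
    have 2: "((\<lambda>t. exp (- (norm z)\<^sup>2 / (4 * t))) has_real_derivative
        (norm z)\<^sup>2 / (4 * t\<^sup>2) * exp (- (norm z)\<^sup>2 / (4 * t))) (at t)"
      using t by (auto intro!: derivative_eq_intros simp: power2_eq_square field_simps)
    show ?thesis unfolding heat_kernel_def
      by (rule DERIV_cong[OF DERIV_mult[OF 1 2]]) (simp add: algebra_simps)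
  qed
  ultimately show ?thesis by simp
qed

section \<open>Estimates for the heat flow of bounded functions and for its gradient\<close>

lemma lborel_distr_reflect: "distr lborel borel (\<lambda>y. x - y) = (lborel :: 'a::euclidean_space measure)"
proof -
  have "(lborel :: 'a measure) = density (distr lborel borel (\<lambda>y. x + (- 1) *\<^sub>R y)) (\<lambda>_. \<bar>- 1 :: real\<bar> ^ DIM('a))"
    by (rule lborel_affine) simp
  then show ?thesis by (simp add: density_1)
qed

lemma kernel_conv_reflect:
  assumes K: "gaussian_kernel K" and [measurable]: "f \<in> borel_measurable borel"
  shows "kernel_conv K f t x = (\<integral>z. K t z * f (x - z) \<partial>lborel)"
proof -
  note [measurable] = gaussian_kernel_measurable[OF K]
  have "(\<integral>y. K t (x - y) * f y \<partial>distr lborel borel (\<lambda>y. x - y)) = (\<integral>z. K t (x - (x - z)) * f (x - z) \<partial>lborel)"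
    by (rule integral_distr) measurable
  then show ?thesis unfolding kernel_conv_def lborel_distr_reflect by simp
qed

lemma integrable_heat_kernel:
  "t > 0 \<Longrightarrow> integrable lborel (\<lambda>y. heat_kernel t (x - y :: 'a::euclidean_space))"
  "t > 0 \<Longrightarrow> integrable lborel (\<lambda>z :: 'a. heat_kernel t z)"
  by (auto intro!: integrableI_nonneg simp: nn_integral_heat_kernel nn_integral_heat_kernel_shift)

lemma integral_heat_kernel:
  "t > 0 \<Longrightarrow> (\<integral>y. heat_kernel t (x - y :: 'a::euclidean_space) \<partial>lborel) = 1"
  "t > 0 \<Longrightarrow> (\<integral>z. heat_kernel t (z :: 'a) \<partial>lborel) = 1"
  by (auto simp: integral_eq_nn_integral nn_integral_heat_kernel nn_integral_heat_kernel_shift)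

text \<open>In the scaled radius \<open>r = norm z / sqrt t\<close> half of the exponent absorbs the
  factor \<open>r\<close>. What remains of the exponent is that of the kernel at time
  \<open>2 * t\<close>.\<close>

lemma norm_times_heat_kernel_le:
  assumes t: "t > 0"
  shows "norm z * heat_kernel t z \<le> 2 * 2 powr (real DIM('a) / 2) * sqrt t * heat_kernel (2 * t) (z::'a::euclidean_space)"
proof -
  define r where "r = norm z / sqrt t"
  have r: "norm z = r * sqrt t" "(norm z)\<^sup>2 = r\<^sup>2 * t" "r \<ge> 0"
    using t by (auto simp: r_def power_divide)
  have "r \<le> 2 * (1 + r\<^sup>2 / 8)"
    using zero_le_power2[of "r - 2"] by (simp add: power2_diff)
  also have "\<dots> \<le> 2 * exp (r\<^sup>2 / 8)" by (intro mult_left_mono exp_ge_add_one_self) simp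
  finally have "r * exp (- r\<^sup>2 / 4) \<le> 2 * exp (r\<^sup>2 / 8) * exp (- r\<^sup>2 / 4)"
    by (rule mult_right_mono) simp
  also have "\<dots> = 2 * exp (- r\<^sup>2 / 8)" by (simp add: exp_add[symmetric])
  finally have 1: "r * exp (- r\<^sup>2 / 4) \<le> 2 * exp (- r\<^sup>2 / 8)" .
  have 2: "(4 * pi * t) powr (- real DIM('a) / 2) = 2 powr (real DIM('a) / 2) * (4 * pi * (2 * t)) powr (- real DIM('a) / 2)"
  proof -
    have "(4 * pi * (2 * t)) powr (- real DIM('a) / 2) = 2 powr (- real DIM('a) / 2) * (4 * pi * t) powr (- real DIM('a) / 2)"
      using t by (simp add: powr_mult[symmetric])
    moreover have "2 powr (real DIM('a) / 2) * 2 powr (- real DIM('a) / 2) = (1::real)"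
      by (simp add: powr_add[symmetric])
    ultimately show ?thesis by simp
  qed
  have "norm z * heat_kernel t z = (4 * pi * t) powr (- real DIM('a) / 2) * sqrt t * (r * exp (- r\<^sup>2 / 4))"
    unfolding heat_kernel_def r(2) unfolding r(1) using t by simp
  also have "\<dots> \<le> (4 * pi * t) powr (- real DIM('a) / 2) * sqrt t * (2 * exp (- r\<^sup>2 / 8))"
    using 1 t by (intro mult_left_mono) auto
  also have "\<dots> = 2 * 2 powr (real DIM('a) / 2) * sqrt t * heat_kernel (2 * t) z"
    unfolding heat_kernel_def r(2) 2 using t by simp
  finally show ?thesis .
qed

text \<open>A space derivative costs \<open>t powr (- 1/2)\<close>. This is integrable at
  \<open>0\<close>, which is why one derivative may stay on the kernel inside a Duhamel
  integral.\<close>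

lemma abs_heat_kernel_d_le:
  assumes t: "t > 0" and b: "b \<in> Basis"
  shows "\<bar>heat_kernel_d b t z\<bar> \<le> 2 powr (real DIM('a) / 2) * t powr (- 1/2) * heat_kernel (2 * t) (z::'a::euclidean_space)"
proof -
  have "\<bar>heat_kernel_d b t z\<bar> = \<bar>z \<bullet> b\<bar> / (2 * t) * heat_kernel t z"
    using t by (simp add: heat_kernel_d_def abs_mult abs_divide)
  also have "\<dots> \<le> norm z / (2 * t) * heat_kernel t z"
    using t b by (intro mult_right_mono divide_right_mono) (auto simp: Basis_le_norm)
  also have "\<dots> = (norm z * heat_kernel t z) / (2 * t)" by simp
  also have "\<dots> \<le> (2 * 2 powr (real DIM('a) / 2) * sqrt t * heat_kernel (2 * t) z) / (2 * t)"
    using t by (intro divide_right_mono norm_times_heat_kernel_le) auto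
  also have "\<dots> = 2 powr (real DIM('a) / 2) * (sqrt t / t) * heat_kernel (2 * t) z"
    by simp
  also have "sqrt t / t = t powr (- 1/2)"
    using t by (simp add: powr_minus_divide powr_half_sqrt field_simps)
  finally show ?thesis .
qed

lemma norm_heat_kernel_times_le:
  assumes "\<And>y. \<bar>f y\<bar> \<le> M"
  shows "norm (heat_kernel t z * f y) \<le> norm (M * heat_kernel t z)"
  using mult_right_mono[OF order_trans[OF assms abs_ge_self], of "heat_kernel t z" y] by (simp add: abs_mult mult.commute)

lemma kernel_conv_abs_le:
  assumes K: "gaussian_kernel (K :: real \<Rightarrow> 'a::euclidean_space \<Rightarrow> real)" and t: "0 < t" and s: "s > 0"
    and le: "\<And>z. \<bar>K t z\<bar> \<le> C * heat_kernel s z"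
    and f: "f \<in> borel_measurable borel" "\<And>y. \<bar>f y\<bar> \<le> M"
  shows "\<bar>kernel_conv K f t x\<bar> \<le> C * M"
proof -
  have "\<bar>kernel_conv K f t x\<bar> \<le> (\<integral>y. \<bar>K t (x - y) * f y\<bar> \<partial>lborel)"
    unfolding kernel_conv_def by (rule integral_abs_bound)
  also have "\<dots> \<le> (\<integral>y. C * M * heat_kernel s (x - y) \<partial>lborel)"
  proof (rule integral_mono)
    show "integrable lborel (\<lambda>y. \<bar>K t (x - y) * f y\<bar>)"
      by (intro integrable_abs integrable_kernel_conv[OF K t f])
    show "integrable lborel (\<lambda>y. C * M * heat_kernel s (x - y))"
      using s by (simp add: integrable_heat_kernel)
    fix y
    have "\<bar>K t (x - y)\<bar> * \<bar>f y\<bar> \<le> (C * heat_kernel s (x - y)) * M"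
      using le f(2) by (intro mult_mono order_trans[OF abs_ge_zero le]) auto
    then show "\<bar>K t (x - y) * f y\<bar> \<le> C * M * heat_kernel s (x - y)" by (simp add: abs_mult mult_ac)
  qed
  also have "\<dots> = C * M" using s by (simp add: integral_heat_kernel)
  finally show ?thesis .
qed

lemma abs_kernel_conv_heat_le:
  assumes "0 < t" "f \<in> borel_measurable borel" "\<And>y. \<bar>f y\<bar> \<le> M"
  shows "\<bar>kernel_conv heat_kernel f t (x::'a::euclidean_space)\<bar> \<le> M"
  using kernel_conv_abs_le[OF gaussian_kernel_heat assms(1) assms(1) _ assms(2,3), of 1] by simp

lemma abs_kernel_conv_heat_d_le:
  assumes "0 < t" "b \<in> Basis" "f \<in> borel_measurable borel" "\<And>y. \<bar>f y\<bar> \<le> M"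
  shows "\<bar>kernel_conv (heat_kernel_d b) f t (x::'a::euclidean_space)\<bar> \<le> 2 powr (real DIM('a) / 2) * t powr (- 1/2) * M"
  by (rule kernel_conv_abs_le[OF gaussian_kernel_heat_d[OF assms(2)] assms(1) _ abs_heat_kernel_d_le[OF assms(1,2)] assms(3,4)])
    (use assms in simp)

text \<open>The affine modulus serves two purposes: \<open>\<alpha> = 0\<close> for Lipschitz
  functions, and a small \<open>\<alpha>\<close> for bounded uniformly continuous ones, where the
  linear term pays for distant points.\<close>

lemma kernel_conv_heat_near:
  assumes t: "t > 0" and f: "f \<in> borel_measurable borel" "\<And>y. \<bar>f y\<bar> \<le> M"
    and near: "\<And>z. \<bar>f (x - z) - f x\<bar> \<le> \<alpha> + \<beta> * norm z" and \<beta>: "\<beta> \<ge> 0"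
  shows "\<bar>kernel_conv heat_kernel f t x - f (x::'a::euclidean_space)\<bar> \<le> \<alpha> + \<beta> * (2 * 2 powr (real DIM('a) / 2) * sqrt t)"
proof -
  note [measurable] = f(1)
  have int: "integrable lborel (\<lambda>z. heat_kernel t z * f (x - z))"
  proof (rule Bochner_Integration.integrable_bound[where f = "\<lambda>z. M * heat_kernel t z"])
    show "AE z in lborel. norm (heat_kernel t z * f (x - z)) \<le> norm (M * heat_kernel t z)"
      using norm_heat_kernel_times_le[OF f(2)] by (intro AE_I2)
  qed (use t in \<open>auto simp: integrable_heat_kernel\<close>)
  have "kernel_conv heat_kernel f t x - f x = (\<integral>z. heat_kernel t z * f (x - z) \<partial>lborel) - (\<integral>z. heat_kernel t (z::'a) * f x \<partial>lborel)"
    using t by (simp add: kernel_conv_reflect[OF gaussian_kernel_heat f(1)] integral_heat_kernel)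
  also have "\<dots> = (\<integral>z. heat_kernel t z * (f (x - z) - f x) \<partial>lborel)"
    using int t by (simp add: right_diff_distrib integrable_heat_kernel)
  finally have "\<bar>kernel_conv heat_kernel f t x - f x\<bar> \<le> (\<integral>z. \<bar>heat_kernel t z * (f (x - z) - f x)\<bar> \<partial>lborel)"
    by (simp only: integral_abs_bound)
  also have "\<dots> \<le> (\<integral>z. \<alpha> * heat_kernel t z + \<beta> * (2 * 2 powr (real DIM('a) / 2) * sqrt t) * heat_kernel (2 * t) (z::'a) \<partial>lborel)"
  proof (rule integral_mono)
    show "integrable lborel (\<lambda>z. \<bar>heat_kernel t z * (f (x - z) - f x)\<bar>)"
      unfolding right_diff_distrib using int t by (intro integrable_abs Bochner_Integration.integrable_diff) (auto simp: integrable_heat_kernel)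
    show "integrable lborel (\<lambda>z::'a. \<alpha> * heat_kernel t z + \<beta> * (2 * 2 powr (real DIM('a) / 2) * sqrt t) * heat_kernel (2 * t) z)"
      using t by (intro Bochner_Integration.integrable_add integrable_mult_right integrable_heat_kernel) auto
    fix z
    have "\<bar>heat_kernel t z * (f (x - z) - f x)\<bar> \<le> heat_kernel t z * (\<alpha> + \<beta> * norm z)"
      using near[of z] by (simp add: abs_mult mult_left_mono)
    also have "\<dots> = \<alpha> * heat_kernel t z + \<beta> * (norm z * heat_kernel t z)" by (simp add: algebra_simps)
    also have "\<dots> \<le> \<alpha> * heat_kernel t z + \<beta> * (2 * 2 powr (real DIM('a) / 2) * sqrt t * heat_kernel (2 * t) z)"
      using norm_times_heat_kernel_le[OF t] \<beta> by (intro add_left_mono mult_left_mono) auto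
    finally show "\<bar>heat_kernel t z * (f (x - z) - f x)\<bar> \<le> \<alpha> * heat_kernel t z + \<beta> * (2 * 2 powr (real DIM('a) / 2) * sqrt t) * heat_kernel (2 * t) z"
      by (simp only: mult.assoc)
  qed
  also have "\<dots> = \<alpha> + \<beta> * (2 * 2 powr (real DIM('a) / 2) * sqrt t)"
    using t by (subst Bochner_Integration.integral_add) (auto simp: integral_heat_kernel integrable_heat_kernel)
  finally show ?thesis .
qed

text \<open>Both sides differentiate the same convolution, once through the kernel and once, after
  reflection, through \<open>f\<close>. Uniqueness of the derivative takes the place of an
  integration by parts.\<close>

lemma kernel_conv_heat_d_eq:
  assumes t: "t > 0" and b: "b \<in> Basis" and f: "f \<in> borel_measurable borel" "\<And>y. \<bar>f y\<bar> \<le> M"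
    and d: "\<And>y. ((\<lambda>h. f (y + h *\<^sub>R b)) has_real_derivative f' y) (at 0)"
    and f': "f' \<in> borel_measurable borel" "\<And>y. \<bar>f' y\<bar> \<le> M'"
  shows "kernel_conv (heat_kernel_d b) f t x = kernel_conv heat_kernel f' t (x::'a::euclidean_space)"
proof -
  note [measurable] = f(1) f'(1)
  have 1: "((\<lambda>h. kernel_conv heat_kernel f t (x + h *\<^sub>R b)) has_real_derivative kernel_conv (heat_kernel_d b) f t x) (at 0)"
    using kernel_conv_space_derivative[OF gaussian_kernel_heat gaussian_kernel_heat_d[OF b] heat_kernel_space_derivative[OF b] f t, of x 0]
    by simp
  have 2: "((\<lambda>h. \<integral>z. heat_kernel t z * f (x + h *\<^sub>R b - z) \<partial>lborel) has_real_derivative (\<integral>z. heat_kernel t z * f' (x + 0 *\<^sub>R b - z) \<partial>lborel)) (at 0)"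
  proof (rule has_derivative_integral_dominated[where d = 1 and B = "\<lambda>z. M' * heat_kernel t z"
        and F' = "\<lambda>h z. heat_kernel t z * f' (x + h *\<^sub>R b - z)" and F = "\<lambda>h z. heat_kernel t z * f (x + h *\<^sub>R b - z)"])
    show "integrable lborel (\<lambda>z. heat_kernel t z * f (x + h *\<^sub>R b - z))" for h
    proof (rule Bochner_Integration.integrable_bound[where f = "\<lambda>z. M * heat_kernel t z"])
      show "AE z in lborel. norm (heat_kernel t z * f (x + h *\<^sub>R b - z)) \<le> norm (M * heat_kernel t z)"
        using norm_heat_kernel_times_le[OF f(2)] by (intro AE_I2)
    qed (use t in \<open>auto simp: integrable_heat_kernel\<close>)
    show "((\<lambda>h. heat_kernel t z * f (x + h *\<^sub>R b - z)) has_real_derivative heat_kernel t z * f' (x + h *\<^sub>R b - z)) (at h)" for h z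
    proof (rule DERIV_cmult)
      have "((\<lambda>k. f ((x + h *\<^sub>R b - z) + k *\<^sub>R b)) has_real_derivative f' (x + h *\<^sub>R b - z)) (at (h - h))"
        using d by simp
      then have "((\<lambda>h'. f ((x + h *\<^sub>R b - z) + (h' + - h) *\<^sub>R b)) has_real_derivative f' (x + h *\<^sub>R b - z)) (at h)"
        unfolding diff_conv_add_uminus DERIV_shift .
      then show "((\<lambda>h. f (x + h *\<^sub>R b - z)) has_real_derivative f' (x + h *\<^sub>R b - z)) (at h)"
        by (simp add: algebra_simps)
    qed
    show "\<bar>heat_kernel t z * f' (x + h *\<^sub>R b - z)\<bar> \<le> M' * heat_kernel t z" for h z
      using f'(2)[of "x + h *\<^sub>R b - z"] by (simp add: abs_mult mult.commute[of M'] mult_left_mono)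
  qed (use t in \<open>auto simp: integrable_heat_kernel\<close>)
  from DERIV_unique[OF 1 2[folded kernel_conv_reflect[OF gaussian_kernel_heat f(1)]]]
  show ?thesis by (simp add: kernel_conv_reflect[OF gaussian_kernel_heat f'(1)])
qed

lemma borel_measurable_kernel_conv:
  fixes K :: "real \<Rightarrow> 'a::euclidean_space \<Rightarrow> real"
  assumes K: "gaussian_kernel K" and g: "(\<lambda>(y, s). g y s) \<in> borel_measurable (borel \<Otimes>\<^sub>M borel)"
    and [measurable]: "a \<in> borel_measurable N" "b \<in> borel_measurable N" "c \<in> borel_measurable N"
  shows "(\<lambda>z. kernel_conv K (\<lambda>y. g y (a z)) (b z) (c z)) \<in> borel_measurable N"
proof -
  note [measurable] = gaussian_kernel_measurable[OF K] g
  show ?thesis unfolding kernel_conv_def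
    by (rule sigma_finite_measure.borel_measurable_lebesgue_integral[OF sigma_finite_lborel]) measurable
qed

text \<open>By the heat equation the time derivative puts two space derivatives on the kernel.
  Moving one of them to \<open>f\<close> leaves a bound of order \<open>t powr (- 1/2)\<close>,
  integrable at \<open>t = 0\<close>, which \<open>heat_conv_increment\<close> relies on.\<close>

lemma heat_conv_time_derivative:
  fixes f :: "'a::euclidean_space \<Rightarrow> real"
  assumes t: "t > 0" and f: "f \<in> borel_measurable borel" "\<And>y. \<bar>f y\<bar> \<le> M"
    and d: "\<And>y b. b \<in> Basis \<Longrightarrow> ((\<lambda>h. f (y + h *\<^sub>R b)) has_real_derivative f' b y) (at 0)"
    and f': "\<And>b. b \<in> Basis \<Longrightarrow> f' b \<in> borel_measurable borel" "\<And>b y. b \<in> Basis \<Longrightarrow> \<bar>f' b y\<bar> \<le> M'"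
  shows "((\<lambda>t. kernel_conv heat_kernel f t x) has_real_derivative
    (\<Sum>b\<in>Basis. kernel_conv (heat_kernel_d b) (f' b) t x)) (at t)"
proof -
  let ?S = "\<lambda>t (z::'a). \<Sum>b\<in>Basis. heat_kernel_dd b t z"
  have S: "gaussian_kernel ?S"
  proof -
    let ?P = "\<lambda>t (z::'a). \<Sum>b\<in>Basis. ((z \<bullet> b)\<^sup>2 / (4 * t\<^sup>2) - 1 / (2 * t))"
    have "gaussian_kernel (\<lambda>t z. ?P t z * heat_kernel t z)"
    proof (rule gaussian_kernel_polynomial_times_heat)
      show "continuous_on ({0<..} \<times> UNIV) (\<lambda>(t, z). ?P t z)"
        unfolding case_prod_beta by (intro continuous_intros) auto
      show "(\<lambda>(t, z). ?P t z) \<in> borel_measurable (borel \<Otimes>\<^sub>M borel)" by measurable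
      fix a :: real assume a: "0 < a"
      have "\<bar>?P t z\<bar> \<le> (real DIM('a) * (1 / a\<^sup>2 + 1 / a)) * (1 + (norm z)\<^sup>2)" if "t \<ge> a" for t z
      proof -
        have "\<bar>(z \<bullet> b)\<^sup>2 / (4 * t\<^sup>2) - 1 / (2 * t)\<bar> \<le> (1 / a\<^sup>2 + 1 / a) * (1 + (norm z)\<^sup>2)" if b: "b \<in> Basis" for b
          using heat_kernel_dd_coeff_bound[OF b a \<open>t \<ge> a\<close>] .
        then have "(\<Sum>b\<in>(Basis::'a set). \<bar>(z \<bullet> b)\<^sup>2 / (4 * t\<^sup>2) - 1 / (2 * t)\<bar>) \<le> real DIM('a) * ((1 / a\<^sup>2 + 1 / a) * (1 + (norm z)\<^sup>2))"
          by (intro sum_bounded_above) auto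
        then show ?thesis unfolding mult.assoc by (rule order_trans[OF sum_abs])
      qed
      then show "\<exists>C. \<forall>t\<ge>a. \<forall>z. \<bar>?P t z\<bar> \<le> C * (1 + (norm z)\<^sup>2)" by blast
    qed
    then show ?thesis by (simp only: heat_kernel_dd_def sum_distrib_right)
  qed
  have "((\<lambda>t. kernel_conv heat_kernel f t x) has_real_derivative kernel_conv ?S f t x) (at t)"
    by (rule kernel_conv_time_derivative[OF gaussian_kernel_heat S heat_kernel_time_derivative f t])
  also have "kernel_conv ?S f t x = (\<Sum>b\<in>Basis. kernel_conv (heat_kernel_dd b) f t x)"
    unfolding kernel_conv_def sum_distrib_right
    by (rule Bochner_Integration.integral_sum) (rule integrable_kernel_conv[OF gaussian_kernel_heat_dd t f])
  also have "\<dots> = (\<Sum>b\<in>Basis. kernel_conv (heat_kernel_d b) (f' b) t x)"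
  proof (rule sum.cong[OF refl])
    fix b :: 'a assume b: "b \<in> Basis"
    note Kd = gaussian_kernel_heat_d[OF b]
    have "((\<lambda>h. kernel_conv (heat_kernel_d b) f t (x + h *\<^sub>R b)) has_real_derivative kernel_conv (heat_kernel_dd b) f t x) (at 0)"
      using kernel_conv_space_derivative[OF Kd gaussian_kernel_heat_dd[OF b] heat_kernel_d_space_derivative[OF b] f t, of x 0]
      by simp
    moreover have "((\<lambda>h. kernel_conv heat_kernel (f' b) t (x + h *\<^sub>R b)) has_real_derivative kernel_conv (heat_kernel_d b) (f' b) t x) (at 0)"
      using kernel_conv_space_derivative[OF gaussian_kernel_heat Kd heat_kernel_space_derivative[OF b] f'[OF b] t, of x 0]
      by simp
    moreover have "kernel_conv (heat_kernel_d b) f t z = kernel_conv heat_kernel (f' b) t z" for z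
      by (rule kernel_conv_heat_d_eq[OF t b f d[OF b] f'[OF b]])
    ultimately show "kernel_conv (heat_kernel_dd b) f t x = kernel_conv (heat_kernel_d b) (f' b) t x"
      by (simp add: DERIV_unique)
  qed
  finally show ?thesis .
qed

subsection \<open>Duhamel integrals\<close>

lemma singular_weight_integral:
  assumes "a \<le> (t::real)"
  shows "(\<integral>\<^sup>+s. ennreal (indicator {a<..<t} s * (1 + (t - s) powr (- 1/2))) \<partial>lborel) = ennreal (t - a + 2 * sqrt (t - a))"
    (is "nn_integral _ (\<lambda>s. ennreal (?f s)) = _")
proof (rule nn_integral_has_integral_lborel)
  have "((\<lambda>s. 1 + (t - s) powr (- 1/2)) has_integral ((t - 2 * sqrt (t - t)) - (a - 2 * sqrt (t - a)))) {a..t}"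
  proof (rule fundamental_theorem_of_calculus_interior[OF assms])
    show "continuous_on {a..t} (\<lambda>s. s - 2 * sqrt (t - s))" by (intro continuous_intros)
    show "((\<lambda>s. s - 2 * sqrt (t - s)) has_vector_derivative 1 + (t - s) powr (- 1/2)) (at s)" if "s \<in> {a<..<t}" for s
      unfolding has_real_derivative_iff_has_vector_derivative[symmetric]
      using that by (auto intro!: derivative_eq_intros simp: powr_minus_divide powr_half_sqrt field_simps)
  qed
  then have "((\<lambda>s. 1 + (t - s) powr (- 1/2)) has_integral (t - a + 2 * sqrt (t - a))) {a<..<t}"
    unfolding has_integral_Icc_iff_Ioo by (simp add: algebra_simps)
  then have "((\<lambda>s. if s \<in> {a<..<t} then 1 + (t - s) powr (- 1/2) else 0) has_integral (t - a + 2 * sqrt (t - a))) UNIV"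
    by (simp only: has_integral_restrict_UNIV)
  moreover have "(\<lambda>s. if s \<in> {a<..<t} then 1 + (t - s) powr (- 1/2) else 0) = ?f"
    by (auto simp: indicator_def)
  ultimately show "(?f has_integral (t - a + 2 * sqrt (t - a))) UNIV" by simp
qed (auto simp: indicator_def)

lemma integrable_singular_weight:
  assumes "a \<le> (t::real)"
  shows "integrable lborel (\<lambda>s. indicator {a<..<t} s * (1 + (t - s) powr (- 1/2)))"
  using singular_weight_integral[OF assms] by (intro integrableI_nonneg) auto

lemma integral_singular_weight:
  assumes "a \<le> (t::real)"
  shows "(\<integral>s. indicator {a<..<t} s * (1 + (t - s) powr (- 1/2)) \<partial>lborel) = t - a + 2 * sqrt (t - a)"
proof -
  have "(\<integral>s. indicator {a<..<t} s * (1 + (t - s) powr (- 1/2)) \<partial>lborel) =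
      enn2real (\<integral>\<^sup>+s. ennreal (indicator {a<..<t} s * (1 + (t - s) powr (- 1/2))) \<partial>lborel)"
    by (rule integral_eq_nn_integral) auto
  also have "\<dots> = t - a + 2 * sqrt (t - a)"
    unfolding singular_weight_integral[OF assms] using assms by (intro enn2real_ennreal) auto
  finally show ?thesis .
qed

text \<open>The summand \<open>1\<close> accommodates the heat kernel and the power its first
  derivatives, so both share the Duhamel estimates. Second derivatives scale like
  \<open>1 / t\<close> and fall outside; before a second derivative is taken, the first one is
  therefore moved onto the source.\<close>

definition weakly_singular :: "(real \<Rightarrow> 'a::euclidean_space \<Rightarrow> real) \<Rightarrow> real \<Rightarrow> bool" where
  "weakly_singular K C \<longleftrightarrow> gaussian_kernel K \<and> C \<ge> 0 \<and>
     (\<forall>t>0. \<forall>f M x. f \<in> borel_measurable borel \<longrightarrow> (\<forall>y. \<bar>f y\<bar> \<le> M) \<longrightarrow>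
        \<bar>kernel_conv K f t x\<bar> \<le> C * M * (1 + t powr (- 1/2)))"

lemma weakly_singular_heat: "weakly_singular (heat_kernel :: real \<Rightarrow> 'a::euclidean_space \<Rightarrow> real) 1"
  unfolding weakly_singular_def
proof (intro conjI allI impI)
  fix t :: real and f :: "'a \<Rightarrow> real" and M x
  assume *: "t > 0" "f \<in> borel_measurable borel" "\<forall>y. \<bar>f y\<bar> \<le> M"
  then have "\<bar>kernel_conv heat_kernel f t x\<bar> \<le> M" by (intro abs_kernel_conv_heat_le) auto
  moreover have "0 \<le> M * t powr (- 1/2)" using *(3)[rule_format, of 0] by simp
  ultimately show "\<bar>kernel_conv heat_kernel f t x\<bar> \<le> 1 * M * (1 + t powr (- 1/2))"
    unfolding distrib_left mult_1_right mult_1_left by linarith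
qed (auto simp: gaussian_kernel_heat)

lemma weakly_singular_heat_d:
  assumes b: "b \<in> Basis"
  shows "weakly_singular (heat_kernel_d (b::'a::euclidean_space)) (2 powr (real DIM('a) / 2))"
  unfolding weakly_singular_def
proof (intro conjI allI impI)
  fix t :: real and f :: "'a \<Rightarrow> real" and M x
  assume *: "t > 0" "f \<in> borel_measurable borel" "\<forall>y. \<bar>f y\<bar> \<le> M"
  then have "\<bar>kernel_conv (heat_kernel_d b) f t x\<bar> \<le> 2 powr (real DIM('a) / 2) * t powr (- 1/2) * M"
    by (intro abs_kernel_conv_heat_d_le b) auto
  moreover have "0 \<le> 2 powr (real DIM('a) / 2) * M" using *(3)[rule_format, of 0] by simp
  ultimately show "\<bar>kernel_conv (heat_kernel_d b) f t x\<bar> \<le> 2 powr (real DIM('a) / 2) * M * (1 + t powr (- 1/2))"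
    unfolding distrib_left mult_1_right mult.assoc mult.commute[of _ M] by linarith
qed (auto simp: gaussian_kernel_heat_d[OF b])

definition duhamel :: "(real \<Rightarrow> 'a \<Rightarrow> real) \<Rightarrow> ('a::euclidean_space \<Rightarrow> real \<Rightarrow> real) \<Rightarrow> real \<Rightarrow> real \<Rightarrow> 'a \<Rightarrow> real" where
  "duhamel K g \<tau> t x = (\<integral>s. indicator {\<tau><..<t} s * kernel_conv K (\<lambda>y. g y s) (t - s) x \<partial>lborel)"

locale duhamel_source =
  fixes g :: "'a::euclidean_space \<Rightarrow> real \<Rightarrow> real" and M :: real
  assumes g_measurable [measurable]: "(\<lambda>(y, s). g y s) \<in> borel_measurable (borel \<Otimes>\<^sub>M borel)"
    and g_bound: "\<And>y s. \<bar>g y s\<bar> \<le> M"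
begin

lemma M_nonneg: "M \<ge> 0" using g_bound[of undefined undefined] by (rule order_trans[OF abs_ge_zero])

lemma g_slice [measurable]: "(\<lambda>y. g y s) \<in> borel_measurable borel" by measurable

lemma integrand_measurable:
  assumes "gaussian_kernel K"
  shows "(\<lambda>s. kernel_conv K (\<lambda>y. g y s) (t - s) x) \<in> borel_measurable lborel"
  using borel_measurable_kernel_conv[OF assms g_measurable, of "\<lambda>s. s" lborel "\<lambda>s. t - s" "\<lambda>_. x"] by simp

lemma integrand_bound:
  assumes "weakly_singular K C" "s < t"
  shows "\<bar>kernel_conv K (\<lambda>y. g y s) (t - s) x\<bar> \<le> C * M * (1 + (t - s) powr (- 1/2))"
  using assms g_bound g_slice unfolding weakly_singular_def by simp

text \<open>The window \<open>A\<close> is general because the continuity proof below also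
  integrates over windows that stop short of \<open>t\<close>.\<close>

lemma integrable_integrand:
  assumes K: "weakly_singular K C" and "A \<subseteq> {\<tau><..<t}" "\<tau> \<le> t" and [measurable]: "A \<in> sets borel"
  shows "integrable lborel (\<lambda>s. indicator A s * kernel_conv K (\<lambda>y. g y s) (t - s) x)"
proof (rule Bochner_Integration.integrable_bound)
  show "integrable lborel (\<lambda>s. C * M * (indicator {\<tau><..<t} s * (1 + (t - s) powr (- 1/2))))"
    by (intro integrable_mult_right integrable_singular_weight assms)
  have [measurable]: "(\<lambda>s. kernel_conv K (\<lambda>y. g y s) (t - s) x) \<in> borel_measurable lborel"
    using K by (intro integrand_measurable) (simp add: weakly_singular_def)
  show "(\<lambda>s. indicator A s * kernel_conv K (\<lambda>y. g y s) (t - s) x) \<in> borel_measurable lborel" by measurable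
  have C: "C * M \<ge> 0" using K M_nonneg by (simp add: weakly_singular_def)
  show "AE s in lborel. norm (indicator A s * kernel_conv K (\<lambda>y. g y s) (t - s) x)
     \<le> norm (C * M * (indicator {\<tau><..<t} s * (1 + (t - s) powr (- 1/2))))"
  proof (rule AE_I2)
    fix s
    show "norm (indicator A s * kernel_conv K (\<lambda>y. g y s) (t - s) x) \<le> norm (C * M * (indicator {\<tau><..<t} s * (1 + (t - s) powr (- 1/2))))"
    proof (cases "s \<in> A")
      case True
      then have s: "s \<in> {\<tau><..<t}" using assms by auto
      have "\<bar>kernel_conv K (\<lambda>y. g y s) (t - s) x\<bar> \<le> C * M * (1 + (t - s) powr (- 1/2))"
        using s by (intro integrand_bound[OF K]) auto
      then show ?thesis using True s by (simp add: order_trans[OF _ abs_ge_self])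
    qed simp
  qed
qed

lemma integral_integrand_bound:
  assumes K: "weakly_singular K C" and "\<sigma> \<le> t"
  shows "\<bar>\<integral>s. indicator {\<sigma><..<t} s * kernel_conv K (\<lambda>y. g y s) (t - s) x \<partial>lborel\<bar> \<le> C * M * (t - \<sigma> + 2 * sqrt (t - \<sigma>))"
proof -
  have "\<bar>\<integral>s. indicator {\<sigma><..<t} s * kernel_conv K (\<lambda>y. g y s) (t - s) x \<partial>lborel\<bar>
      \<le> (\<integral>s. \<bar>indicator {\<sigma><..<t} s * kernel_conv K (\<lambda>y. g y s) (t - s) x\<bar> \<partial>lborel)"
    by (rule integral_abs_bound)
  also have "\<dots> \<le> (\<integral>s. C * M * (indicator {\<sigma><..<t} s * (1 + (t - s) powr (- 1/2))) \<partial>lborel)"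
  proof (rule integral_mono)
    show "integrable lborel (\<lambda>s. \<bar>indicator {\<sigma><..<t} s * kernel_conv K (\<lambda>y. g y s) (t - s) x\<bar>)"
      by (intro integrable_abs integrable_integrand[OF K _ \<open>\<sigma> \<le> t\<close>]) auto
    show "integrable lborel (\<lambda>s. C * M * (indicator {\<sigma><..<t} s * (1 + (t - s) powr (- 1/2))))"
      by (intro integrable_mult_right integrable_singular_weight assms)
    show "\<bar>indicator {\<sigma><..<t} s * kernel_conv K (\<lambda>y. g y s) (t - s) x\<bar> \<le> C * M * (indicator {\<sigma><..<t} s * (1 + (t - s) powr (- 1/2)))" for s
      using integrand_bound[OF K, of s t x] by (cases "s \<in> {\<sigma><..<t}") auto
  qed
  also have "\<dots> = C * M * (t - \<sigma> + 2 * sqrt (t - \<sigma>))"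
    using integral_singular_weight[OF \<open>\<sigma> \<le> t\<close>] by simp
  finally show ?thesis .
qed

lemma duhamel_bound:
  "weakly_singular K C \<Longrightarrow> \<tau> \<le> t \<Longrightarrow> \<bar>duhamel K g \<tau> t x\<bar> \<le> C * M * (t - \<tau> + 2 * sqrt (t - \<tau>))"
  unfolding duhamel_def by (rule integral_integrand_bound)

text \<open>Cutting off the last stretch \<open>e n\<close> before \<open>t\<close> keeps the kernel
  away from its singularity, so the truncated integrals \<open>F n\<close> are continuous by
  dominated convergence. The removed piece is of order \<open>e n + sqrt (e n)\<close> uniformly,
  and a uniform limit of continuous functions is continuous.\<close>

lemma continuous_on_duhamel:
  assumes K: "weakly_singular K C"
  shows "continuous_on (UNIV \<times> {\<tau><..}) (\<lambda>(x, t). duhamel K g \<tau> t x)"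
proof -
  have gK: "gaussian_kernel K" using K by (simp add: weakly_singular_def)
  have CM: "C * M \<ge> 0" using K M_nonneg by (simp add: weakly_singular_def)
  let ?k = "\<lambda>p s. kernel_conv K (\<lambda>y. g y s) (snd p - s) (fst p)"
  define e where "e n = 1 / real (Suc n)" for n
  have e0: "e n > 0" for n by (simp add: e_def)
  have elim: "e \<longlonglongrightarrow> 0" unfolding e_def by (rule LIMSEQ_inverse_real_of_nat[unfolded inverse_eq_divide])
  define F where "F n p = (\<integral>s. indicator {\<tau><..<snd p - e n} s * ?k p s \<partial>lborel)" for n and p :: "'a \<times> real"
  let ?D = "\<lambda>p. duhamel K g \<tau> (snd p) (fst p)"
  let ?U = "UNIV \<times> {\<tau><..} :: ('a \<times> real) set"
  have "continuous_on ?U ?D"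
  proof (rule uniform_limit_theorem[where F = sequentially and f = F])
    show "\<forall>\<^sub>F n in sequentially. continuous_on ?U (F n)"
    proof (intro always_eventually allI)
      fix n
      show "continuous_on ?U (F n)" unfolding continuous_on_def
      proof
        fix z :: "'a \<times> real" assume z: "z \<in> ?U"
        have "((\<lambda>p. \<integral>s. indicator {\<tau><..<snd p - e n} s * ?k p s \<partial>lborel) \<longlongrightarrow>
            (\<integral>s. indicator {\<tau><..<snd z - e n} s * ?k z s \<partial>lborel)) (at z within ?U)"
        proof (rule tendsto_integral_dominated[OF _ z])
          show "(\<lambda>s. indicator {\<tau><..<snd p - e n} s * ?k p s) \<in> borel_measurable lborel" for p
            using integrand_measurable[OF gK, of "snd p" "fst p"] by measurable
          show "integrable lborel (\<lambda>s. indicator {\<tau>..snd z + 1} s * (C * M * (1 + e n powr (- 1/2))))"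
            by (intro integrable_mult_left integrable_real_indicator) (auto simp: emeasure_lborel_Icc_eq)
          have ev: "\<forall>\<^sub>F p in at z within ?U. snd p < snd z + 1"
          proof -
            have "(snd \<longlongrightarrow> snd z) (at z within ?U)" by (intro tendsto_intros)
            then show ?thesis by (rule order_tendstoD) simp
          qed
          then show "\<forall>\<^sub>F p in at z within ?U. \<forall>s\<in>space lborel. \<bar>indicator {\<tau><..<snd p - e n} s * ?k p s\<bar>
              \<le> indicator {\<tau>..snd z + 1} s * (C * M * (1 + e n powr (- 1/2)))"
          proof eventually_elim
            case (elim p)
            show ?case
            proof
              fix s :: real
              show "\<bar>indicator {\<tau><..<snd p - e n} s * ?k p s\<bar> \<le> indicator {\<tau>..snd z + 1} s * (C * M * (1 + e n powr (- 1/2)))"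
              proof (cases "s \<in> {\<tau><..<snd p - e n}")
                case True
                then have s: "s < snd p" "e n \<le> snd p - s" "s \<in> {\<tau>..snd z + 1}" using e0[of n] elim by auto
                have "\<bar>?k p s\<bar> \<le> C * M * (1 + (snd p - s) powr (- 1/2))" by (rule integrand_bound[OF K s(1)])
                also have "\<dots> \<le> C * M * (1 + e n powr (- 1/2))"
                  using CM s e0 by (intro mult_left_mono add_left_mono powr_mono2') auto
                finally show ?thesis using True s by simp
              next
                case False
                have "0 \<le> C * M * (1 + e n powr (- 1/2))" by (rule mult_nonneg_nonneg[OF CM]) simp
                moreover have "indicator {\<tau><..<snd p - e n} s = (0::real)" using False by (rule indicator_simps)
                ultimately show ?thesis by simp
              qed
            qed
          qed
          \<comment> \<open>The cutoff depends on \<open>p\<close>, and its indicator may fail to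
            converge at the single point \<open>s = snd z - e n\<close>.\<close>
          show "AE s in lborel. ((\<lambda>p. indicator {\<tau><..<snd p - e n} s * ?k p s) \<longlongrightarrow>
             indicator {\<tau><..<snd z - e n} s * ?k z s) (at z within ?U)"
            using AE_lborel_singleton[of "snd z - e n"]
          proof eventually_elim
            case (elim s)
            have lim: "((\<lambda>p. snd p - e n) \<longlongrightarrow> snd z - e n) (at z within ?U)" by (intro tendsto_intros)
            show ?case
            proof (cases "s < snd z - e n")
              case True
              have "\<forall>\<^sub>F p in at z within ?U. s < snd p - e n" using lim True by (rule order_tendstoD)
              then have "\<forall>\<^sub>F p in at z within ?U. (indicator {\<tau><..<snd z - e n} s :: real) * ?k p s = indicator {\<tau><..<snd p - e n} s * ?k p s"
                by eventually_elim (use True in \<open>auto simp: indicator_def\<close>)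
              moreover have "((\<lambda>p. (indicator {\<tau><..<snd z - e n} s :: real) * ?k p s) \<longlongrightarrow> indicator {\<tau><..<snd z - e n} s * ?k z s) (at z within ?U)"
              proof (rule tendsto_mult_left)
                have op: "open (UNIV \<times> {s<..} :: ('a \<times> real) set)" by (intro open_Times) auto
                have "continuous_on (UNIV \<times> {s<..}) (\<lambda>p. (\<lambda>(x, t). kernel_conv K (\<lambda>y. g y s) t x) (fst p, snd p - s))"
                  by (rule continuous_on_compose2[OF continuous_on_kernel_conv[OF gK g_slice g_bound]])
                    (auto intro!: continuous_intros)
                moreover have "z \<in> UNIV \<times> {s<..}" using True e0[of n] by (cases z) auto
                ultimately have "isCont (\<lambda>p. ?k p s) z"
                  using op by (auto simp only: continuous_on_eq_continuous_at case_prod_conv)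
                then show "((\<lambda>p. ?k p s) \<longlongrightarrow> ?k z s) (at z within ?U)"
                  unfolding isCont_def by (rule tendsto_within_subset) simp
              qed
              ultimately show ?thesis by (rule Lim_transform_eventually[rotated])
            next
              case False
              with elim have less: "snd z - e n < s" by simp
              have "\<forall>\<^sub>F p in at z within ?U. snd p - e n < s" using lim less by (rule order_tendstoD)
              then have "\<forall>\<^sub>F p in at z within ?U. 0 = indicator {\<tau><..<snd p - e n} s * ?k p s"
                by eventually_elim auto
              moreover have "indicator {\<tau><..<snd z - e n} s * ?k z s = 0" using less by simp
              ultimately show ?thesis
                using Lim_transform_eventually[OF tendsto_const[of "0::real"]] by (simp only:)
            qed
          qed
        qed
        then show "(F n \<longlongrightarrow> F n z) (at z within ?U)" by (simp add: F_def[abs_def])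
      qed
    qed
    show "uniform_limit ?U F ?D sequentially"
    proof (rule uniform_limitI)
      fix r :: real assume r: "r > 0"
      have "(\<lambda>n. C * M * (e n + 2 * sqrt (e n))) \<longlonglongrightarrow> C * M * (0 + 2 * sqrt 0)" by (intro tendsto_intros elim)
      then have "\<forall>\<^sub>F n in sequentially. C * M * (e n + 2 * sqrt (e n)) < r"
        using r by (intro order_tendstoD) auto
      then show "\<forall>\<^sub>F n in sequentially. \<forall>p\<in>?U. dist (F n p) (?D p) < r"
      proof eventually_elim
        case (elim n)
        show ?case
        proof
          fix p assume p: "p \<in> ?U"
          let ?t = "snd p"
          \<comment> \<open>For \<open>?t\<close> close to \<open>\<tau>\<close> the cut at
            \<open>?t - e n\<close> lies before the start of the integral.\<close>
          define \<sigma> where "\<sigma> = max \<tau> (?t - e n)"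
          have \<sigma>: "\<sigma> \<ge> \<tau>" "\<sigma> \<le> ?t" "?t - \<sigma> \<le> e n" using p e0[of n] by (auto simp: \<sigma>_def)
          have "?D p - F n p = (\<integral>s. indicator {\<tau><..<?t} s * ?k p s - indicator {\<tau><..<?t - e n} s * ?k p s \<partial>lborel)"
            unfolding duhamel_def F_def using p e0[of n]
            by (intro Bochner_Integration.integral_diff[symmetric] integrable_integrand[OF K, of _ \<tau>]) auto
          also have "\<dots> = (\<integral>s. indicator {\<sigma><..<?t} s * ?k p s \<partial>lborel)"
          proof (rule integral_cong_AE)
            show "AE s in lborel. indicator {\<tau><..<?t} s * ?k p s - indicator {\<tau><..<?t - e n} s * ?k p s = indicator {\<sigma><..<?t} s * ?k p s"
              using AE_lborel_singleton[of "?t - e n"]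
              by eventually_elim (use e0[of n] in \<open>auto simp: \<sigma>_def indicator_def\<close>)
          qed (use integrand_measurable[OF gK, of "snd p" "fst p"] in measurable)
          finally have "\<bar>?D p - F n p\<bar> \<le> C * M * (?t - \<sigma> + 2 * sqrt (?t - \<sigma>))"
            using integral_integrand_bound[OF K \<sigma>(2)] by simp
          also have "\<dots> \<le> C * M * (e n + 2 * sqrt (e n))"
            using \<sigma> CM by (intro mult_left_mono add_mono real_sqrt_le_mono) auto
          finally show "dist (F n p) (?D p) < r" using elim by (simp add: dist_real_def abs_minus_commute)
        qed
      qed
    qed
  qed simp
  then show ?thesis by (simp add: case_prod_unfold)
qed

lemma duhamel_space_derivative:
  assumes b: "b \<in> Basis" and t: "\<tau> \<le> t"
  shows "((\<lambda>h. duhamel heat_kernel g \<tau> t (x + h *\<^sub>R b)) has_real_derivative duhamel (heat_kernel_d b) g \<tau> t x) (at 0)"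
proof -
  let ?C = "2 powr (real DIM('a) / 2)"
  note K = weakly_singular_heat weakly_singular_heat_d[OF b]
  have CM: "?C * M \<ge> 0" using M_nonneg by simp
  have "((\<lambda>h. duhamel heat_kernel g \<tau> t (x + h *\<^sub>R b)) has_real_derivative duhamel (heat_kernel_d b) g \<tau> t (x + 0 *\<^sub>R b)) (at 0)"
    unfolding duhamel_def
  proof (rule has_derivative_integral_dominated[where d = 1 and
        F' = "\<lambda>h s. indicator {\<tau><..<t} s * kernel_conv (heat_kernel_d b) (\<lambda>y. g y s) (t - s) (x + h *\<^sub>R b)"
        and F = "\<lambda>h s. indicator {\<tau><..<t} s * kernel_conv heat_kernel (\<lambda>y. g y s) (t - s) (x + h *\<^sub>R b)"
        and B = "\<lambda>s. ?C * M * (indicator {\<tau><..<t} s * (1 + (t - s) powr (- 1/2)))"])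
    show "integrable lborel (\<lambda>s. indicator {\<tau><..<t} s * kernel_conv heat_kernel (\<lambda>y. g y s) (t - s) (x + h *\<^sub>R b))" for h
      by (rule integrable_integrand[OF K(1) _ t]) auto
    show "integrable lborel (\<lambda>s. ?C * M * (indicator {\<tau><..<t} s * (1 + (t - s) powr (- 1/2))))"
      by (intro integrable_mult_right integrable_singular_weight t)
    show "\<bar>indicator {\<tau><..<t} s * kernel_conv (heat_kernel_d b) (\<lambda>y. g y s) (t - s) (x + h *\<^sub>R b)\<bar>
       \<le> ?C * M * (indicator {\<tau><..<t} s * (1 + (t - s) powr (- 1/2)))" for h s
      using integrand_bound[OF K(2), of s t "x + h *\<^sub>R b"] by (cases "s \<in> {\<tau><..<t}") auto
    show "((\<lambda>h. indicator {\<tau><..<t} s * kernel_conv heat_kernel (\<lambda>y. g y s) (t - s) (x + h *\<^sub>R b)) has_real_derivative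
      indicator {\<tau><..<t} s * kernel_conv (heat_kernel_d b) (\<lambda>y. g y s) (t - s) (x + h *\<^sub>R b)) (at h)" for h s
    proof (cases "s \<in> {\<tau><..<t}")
      case True
      then show ?thesis
        using kernel_conv_space_derivative[where t = "t - s" and x = x and a = h and f = "\<lambda>y. g y s", OF gaussian_kernel_heat
            gaussian_kernel_heat_d[OF b] heat_kernel_space_derivative[OF b] g_slice g_bound]
        by (intro DERIV_cmult) simp
    qed simp
  qed simp
  then show ?thesis by simp
qed

end

lemma duhamel_heat_d_eq:
  fixes g :: "'a::euclidean_space \<Rightarrow> real \<Rightarrow> real"
  assumes g: "duhamel_source g M" and g': "duhamel_source g' M'" and b: "b \<in> Basis"
    and d: "\<And>y s. ((\<lambda>h. g (y + h *\<^sub>R b) s) has_real_derivative g' y s) (at 0)"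
  shows "duhamel (heat_kernel_d b) g \<tau> t x = duhamel heat_kernel g' \<tau> t x"
proof -
  interpret g: duhamel_source g M by fact
  interpret g': duhamel_source g' M' by fact
  have "kernel_conv (heat_kernel_d b) (\<lambda>y. g y s) (t - s) x = kernel_conv heat_kernel (\<lambda>y. g' y s) (t - s) x" if "s < t" for s
    using that by (intro kernel_conv_heat_d_eq[OF _ b g.g_slice g.g_bound d g'.g_slice g'.g_bound]) auto
  then show ?thesis unfolding duhamel_def
    by (intro Bochner_Integration.integral_cong) (auto simp: indicator_def)
qed

section \<open>Increments of the heat flow and the time derivative of Duhamel integrals\<close>

lemma directional_derivative_shift:
  fixes f :: "'a::real_vector \<Rightarrow> real"
  assumes "\<And>y. ((\<lambda>h. f (y + h *\<^sub>R b)) has_real_derivative f' y) (at 0)"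
  shows "((\<lambda>h. f (y + h *\<^sub>R b)) has_real_derivative f' (y + h *\<^sub>R b)) (at h)"
proof -
  have "((\<lambda>k. f ((y + h *\<^sub>R b) + k *\<^sub>R b)) has_real_derivative f' (y + h *\<^sub>R b)) (at (h + - h))"
    using assms by simp
  then have "((\<lambda>h'. f ((y + h *\<^sub>R b) + (h' + - h) *\<^sub>R b)) has_real_derivative f' (y + h *\<^sub>R b)) (at h)"
    by (rule DERIV_shift[THEN iffD1])
  moreover have "(y + h *\<^sub>R b) + (h' + - h) *\<^sub>R b = y + h' *\<^sub>R b" for h'
    by (simp add: algebra_simps)
  ultimately show ?thesis by (simp only:)
qed

text \<open>The path from \<open>y\<close> to \<open>y + z\<close> changes one coordinate at a time,
  so bounds on partial derivatives suffice, without total differentiability. Each coordinate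
  contributes \<open>M * norm z\<close>.\<close>

lemma lipschitz_of_bounded_partials:
  fixes f :: "'a::euclidean_space \<Rightarrow> real"
  assumes d: "\<And>y b. b \<in> Basis \<Longrightarrow> ((\<lambda>h. f (y + h *\<^sub>R b)) has_real_derivative f' b y) (at 0)"
    and f': "\<And>b y. b \<in> Basis \<Longrightarrow> \<bar>f' b y\<bar> \<le> M"
  shows "\<bar>f (y + z) - f y\<bar> \<le> real DIM('a) * M * norm z"
proof -
  have M: "M \<ge> 0" using order_trans[OF abs_ge_zero f'[OF SOME_Basis]] .
  have "\<bar>f (y + (\<Sum>b\<in>A. (z \<bullet> b) *\<^sub>R b)) - f y\<bar> \<le> real (card A) * (M * norm z)" if "A \<subseteq> Basis" for A
    using finite_subset[OF that finite_Basis] that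
  proof (induction A rule: finite_induct)
    case (insert b A)
    let ?y = "y + (\<Sum>b\<in>A. (z \<bullet> b) *\<^sub>R b)"
    have b: "b \<in> Basis" using insert by simp
    have "norm (f (?y + (z \<bullet> b) *\<^sub>R b) - f (?y + 0 *\<^sub>R b)) \<le> M * norm (z \<bullet> b - 0)"
    proof (rule field_differentiable_bound[where S = UNIV and f = "\<lambda>h. f (?y + h *\<^sub>R b)" and f' = "\<lambda>h. f' b (?y + h *\<^sub>R b)"])
      show "((\<lambda>h. f (?y + h *\<^sub>R b)) has_field_derivative f' b (?y + h *\<^sub>R b)) (at h within UNIV)" for h
        using directional_derivative_shift[OF d[OF b], of ?y h] by simp
    qed (use f'[OF b] in auto)
    also have "\<dots> \<le> M * norm z" using b M by (intro mult_left_mono) (auto simp: Basis_le_norm)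
    finally have "\<bar>f (?y + (z \<bullet> b) *\<^sub>R b) - f ?y\<bar> \<le> M * norm z" by simp
    moreover have "\<bar>f ?y - f y\<bar> \<le> real (card A) * (M * norm z)" using insert by simp
    moreover have eq: "y + (\<Sum>b\<in>insert b A. (z \<bullet> b) *\<^sub>R b) = ?y + (z \<bullet> b) *\<^sub>R b"
      using insert by (simp add: algebra_simps)
    moreover have "real (card (insert b A)) * (M * norm z) = real (card A) * (M * norm z) + M * norm z"
      using insert.hyps by (simp add: distrib_right)
    ultimately show ?case unfolding eq by linarith
  qed simp
  from this[of Basis] show ?thesis by (simp add: euclidean_representation mult.assoc)
qed

text \<open>The fundamental theorem of calculus in time, from the initial moment on. The derivative
  is singular but integrable there, and continuity of the flow up to that moment comes from the
  Lipschitz bound on \<open>f\<close>.\<close>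

lemma heat_conv_increment:
  fixes f :: "'a::euclidean_space \<Rightarrow> real"
  assumes f: "f \<in> borel_measurable borel" "\<And>y. \<bar>f y\<bar> \<le> M"
    and d: "\<And>y b. b \<in> Basis \<Longrightarrow> ((\<lambda>h. f (y + h *\<^sub>R b)) has_real_derivative f' b y) (at 0)"
    and f': "\<And>b. b \<in> Basis \<Longrightarrow> f' b \<in> borel_measurable borel" "\<And>b y. b \<in> Basis \<Longrightarrow> \<bar>f' b y\<bar> \<le> M'"
    and s: "s < t"
  shows "(\<integral>r. indicator {s<..<t} r * (\<Sum>b\<in>Basis. kernel_conv (heat_kernel_d b) (f' b) (r - s) x) \<partial>lborel)
    = kernel_conv heat_kernel f (t - s) x - f x"
proof -
  let ?L = "\<lambda>r. \<Sum>b\<in>Basis. kernel_conv (heat_kernel_d b) (f' b) (r - s) x"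
  let ?C = "real DIM('a) * (2 powr (real DIM('a) / 2) * M')"
  have M': "M' \<ge> 0" using order_trans[OF abs_ge_zero f'(2)[OF SOME_Basis]] .
  have Lm [measurable]: "(\<lambda>r. indicator {s<..<t} r * ?L r) \<in> borel_measurable lborel"
  proof (intro borel_measurable_times borel_measurable_sum)
    fix b :: 'a assume b: "b \<in> Basis"
    note [measurable] = f'(1)[OF b]
    show "(\<lambda>r. kernel_conv (heat_kernel_d b) (f' b) (r - s) x) \<in> borel_measurable lborel"
      by (rule borel_measurable_kernel_conv[OF gaussian_kernel_heat_d[OF b], where g = "\<lambda>y s. f' b y" and a = "\<lambda>_. 0"]) measurable
  qed simp
  have Lb: "\<bar>?L r\<bar> \<le> ?C * (1 + (r - s) powr (- 1/2))" if "r > s" for r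
  proof -
    have "\<bar>kernel_conv (heat_kernel_d b) (f' b) (r - s) x\<bar> \<le> 2 powr (real DIM('a) / 2) * M' * (1 + (r - s) powr (- 1/2))"
      if "b \<in> Basis" for b
      using weakly_singular_heat_d[OF that] f'[OF that] \<open>r > s\<close> unfolding weakly_singular_def by simp
    then have "(\<Sum>b\<in>(Basis::'a set). \<bar>kernel_conv (heat_kernel_d b) (f' b) (r - s) x\<bar>)
       \<le> real DIM('a) * (2 powr (real DIM('a) / 2) * M' * (1 + (r - s) powr (- 1/2)))"
      by (intro sum_bounded_above) auto
    then show ?thesis by (intro order_trans[OF sum_abs]) (simp add: mult.assoc)
  qed
  \<comment> \<open>The reflection \<open>s + t - r\<close> turns the weight that is singular at the
    right end into one that is singular at the left end.\<close>
  have "integrable lborel (\<lambda>r. indicator {s<..<t} ((s + t) + - 1 * r) * (1 + (t - ((s + t) + - 1 * r)) powr (- 1/2)))"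
    using lborel_integrable_real_affine[OF integrable_singular_weight, of s t "- 1" "s + t"] s by simp
  moreover have "indicator {s<..<t} ((s + t) + - 1 * r) = (indicator {s<..<t} r :: real)" for r
    by (auto simp: indicator_def)
  ultimately have W: "integrable lborel (\<lambda>r. indicator {s<..<t} r * (1 + (r - s) powr (- 1/2)))" by simp
  have I: "integrable lborel (\<lambda>r. indicator {s<..<t} r * ?L r)"
  proof (rule Bochner_Integration.integrable_bound[OF _ Lm])
    show "integrable lborel (\<lambda>r. ?C * (indicator {s<..<t} r * (1 + (r - s) powr (- 1/2))))"
      by (intro integrable_mult_right W)
    show "AE r in lborel. norm (indicator {s<..<t} r * ?L r) \<le> norm (?C * (indicator {s<..<t} r * (1 + (r - s) powr (- 1/2))))"
    proof (rule AE_I2)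
      fix r
      show "norm (indicator {s<..<t} r * ?L r) \<le> norm (?C * (indicator {s<..<t} r * (1 + (r - s) powr (- 1/2))))"
        using Lb[of r] by (cases "r \<in> {s<..<t}") (auto intro: order_trans[OF _ abs_ge_self])
    qed
  qed
  \<comment> \<open>At time \<open>0\<close> the formula for the kernel gives \<open>0\<close> and
    not the identity, so the initial value is inserted by hand.\<close>
  define F where "F r = (if r = s then f x else kernel_conv heat_kernel f (r - s) x)" for r
  have FD: "(F has_real_derivative ?L r) (at r)" if "r > s" for r
  proof -
    have "((\<lambda>r. kernel_conv heat_kernel f (r + - s) x) has_real_derivative ?L r) (at r)"
      by (rule DERIV_shift[THEN iffD1]) (use that heat_conv_time_derivative[OF _ f d f', of "r - s" x] in simp)
    then show ?thesis
    proof (rule has_field_derivative_transform_within_open[where S = "{s<..}"])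
      show "kernel_conv heat_kernel f (r + - s) x = F r" if "r \<in> {s<..}" for r using that by (simp add: F_def)
    qed (use that in auto)
  qed
  have "((\<lambda>r. ?L r) has_integral (F t - F s)) {s..t}"
  proof (rule fundamental_theorem_of_calculus_interior)
    show "continuous_on {s..t} F" unfolding continuous_on_def
    proof
      fix r assume r: "r \<in> {s..t}"
      show "(F \<longlongrightarrow> F r) (at r within {s..t})"
      proof (cases "r = s")
        case False
        then have "isCont F r" using FD[of r] r by (auto intro: DERIV_isCont)
        then show ?thesis unfolding isCont_def by (rule tendsto_within_subset) simp
      next
        case True
        let ?\<beta> = "real DIM('a) * M'"
        let ?c = "2 * 2 powr (real DIM('a) / 2)"
        have near: "\<bar>f (x - z) - f x\<bar> \<le> 0 + ?\<beta> * norm z" for z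
          using lipschitz_of_bounded_partials[OF d f'(2), of x "- z"] by simp
        have *: "norm (F r - f x) \<le> ?\<beta> * (?c * sqrt (r - s))" if "r \<ge> s" for r
        proof (cases "r = s")
          case False
          then show ?thesis
            using kernel_conv_heat_near[OF _ f near, of "r - s"] that M' by (simp add: F_def)
        qed (simp add: F_def)
        have "((\<lambda>r. F r - f x) \<longlongrightarrow> 0) (at s within {s..t})"
        proof (rule Lim_null_comparison)
          show "\<forall>\<^sub>F r in at s within {s..t}. norm (F r - f x) \<le> ?\<beta> * (?c * sqrt (r - s))"
            using * by (auto simp: eventually_at_filter)
          have "((\<lambda>r. ?\<beta> * (?c * sqrt (r - s))) \<longlongrightarrow> ?\<beta> * (?c * sqrt (s - s))) (at s within {s..t})"
            by (intro tendsto_intros)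
          then show "((\<lambda>r. ?\<beta> * (?c * sqrt (r - s))) \<longlongrightarrow> 0) (at s within {s..t})" by simp
        qed
        then have "(F \<longlongrightarrow> f x) (at s within {s..t})" by (rule LIM_zero_cancel)
        then show ?thesis using True by (simp add: F_def)
      qed
    qed
    show "(F has_vector_derivative ?L r) (at r)" if "r \<in> {s<..<t}" for r
      using FD[of r] that by (simp add: has_real_derivative_iff_has_vector_derivative)
  qed (use s in simp)
  then have "((\<lambda>r. if r \<in> {s<..<t} then ?L r else 0) has_integral (F t - F s)) UNIV"
    by (simp only: has_integral_restrict_UNIV has_integral_Icc_iff_Ioo)
  moreover have "(\<lambda>r. if r \<in> {s<..<t} then ?L r else 0) = (\<lambda>r. indicator {s<..<t} r * ?L r)"
    by (auto simp: indicator_def)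
  ultimately have "((\<lambda>r. indicator {s<..<t} r * ?L r) has_integral (F t - F s)) UNIV" by simp
  from has_integral_unique[OF has_integral_integral_lborel[OF I] this] show ?thesis
    using s by (simp add: F_def)
qed

locale duhamel_C1_source = duhamel_source g M
  for g :: "'a::euclidean_space \<Rightarrow> real \<Rightarrow> real" and M +
  fixes g' :: "'a \<Rightarrow> 'a \<Rightarrow> real \<Rightarrow> real" and M' :: real
  assumes g'_source: "\<And>b. b \<in> Basis \<Longrightarrow> duhamel_source (g' b) M'"
    and g_deriv: "\<And>b y s. b \<in> Basis \<Longrightarrow> ((\<lambda>h. g (y + h *\<^sub>R b) s) has_real_derivative g' b y s) (at 0)"
begin

lemma g'_slice: "b \<in> Basis \<Longrightarrow> (\<lambda>y. g' b y s) \<in> borel_measurable borel"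
  using duhamel_source.g_slice[OF g'_source] .

lemma g'_bound: "b \<in> Basis \<Longrightarrow> \<bar>g' b y s\<bar> \<le> M'"
  using duhamel_source.g_bound[OF g'_source] .

text \<open>The convolution of each slice of the source is the slice itself plus an integral of its
  Laplacian, by \<open>heat_conv_increment\<close>. Inserting this and exchanging the order of
  integration writes the Duhamel term as one integral over time, from which its time derivative can
  be read off.\<close>

lemma
  assumes t: "\<tau> < t"
  shows integrable_increment: "integrable lborel
      (\<lambda>r. indicator {\<tau><..<t} r * ((\<Sum>b\<in>Basis. duhamel (heat_kernel_d b) (g' b) \<tau> r x) + g x r))"
    and duhamel_increment: "duhamel heat_kernel g \<tau> t x =
    (\<integral>r. indicator {\<tau><..<t} r * ((\<Sum>b\<in>Basis. duhamel (heat_kernel_d b) (g' b) \<tau> r x) + g x r) \<partial>lborel)"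
proof -
  let ?D = "\<lambda>r. \<Sum>b\<in>Basis. duhamel (heat_kernel_d b) (g' b) \<tau> r x"
  let ?L = "\<lambda>s r. \<Sum>b\<in>Basis. kernel_conv (heat_kernel_d b) (\<lambda>y. g' b y s) (r - s) x"
  let ?C = "real DIM('a) * (2 powr (real DIM('a) / 2) * M')"
  \<comment> \<open>Extension by zero off the triangle \<open>\<tau> < s < r < t\<close>, so that
    both orders of integration run over the whole line.\<close>
  define f where "f r s = (if \<tau> < s \<and> s < r \<and> r < t then ?L s r else 0)" for r s
  have M': "M' \<ge> 0" using order_trans[OF abs_ge_zero g'_bound[OF SOME_Basis]] .
  have Lm: "(\<lambda>z. ?L (snd z) (fst z)) \<in> borel_measurable (lborel \<Otimes>\<^sub>M lborel)"
  proof (rule borel_measurable_sum)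
    fix b :: 'a assume b: "b \<in> Basis"
    show "(\<lambda>z. kernel_conv (heat_kernel_d b) (\<lambda>y. g' b y (snd z)) (fst z - snd z) x) \<in> borel_measurable (lborel \<Otimes>\<^sub>M lborel)"
      by (rule borel_measurable_kernel_conv[OF gaussian_kernel_heat_d[OF b] duhamel_source.g_measurable[OF g'_source[OF b]]]) measurable
  qed
  have fm: "case_prod f \<in> borel_measurable (lborel \<Otimes>\<^sub>M lborel)"
    unfolding f_def case_prod_unfold using Lm by measurable
  have Lb: "\<bar>?L s r\<bar> \<le> ?C * (1 + (r - s) powr (- 1/2))" if "s < r" for r s
  proof -
    have "\<bar>kernel_conv (heat_kernel_d b) (\<lambda>y. g' b y s) (r - s) x\<bar> \<le> 2 powr (real DIM('a) / 2) * M' * (1 + (r - s) powr (- 1/2))"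
      if "b \<in> Basis" for b
      using duhamel_source.integrand_bound[OF g'_source[OF that] weakly_singular_heat_d[OF that] \<open>s < r\<close>] .
    then have "(\<Sum>b\<in>(Basis::'a set). \<bar>kernel_conv (heat_kernel_d b) (\<lambda>y. g' b y s) (r - s) x\<bar>)
       \<le> real DIM('a) * (2 powr (real DIM('a) / 2) * M' * (1 + (r - s) powr (- 1/2)))"
      by (intro sum_bounded_above) auto
    then show ?thesis by (intro order_trans[OF sum_abs]) (simp add: mult.assoc)
  qed
  have C0: "?C \<ge> 0" using M' by simp
  have fb: "norm (f r s) \<le> ?C * (indicator {\<tau><..<r} s * (1 + (r - s) powr (- 1/2)))" for r s
    using Lb[of s r] C0 by (auto simp: f_def indicator_def)
  have fint: "integrable lborel (f r)" if "\<tau> < r" for r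
  proof (rule Bochner_Integration.integrable_bound)
    show "integrable lborel (\<lambda>s. ?C * (indicator {\<tau><..<r} s * (1 + (r - s) powr (- 1/2))))"
      using that by (intro integrable_mult_right integrable_singular_weight) simp
    have "f r = (\<lambda>s. case_prod f (r, s))" by simp
    then show "f r \<in> borel_measurable lborel" using fm by simp
    show "AE s in lborel. norm (f r s) \<le> norm (?C * (indicator {\<tau><..<r} s * (1 + (r - s) powr (- 1/2))))"
      by (rule AE_I2) (rule order_trans[OF fb], simp)
  qed
  have f0: "f r = (\<lambda>s. 0)" if "\<not> (\<tau> < r \<and> r < t)" for r using that by (auto simp: f_def fun_eq_iff)
  have int2: "integrable (lborel \<Otimes>\<^sub>M lborel) (case_prod f)"
  proof (rule lborel_pair.Fubini_integrable[OF fm])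
    show "AE r in lborel. integrable lborel (\<lambda>s. case_prod f (r, s))"
      by (rule AE_I2) (use fint f0 in \<open>metis (no_types, lifting) case_prod_conv integrable_zero ext\<close>)
    show "integrable lborel (\<lambda>r. \<integral>s. norm (case_prod f (r, s)) \<partial>lborel)"
    proof (rule Bochner_Integration.integrable_bound)
      show "integrable lborel (\<lambda>r. indicator {\<tau>..t} r * (?C * (t - \<tau> + 2 * sqrt (t - \<tau>))))"
        by (intro integrable_mult_left integrable_real_indicator) (auto simp: emeasure_lborel_Icc_eq)
      show "(\<lambda>r. \<integral>s. norm (case_prod f (r, s)) \<partial>lborel) \<in> borel_measurable lborel"
        using fm by measurable
      show "AE r in lborel. norm (\<integral>s. norm (case_prod f (r, s)) \<partial>lborel) \<le> norm (indicator {\<tau>..t} r * (?C * (t - \<tau> + 2 * sqrt (t - \<tau>))))"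
      proof (rule AE_I2)
        fix r
        show "norm (\<integral>s. norm (case_prod f (r, s)) \<partial>lborel) \<le> norm (indicator {\<tau>..t} r * (?C * (t - \<tau> + 2 * sqrt (t - \<tau>))))"
        proof (cases "\<tau> < r \<and> r < t")
          case True
          have "(\<integral>s. norm (f r s) \<partial>lborel) \<le> (\<integral>s. ?C * (indicator {\<tau><..<r} s * (1 + (r - s) powr (- 1/2))) \<partial>lborel)"
            using True by (intro integral_mono fb integrable_norm fint integrable_mult_right integrable_singular_weight) auto
          also have "\<dots> = ?C * (r - \<tau> + 2 * sqrt (r - \<tau>))"
            using integral_singular_weight[of \<tau> r] True by simp
          also have "\<dots> \<le> ?C * (t - \<tau> + 2 * sqrt (t - \<tau>))"
            using True C0 by (intro mult_left_mono add_mono real_sqrt_le_mono) auto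
          finally show ?thesis using True by simp
        next
          case False
          then show ?thesis by (simp add: f0)
        qed
      qed
    qed
  qed
  have g_int: "integrable lborel (\<lambda>s. indicator {\<tau><..<t} s * g x s)"
  proof (rule Bochner_Integration.integrable_bound)
    show "integrable lborel (\<lambda>s. indicator {\<tau>..t} s * M)"
      by (intro integrable_mult_left integrable_real_indicator) (auto simp: emeasure_lborel_Icc_eq)
    show "AE s in lborel. norm (indicator {\<tau><..<t} s * g x s) \<le> norm (indicator {\<tau>..t} s * M)"
      using g_bound[of x] M_nonneg by (intro AE_I2) (auto simp: indicator_def)
  qed measurable
  have d_int: "integrable lborel (\<lambda>s. indicator {\<tau><..<t} s * kernel_conv heat_kernel (\<lambda>y. g y s) (t - s) x)"
    by (rule integrable_integrand[OF weakly_singular_heat, of _ \<tau>]) (use t in auto)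
  have inner_r: "(\<integral>r. f r s \<partial>lborel) = indicator {\<tau><..<t} s * (kernel_conv heat_kernel (\<lambda>y. g y s) (t - s) x - g x s)" for s
  proof (cases "\<tau> < s \<and> s < t")
    case True
    have "(\<integral>r. f r s \<partial>lborel) = (\<integral>r. indicator {s<..<t} r * ?L s r \<partial>lborel)"
      by (rule Bochner_Integration.integral_cong) (use True in \<open>auto simp: f_def indicator_def\<close>)
    also have "\<dots> = kernel_conv heat_kernel (\<lambda>y. g y s) (t - s) x - g x s"
      using True by (intro heat_conv_increment[where f' = "\<lambda>b y. g' b y s", OF g_slice g_bound g_deriv g'_slice g'_bound]) auto
    finally show ?thesis using True by simp
  next
    case False
    then have "f r s = 0" for r by (auto simp: f_def)
    then show ?thesis using False by auto
  qed
  have inner_s: "(\<integral>s. f r s \<partial>lborel) = indicator {\<tau><..<t} r * ?D r" for r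
  proof (cases "\<tau> < r \<and> r < t")
    case True
    have "(\<integral>s. f r s \<partial>lborel) = (\<integral>s. (\<Sum>b\<in>Basis. indicator {\<tau><..<r} s * kernel_conv (heat_kernel_d b) (\<lambda>y. g' b y s) (r - s) x) \<partial>lborel)"
      unfolding sum_distrib_left[symmetric]
      by (rule Bochner_Integration.integral_cong) (use True in \<open>auto simp: f_def indicator_def\<close>)
    also have "\<dots> = ?D r"
      unfolding duhamel_def
      by (rule Bochner_Integration.integral_sum)
        (rule duhamel_source.integrable_integrand[OF g'_source weakly_singular_heat_d, of _ _ _ \<tau>], use True in auto)
    finally show ?thesis using True by simp
  next
    case False
    then show ?thesis by (auto simp: f0)
  qed
  have D_int: "integrable lborel (\<lambda>r. indicator {\<tau><..<t} r * ?D r)"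
    using lborel_pair.integrable_fst'[OF int2] by (simp add: inner_s)
  have "(\<integral>s. indicator {\<tau><..<t} s * (kernel_conv heat_kernel (\<lambda>y. g y s) (t - s) x - g x s) \<partial>lborel)
     = (\<integral>r. indicator {\<tau><..<t} r * ?D r \<partial>lborel)"
    using lborel_pair.Fubini_integral[OF int2] by (simp add: inner_r inner_s)
  then have "duhamel heat_kernel g \<tau> t x - (\<integral>s. indicator {\<tau><..<t} s * g x s \<partial>lborel) = (\<integral>r. indicator {\<tau><..<t} r * ?D r \<partial>lborel)"
    unfolding duhamel_def[of heat_kernel] using d_int g_int by (simp add: right_diff_distrib)
  then show "duhamel heat_kernel g \<tau> t x = (\<integral>r. indicator {\<tau><..<t} r * (?D r + g x r) \<partial>lborel)"
    using D_int g_int by (simp add: distrib_left)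
  show "integrable lborel (\<lambda>r. indicator {\<tau><..<t} r * (?D r + g x r))"
    using D_int g_int by (simp add: distrib_left)
qed

end

text \<open>Nothing beyond integrability is known of \<open>\<psi>\<close> at \<open>\<tau>\<close>.
  The integral is therefore split at an interior point \<open>a\<close>, and the fundamental theorem
  is applied on the compact interval \<open>{a..b}\<close> around \<open>t\<close>.\<close>

lemma lborel_integral_has_real_derivative:
  fixes \<psi> :: "real \<Rightarrow> real"
  assumes int: "\<And>t. \<tau> < t \<Longrightarrow> t < T \<Longrightarrow> integrable lborel (\<lambda>r. indicator {\<tau><..<t} r * \<psi> r)"
    and cont: "continuous_on {\<tau><..<T} \<psi>" and t: "\<tau> < t" "t < T"
  shows "((\<lambda>t. \<integral>r. indicator {\<tau><..<t} r * \<psi> r \<partial>lborel) has_real_derivative \<psi> t) (at t)"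
proof -
  obtain a b where a: "\<tau> < a" "a < t" and b: "t < b" "b < T" using dense t by metis
  let ?\<Phi> = "\<lambda>t. \<integral>r. indicator {\<tau><..<t} r * \<psi> r \<partial>lborel"
  have cab: "continuous_on {a..b} \<psi>" by (rule continuous_on_subset[OF cont]) (use a b in auto)
  have eq: "?\<Phi> t' = ?\<Phi> a + integral {a..t'} \<psi>" if "t' \<in> {a..b}" for t'
  proof -
    have "set_integrable lborel {a..t'} \<psi>"
      unfolding set_integrable_def by (rule borel_integrable_compact) (use that in \<open>auto intro: continuous_on_subset[OF cab]\<close>)
    then have si: "integrable lborel (\<lambda>r. indicator {a..t'} r * \<psi> r)" and
      "(\<integral>r. indicator {a..t'} r * \<psi> r \<partial>lborel) = integral {a..t'} \<psi>"
      using set_borel_integral_eq_integral(2)[of "{a..t'}" \<psi>] by (auto simp: set_integrable_def set_lebesgue_integral_def)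
    then have "?\<Phi> a + integral {a..t'} \<psi> = (\<integral>r. indicator {\<tau><..<a} r * \<psi> r + indicator {a..t'} r * \<psi> r \<partial>lborel)"
      using a b int[of a] by simp
    also have "\<dots> = ?\<Phi> t'"
    proof (rule integral_cong_AE)
      show "(\<lambda>r. indicator {\<tau><..<a} r * \<psi> r + indicator {a..t'} r * \<psi> r) \<in> borel_measurable lborel"
        using int[of a] si a b by (intro borel_measurable_add) auto
      show "(\<lambda>r. indicator {\<tau><..<t'} r * \<psi> r) \<in> borel_measurable lborel"
        using int[of t'] that a b by auto
      show "AE r in lborel. indicator {\<tau><..<a} r * \<psi> r + indicator {a..t'} r * \<psi> r = indicator {\<tau><..<t'} r * \<psi> r"
        using AE_lborel_singleton[of t'] by eventually_elim (use a that in \<open>auto simp: indicator_def\<close>)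
    qed
    finally show ?thesis by simp
  qed
  have "((\<lambda>t. integral {a..t} \<psi>) has_real_derivative \<psi> t) (at t within {a..b})"
    by (rule integral_has_real_derivative[OF cab]) (use a b in auto)
  then have "((\<lambda>t. ?\<Phi> a + integral {a..t} \<psi>) has_real_derivative \<psi> t) (at t within {a..b})"
    by (auto intro!: derivative_eq_intros)
  then have "(?\<Phi> has_real_derivative \<psi> t) (at t within {a..b})"
  proof (rule has_field_derivative_transform_within[where d = 1])
    show "?\<Phi> a + integral {a..t'} \<psi> = ?\<Phi> t'" if "t' \<in> {a..b}" for t'
      using eq[OF that] by (rule sym)
  qed (use a b in auto)
  moreover have "at t within {a..b} = at t" using a b by (intro at_within_interior) auto
  ultimately show ?thesis by simp
qed

subsection \<open>Regularity of bounded mild solutions\<close>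

text \<open>Only restarts at positive times \<open>\<tau>\<close> enter, because the solution may be
  unbounded near time \<open>0\<close>. Strict positivity keeps \<open>v powr p\<close>
  differentiable in \<open>v\<close>.\<close>

locale mild_solution =
  fixes v :: "'a::euclidean_space \<Rightarrow> real \<Rightarrow> real" and p T :: real
  assumes p: "p > 1"
    and v_measurable: "(\<lambda>(x, t). v x t) \<in> borel_measurable (borel \<Otimes>\<^sub>M borel)"
    and v_pos: "\<And>x t. 0 < t \<Longrightarrow> t < T \<Longrightarrow> 0 < v x t"
    and v_bounded: "\<And>\<tau>. 0 < \<tau> \<Longrightarrow> \<exists>M. \<forall>t\<in>{\<tau>..<T}. \<forall>x. v x t \<le> M"
    and v_mild: "\<And>\<tau> t x. 0 < \<tau> \<Longrightarrow> \<tau> < t \<Longrightarrow> t < T \<Longrightarrow>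
       v x t = kernel_conv heat_kernel (\<lambda>y. v y \<tau>) (t - \<tau>) x
         + duhamel heat_kernel (\<lambda>y s. indicator {\<tau><..<T} s * v y s powr p) \<tau> t x"
begin

lemma v_slice: "(\<lambda>y. v y s) \<in> borel_measurable borel"
proof -
  note [measurable] = v_measurable
  have "(\<lambda>y. (\<lambda>(x, t). v x t) (y, s)) \<in> borel_measurable borel" by measurable
  then show ?thesis by simp
qed

lemma v_abs_bounded:
  assumes "0 < \<tau>"
  obtains M where "M \<ge> 0" "\<And>t x. t \<in> {\<tau>..<T} \<Longrightarrow> \<bar>v x t\<bar> \<le> M"
proof -
  obtain M where M: "\<forall>t\<in>{\<tau>..<T}. \<forall>x. v x t \<le> M" using v_bounded[OF assms] by blast
  have "\<bar>v x t\<bar> \<le> max M 0" if "t \<in> {\<tau>..<T}" for t x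
  proof -
    have "v x t \<le> M" "0 < v x t" using M that v_pos[of t x] assms by auto
    then show ?thesis by simp
  qed
  then show thesis using that[of "max M 0"] by auto
qed

lemma v_slice_bounded:
  assumes "0 < \<tau>" "\<tau> < T"
  obtains M where "\<And>x. \<bar>v x \<tau>\<bar> \<le> M"
  using v_abs_bounded[OF assms(1)] assms(2) by (metis atLeastLessThan_iff order_refl)

text \<open>The cutoff turns a source that is bounded away from time \<open>0\<close> into one
  bounded everywhere, as \<open>duhamel_source\<close> demands. It does not affect Duhamel integrals
  that start at \<open>\<tau>\<close> and end before \<open>T\<close>.\<close>

definition source :: "real \<Rightarrow> 'a \<Rightarrow> real \<Rightarrow> real" where
  "source \<tau> y s = indicator {\<tau><..<T} s * v y s powr p"

lemma source_duhamel_source: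
  assumes "0 < \<tau>"
  obtains M where "duhamel_source (source \<tau>) M"
proof -
  obtain M where M: "M \<ge> 0" "\<And>t x. t \<in> {\<tau>..<T} \<Longrightarrow> \<bar>v x t\<bar> \<le> M" using v_abs_bounded[OF assms] by metis
  have "duhamel_source (source \<tau>) (M powr p)"
  proof
    note [measurable] = v_measurable
    show "(\<lambda>(y, s). source \<tau> y s) \<in> borel_measurable (borel \<Otimes>\<^sub>M borel)"
      unfolding source_def by measurable
    show "\<bar>source \<tau> y s\<bar> \<le> M powr p" for y s
    proof (cases "s \<in> {\<tau><..<T}")
      case True
      then have "v y s \<le> M" "0 < v y s" using M(2)[of s y] v_pos[of s y] assms by auto
      then have "v y s powr p \<le> M powr p" using p by (intro powr_mono2) auto
      then show ?thesis using True by (simp add: source_def)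
    qed (simp add: source_def)
  qed
  then show thesis by (rule that)
qed

definition v' :: "'a \<Rightarrow> 'a \<Rightarrow> real \<Rightarrow> real" where
  "v' b x t = deriv (\<lambda>h. v (x + h *\<^sub>R b) t) 0"

lemma v_eq:
  assumes "0 < \<tau>" "\<tau> < t" "t < T"
  shows "v x t = kernel_conv heat_kernel (\<lambda>y. v y \<tau>) (t - \<tau>) x + duhamel heat_kernel (source \<tau>) \<tau> t x"
  using v_mild[OF assms] by (simp add: source_def[abs_def])

lemma v_space_derivative_from:
  assumes \<tau>: "0 < \<tau>" "\<tau> < t" "t < T" and b: "b \<in> Basis"
  shows "((\<lambda>h. v (x + h *\<^sub>R b) t) has_real_derivative
     kernel_conv (heat_kernel_d b) (\<lambda>y. v y \<tau>) (t - \<tau>) x + duhamel (heat_kernel_d b) (source \<tau>) \<tau> t x) (at 0)"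
proof -
  obtain M where M: "\<And>x. \<bar>v x \<tau>\<bar> \<le> M" using v_abs_bounded[OF \<tau>(1)] \<tau> by (metis atLeastLessThan_iff order_less_trans order_refl)
  obtain M' where "duhamel_source (source \<tau>) M'" using source_duhamel_source[OF \<tau>(1)] by metis
  then interpret duhamel_source "source \<tau>" M' .
  have "((\<lambda>h. kernel_conv heat_kernel (\<lambda>y. v y \<tau>) (t - \<tau>) (x + h *\<^sub>R b)) has_real_derivative kernel_conv (heat_kernel_d b) (\<lambda>y. v y \<tau>) (t - \<tau>) (x + 0 *\<^sub>R b)) (at 0)"
    by (rule kernel_conv_space_derivative[OF gaussian_kernel_heat gaussian_kernel_heat_d[OF b] heat_kernel_space_derivative[OF b] v_slice M])
      (use \<tau> in simp)
  moreover have "((\<lambda>h. duhamel heat_kernel (source \<tau>) \<tau> t (x + h *\<^sub>R b)) has_real_derivative duhamel (heat_kernel_d b) (source \<tau>) \<tau> t x) (at 0)"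
    by (rule duhamel_space_derivative[OF b]) (use \<tau> in simp)
  ultimately show ?thesis unfolding v_eq[OF \<tau>] by (auto intro: DERIV_add)
qed

lemma v'_eq:
  assumes "0 < \<tau>" "\<tau> < t" "t < T" "b \<in> Basis"
  shows "v' b x t = kernel_conv (heat_kernel_d b) (\<lambda>y. v y \<tau>) (t - \<tau>) x + duhamel (heat_kernel_d b) (source \<tau>) \<tau> t x"
  unfolding v'_def by (rule DERIV_imp_deriv[OF v_space_derivative_from[OF assms]])

lemma v_space_derivative:
  assumes "0 < t" "t < T" "b \<in> Basis"
  shows "((\<lambda>h. v (x + h *\<^sub>R b) t) has_real_derivative v' b x t) (at 0)"
  using v_space_derivative_from[of "t/2" t b x] v'_eq[of "t/2" t b x] assms by simp

lemma continuous_on_kernel_part: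
  assumes K: "weakly_singular K C" and f: "f \<in> borel_measurable borel" "\<And>y. \<bar>f y\<bar> \<le> M" and g: "duhamel_source g M'"
  shows "continuous_on (UNIV \<times> {\<tau><..}) (\<lambda>(x, t). kernel_conv K f (t - \<tau>) x + duhamel K g \<tau> t x)"
proof -
  have gK: "gaussian_kernel K" using K by (simp add: weakly_singular_def)
  have "continuous_on (UNIV \<times> {\<tau><..}) (\<lambda>q. (\<lambda>(x, t). kernel_conv K f t x) (fst q, snd q - \<tau>))"
    by (rule continuous_on_compose2[OF continuous_on_kernel_conv[OF gK f]]) (auto intro!: continuous_intros)
  from continuous_on_add[OF this duhamel_source.continuous_on_duhamel[OF g K]]
  show ?thesis by (simp add: case_prod_unfold)
qed

text \<open>Each restart time gives information after that time only. The open strips exhaust the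
  whole domain.\<close>

lemma continuous_on_from_local:
  assumes "\<And>\<tau>. 0 < \<tau> \<Longrightarrow> \<tau> < T \<Longrightarrow> continuous_on (UNIV \<times> {\<tau><..<T}) (F :: 'a \<times> real \<Rightarrow> real)"
  shows "continuous_on (UNIV \<times> {0<..<T}) F"
proof -
  have "\<exists>\<tau>\<in>{0<..<T}. \<tau> < t" if "0 < t" "t < T" for t
    by (rule bexI[of _ "t / 2"]) (use that in auto)
  then have "UNIV \<times> {0<..<T} = (\<Union>\<tau>\<in>{0<..<T}. UNIV \<times> {\<tau><..<T} :: ('a \<times> real) set)"
    by auto
  moreover have "continuous_on (\<Union>\<tau>\<in>{0<..<T}. UNIV \<times> {\<tau><..<T} :: ('a \<times> real) set) F"
    by (rule continuous_on_open_UN) (use assms in \<open>auto intro: open_Times\<close>)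
  ultimately show ?thesis by simp
qed

lemma continuous_on_v: "continuous_on (UNIV \<times> {0<..<T}) (\<lambda>(x, t). v x t)"
proof (rule continuous_on_from_local)
  fix \<tau> assume \<tau>: "0 < \<tau>" "\<tau> < T"
  obtain M where M: "\<And>x. \<bar>v x \<tau>\<bar> \<le> M" using v_slice_bounded \<tau> by metis
  obtain M' where M': "duhamel_source (source \<tau>) M'" using source_duhamel_source[OF \<tau>(1)] by metis
  have "continuous_on (UNIV \<times> {\<tau><..<T}) (\<lambda>(x, t). kernel_conv heat_kernel (\<lambda>y. v y \<tau>) (t - \<tau>) x + duhamel heat_kernel (source \<tau>) \<tau> t x)"
    by (rule continuous_on_subset[OF continuous_on_kernel_part[OF weakly_singular_heat v_slice M M']]) auto
  then show "continuous_on (UNIV \<times> {\<tau><..<T}) (\<lambda>(x, t). v x t)"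
    by (rule continuous_on_cong[THEN iffD1, rotated 2]) (use \<tau> v_eq in auto)
qed

lemma continuous_on_v':
  assumes b: "b \<in> Basis"
  shows "continuous_on (UNIV \<times> {0<..<T}) (\<lambda>(x, t). v' b x t)"
proof (rule continuous_on_from_local)
  fix \<tau> assume \<tau>: "0 < \<tau>" "\<tau> < T"
  obtain M where M: "\<And>x. \<bar>v x \<tau>\<bar> \<le> M" using v_slice_bounded \<tau> by metis
  obtain M' where M': "duhamel_source (source \<tau>) M'" using source_duhamel_source[OF \<tau>(1)] by metis
  have "continuous_on (UNIV \<times> {\<tau><..<T}) (\<lambda>(x, t). kernel_conv (heat_kernel_d b) (\<lambda>y. v y \<tau>) (t - \<tau>) x + duhamel (heat_kernel_d b) (source \<tau>) \<tau> t x)"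
    by (rule continuous_on_subset[OF continuous_on_kernel_part[OF weakly_singular_heat_d[OF b] v_slice M M']]) auto
  then show "continuous_on (UNIV \<times> {\<tau><..<T}) (\<lambda>(x, t). v' b x t)"
    by (rule continuous_on_cong[THEN iffD1, rotated 2]) (use \<tau> v'_eq b in auto)
qed

lemma v'_bounded:
  assumes \<tau>: "0 < \<tau>"
  obtains M where "M \<ge> 0" "\<And>t x b. b \<in> Basis \<Longrightarrow> t \<in> {\<tau>..<T} \<Longrightarrow> \<bar>v' b x t\<bar> \<le> M"
proof (cases "\<tau> < T")
  case False
  then show thesis using that[of 0] by auto
next
  case True
  \<comment> \<open>Restarting at half time keeps \<open>t - ?\<sigma> \<ge> \<tau> / 2\<close>,
    away from the singularity of the gradient estimate.\<close>
  let ?\<sigma> = "\<tau> / 2"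
  let ?C = "2 powr (real DIM('a) / 2)"
  have \<sigma>: "0 < ?\<sigma>" "?\<sigma> < T" using \<tau> True by auto
  obtain M where M: "M \<ge> 0" "\<And>x. \<bar>v x ?\<sigma>\<bar> \<le> M" using v_abs_bounded[OF \<sigma>(1)] \<sigma> by (metis atLeastLessThan_iff order_refl)
  obtain M' where "duhamel_source (source ?\<sigma>) M'" using source_duhamel_source[OF \<sigma>(1)] by metis
  then interpret duhamel_source "source ?\<sigma>" M' .
  let ?B = "?C * (\<tau>/2) powr (- 1/2) * M + ?C * M' * (T + 2 * sqrt T)"
  have "\<bar>v' b x t\<bar> \<le> ?B" if b: "b \<in> Basis" and t: "t \<in> {\<tau>..<T}" for t x b
  proof -
    have "\<bar>kernel_conv (heat_kernel_d b) (\<lambda>y. v y ?\<sigma>) (t - ?\<sigma>) x\<bar> \<le> ?C * (t - ?\<sigma>) powr (- 1/2) * M"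
      using t \<tau> by (intro abs_kernel_conv_heat_d_le b v_slice M) auto
    also have "\<dots> \<le> ?C * (\<tau>/2) powr (- 1/2) * M"
      using t \<tau> M by (intro mult_right_mono mult_left_mono powr_mono2') auto
    finally have 1: "\<bar>kernel_conv (heat_kernel_d b) (\<lambda>y. v y ?\<sigma>) (t - ?\<sigma>) x\<bar> \<le> ?C * (\<tau>/2) powr (- 1/2) * M" .
    have "\<bar>duhamel (heat_kernel_d b) (source ?\<sigma>) ?\<sigma> t x\<bar> \<le> ?C * M' * (t - ?\<sigma> + 2 * sqrt (t - ?\<sigma>))"
      using t \<tau> by (intro duhamel_bound weakly_singular_heat_d b) auto
    also have "\<dots> \<le> ?C * M' * (T + 2 * sqrt T)"
      using t \<tau> M_nonneg by (intro mult_left_mono add_mono real_sqrt_le_mono) auto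
    finally have 2: "\<bar>duhamel (heat_kernel_d b) (source ?\<sigma>) ?\<sigma> t x\<bar> \<le> ?C * M' * (T + 2 * sqrt T)" .
    have "v' b x t = kernel_conv (heat_kernel_d b) (\<lambda>y. v y ?\<sigma>) (t - ?\<sigma>) x + duhamel (heat_kernel_d b) (source ?\<sigma>) ?\<sigma> t x"
      using t \<tau> by (intro v'_eq b) auto
    then show ?thesis using 1 2 by linarith
  qed
  moreover have "?B \<ge> 0" using M M_nonneg True \<tau> by simp
  ultimately show thesis using that[of ?B] by blast
qed

definition source' :: "real \<Rightarrow> 'a \<Rightarrow> 'a \<Rightarrow> real \<Rightarrow> real" where
  "source' \<tau> b y s = indicator {\<tau><..<T} s * (p * v y s powr (p - 1) * v' b y s)"

lemma source_C1:
  assumes \<tau>: "0 < \<tau>"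
  obtains M M' where "duhamel_C1_source (source \<tau>) M (source' \<tau>) M'"
proof -
  obtain M0 where M0: "duhamel_source (source \<tau>) M0" using source_duhamel_source[OF \<tau>] by metis
  obtain M where M: "M \<ge> 0" "\<And>t x. t \<in> {\<tau>..<T} \<Longrightarrow> \<bar>v x t\<bar> \<le> M" using v_abs_bounded[OF \<tau>] by metis
  obtain N where N: "N \<ge> 0" "\<And>t x b. b \<in> Basis \<Longrightarrow> t \<in> {\<tau>..<T} \<Longrightarrow> \<bar>v' b x t\<bar> \<le> N" using v'_bounded[OF \<tau>] by metis
  have "duhamel_source (source' \<tau> b) (p * M powr (p - 1) * N)" if b: "b \<in> Basis" for b
  proof
    have "continuous_on (UNIV \<times> {\<tau><..<T}) (\<lambda>q. v' b (fst q) (snd q))"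
      using continuous_on_subset[OF continuous_on_v'[OF b, unfolded case_prod_unfold], of "UNIV \<times> {\<tau><..<T}"] \<tau>
      by (simp add: Sigma_mono subset_iff)
    then have "(\<lambda>q. indicator (UNIV \<times> {\<tau><..<T}) q *\<^sub>R v' b (fst q) (snd q)) \<in> borel_measurable borel"
      by (intro borel_measurable_continuous_on_indicator) (auto intro!: borel_open open_Times)
    moreover have "(\<lambda>q. indicator (UNIV \<times> {\<tau><..<T}) q *\<^sub>R v' b (fst q) (snd q)) = (\<lambda>q. indicator {\<tau><..<T} (snd q) * v' b (fst q) (snd q))"
      by (auto simp: indicator_def fun_eq_iff)
    ultimately have [measurable]: "(\<lambda>q. indicator {\<tau><..<T} (snd q) * v' b (fst q) (snd q)) \<in> borel_measurable (borel \<Otimes>\<^sub>M borel)"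
      by (simp only: borel_prod)
    note [measurable] = v_measurable
    have "(\<lambda>(y, s). source' \<tau> b y s) = (\<lambda>q. p * v (fst q) (snd q) powr (p - 1) * (indicator {\<tau><..<T} (snd q) * v' b (fst q) (snd q)))"
      by (auto simp: source'_def fun_eq_iff)
    then show "(\<lambda>(y, s). source' \<tau> b y s) \<in> borel_measurable (borel \<Otimes>\<^sub>M borel)" by simp
    show "\<bar>source' \<tau> b y s\<bar> \<le> p * M powr (p - 1) * N" for y s
    proof (cases "s \<in> {\<tau><..<T}")
      case True
      then have "v y s \<le> M" "0 < v y s" "\<bar>v' b y s\<bar> \<le> N" using M(2)[of s y] N(2)[OF b, of s y] v_pos[of s y] \<tau> by auto
      then show ?thesis using True p by (auto simp: source'_def abs_mult intro!: mult_mono powr_mono2)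
    qed (use N p in \<open>simp add: source'_def\<close>)
  qed
  moreover have "((\<lambda>h. source \<tau> (y + h *\<^sub>R b) s) has_real_derivative source' \<tau> b y s) (at 0)" if b: "b \<in> Basis" for b y s
  proof (cases "s \<in> {\<tau><..<T}")
    case True
    then have "((\<lambda>h. v (y + h *\<^sub>R b) s powr p) has_real_derivative p * v (y + 0 *\<^sub>R b) s powr (p - of_nat 1) * v' b y s) (at 0)"
      using \<tau> v_pos by (intro DERIV_fun_powr v_space_derivative b) auto
    then show ?thesis using True by (simp add: source_def source'_def)
  qed (simp add: source_def source'_def)
  ultimately have "duhamel_C1_source (source \<tau>) M0 (source' \<tau>) (p * M powr (p - 1) * N)"
    using M0 by (simp add: duhamel_C1_source_def duhamel_C1_source_axioms_def)
  then show thesis by (rule that)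
qed

lemma v'_slice:
  assumes "b \<in> Basis" "0 < t" "t < T"
  shows "(\<lambda>y. v' b y t) \<in> borel_measurable borel"
proof -
  have "continuous_on UNIV (\<lambda>y. (\<lambda>(x, t). v' b x t) (y, t))"
    by (rule continuous_on_compose2[OF continuous_on_v'[OF assms(1)]]) (use assms in \<open>auto intro!: continuous_intros\<close>)
  then show ?thesis by (simp add: borel_measurable_continuous_onI)
qed

definition v'' :: "'a \<Rightarrow> 'a \<Rightarrow> 'a \<Rightarrow> real \<Rightarrow> real" where
  "v'' c b x t = deriv (\<lambda>h. v' b (x + h *\<^sub>R c) t) 0"

text \<open>The bootstrap: once the derivative sits on the slice and on the source,
  \<open>v' b\<close> again satisfies a Duhamel formula with the undifferentiated kernel, and a
  second derivative can be put on that kernel.\<close>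

lemma v'_eq_heat:
  assumes \<tau>: "0 < \<tau>" "\<tau> < t" "t < T" and b: "b \<in> Basis"
  shows "v' b x t = kernel_conv heat_kernel (\<lambda>y. v' b y \<tau>) (t - \<tau>) x + duhamel heat_kernel (source' \<tau> b) \<tau> t x"
proof -
  have \<tau>T: "\<tau> < T" using \<tau> by simp
  obtain M where M: "\<And>x. \<bar>v x \<tau>\<bar> \<le> M" using v_slice_bounded[OF \<tau>(1) \<tau>T] by metis
  obtain N where N: "\<And>x. \<bar>v' b x \<tau>\<bar> \<le> N" using v'_bounded[OF \<tau>(1)] \<tau>T b by (metis atLeastLessThan_iff order_refl)
  obtain M0 M1 where "duhamel_C1_source (source \<tau>) M0 (source' \<tau>) M1" using source_C1[OF \<tau>(1)] by metis
  then interpret S: duhamel_C1_source "source \<tau>" M0 "source' \<tau>" M1 .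
  have "kernel_conv (heat_kernel_d b) (\<lambda>y. v y \<tau>) (t - \<tau>) x = kernel_conv heat_kernel (\<lambda>y. v' b y \<tau>) (t - \<tau>) x"
    by (rule kernel_conv_heat_d_eq[OF _ b v_slice M v_space_derivative[OF \<tau>(1) \<tau>T b] v'_slice[OF b \<tau>(1) \<tau>T] N]) (use \<tau> in simp)
  moreover have "duhamel (heat_kernel_d b) (source \<tau>) \<tau> t x = duhamel heat_kernel (source' \<tau> b) \<tau> t x"
    by (rule duhamel_heat_d_eq[OF S.duhamel_source_axioms S.g'_source[OF b] b S.g_deriv[OF b]])
  ultimately show ?thesis using v'_eq[OF \<tau> b] by simp
qed

lemma v'_space_derivative_from:
  assumes \<tau>: "0 < \<tau>" "\<tau> < t" "t < T" and b: "b \<in> Basis" and c: "c \<in> Basis"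
  shows "((\<lambda>h. v' b (x + h *\<^sub>R c) t) has_real_derivative
     kernel_conv (heat_kernel_d c) (\<lambda>y. v' b y \<tau>) (t - \<tau>) x + duhamel (heat_kernel_d c) (source' \<tau> b) \<tau> t x) (at 0)"
proof -
  have \<tau>T: "\<tau> < T" using \<tau> by simp
  obtain N where N: "\<And>x. \<bar>v' b x \<tau>\<bar> \<le> N" using v'_bounded[OF \<tau>(1)] \<tau>T b by (metis atLeastLessThan_iff order_refl)
  obtain M0 M1 where "duhamel_C1_source (source \<tau>) M0 (source' \<tau>) M1" using source_C1[OF \<tau>(1)] by metis
  then have "duhamel_source (source' \<tau> b) M1" using duhamel_C1_source.g'_source b by blast
  then interpret duhamel_source "source' \<tau> b" M1 .
  have "((\<lambda>h. kernel_conv heat_kernel (\<lambda>y. v' b y \<tau>) (t - \<tau>) (x + h *\<^sub>R c)) has_real_derivative kernel_conv (heat_kernel_d c) (\<lambda>y. v' b y \<tau>) (t - \<tau>) (x + 0 *\<^sub>R c)) (at 0)"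
    by (rule kernel_conv_space_derivative[OF gaussian_kernel_heat gaussian_kernel_heat_d[OF c] heat_kernel_space_derivative[OF c] v'_slice[OF b \<tau>(1) \<tau>T] N])
      (use \<tau> in simp)
  moreover have "((\<lambda>h. duhamel heat_kernel (source' \<tau> b) \<tau> t (x + h *\<^sub>R c)) has_real_derivative duhamel (heat_kernel_d c) (source' \<tau> b) \<tau> t x) (at 0)"
    by (rule duhamel_space_derivative[OF c]) (use \<tau> in simp)
  ultimately show ?thesis unfolding v'_eq_heat[OF \<tau> b] by (auto intro: DERIV_add)
qed

lemma v''_eq:
  assumes "0 < \<tau>" "\<tau> < t" "t < T" "b \<in> Basis" "c \<in> Basis"
  shows "v'' c b x t = kernel_conv (heat_kernel_d c) (\<lambda>y. v' b y \<tau>) (t - \<tau>) x + duhamel (heat_kernel_d c) (source' \<tau> b) \<tau> t x"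
  unfolding v''_def by (rule DERIV_imp_deriv[OF v'_space_derivative_from[OF assms]])

lemma v'_space_derivative:
  assumes "0 < t" "t < T" "b \<in> Basis" "c \<in> Basis"
  shows "((\<lambda>h. v' b (x + h *\<^sub>R c) t) has_real_derivative v'' c b x t) (at 0)"
  using v'_space_derivative_from[of "t/2" t b c x] v''_eq[of "t/2" t b c x] assms by simp

lemma continuous_on_v'':
  assumes b: "b \<in> Basis" and c: "c \<in> Basis"
  shows "continuous_on (UNIV \<times> {0<..<T}) (\<lambda>(x, t). v'' c b x t)"
proof (rule continuous_on_from_local)
  fix \<tau> assume \<tau>: "0 < \<tau>" "\<tau> < T"
  obtain N where N: "\<And>x. \<bar>v' b x \<tau>\<bar> \<le> N" using v'_bounded[OF \<tau>(1)] \<tau> b by (metis atLeastLessThan_iff order_refl)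
  obtain M0 M1 where "duhamel_C1_source (source \<tau>) M0 (source' \<tau>) M1" using source_C1[OF \<tau>(1)] by metis
  then have M1: "duhamel_source (source' \<tau> b) M1" using duhamel_C1_source.g'_source b by blast
  have "continuous_on (UNIV \<times> {\<tau><..<T}) (\<lambda>(x, t). kernel_conv (heat_kernel_d c) (\<lambda>y. v' b y \<tau>) (t - \<tau>) x + duhamel (heat_kernel_d c) (source' \<tau> b) \<tau> t x)"
    by (rule continuous_on_subset[OF continuous_on_kernel_part[OF weakly_singular_heat_d[OF c] v'_slice[OF b \<tau>] N M1]]) auto
  then show "continuous_on (UNIV \<times> {\<tau><..<T}) (\<lambda>(x, t). v'' c b x t)"
    by (rule continuous_on_cong[THEN iffD1, rotated 2]) (use \<tau> v''_eq b c in auto)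
qed

text \<open>The flow of the slice at \<open>\<tau>\<close> contributes its Laplacian, and by
  \<open>duhamel_increment\<close> the Duhamel term contributes its own Laplacian plus the source.
  By \<open>v''_eq\<close> the two Laplacians add up to that of \<open>v\<close>.\<close>

lemma v_time_derivative:
  assumes t: "0 < t" "t < T"
  shows "(v x has_real_derivative (\<Sum>b\<in>Basis. v'' b b x t) + v x t powr p) (at t)"
proof -
  define \<tau> where "\<tau> = t / 2"
  have \<tau>: "0 < \<tau>" "\<tau> < t" "\<tau> < T" using t by (auto simp: \<tau>_def)
  obtain M where M: "\<And>x. \<bar>v x \<tau>\<bar> \<le> M" using v_slice_bounded \<tau> by metis
  obtain N where N: "\<And>b x. b \<in> Basis \<Longrightarrow> \<bar>v' b x \<tau>\<bar> \<le> N" using v'_bounded[OF \<tau>(1)] \<tau> by (metis atLeastLessThan_iff order_refl)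
  obtain M0 M1 where "duhamel_C1_source (source \<tau>) M0 (source' \<tau>) M1" using source_C1[OF \<tau>(1)] by metis
  then interpret S: duhamel_C1_source "source \<tau>" M0 "source' \<tau>" M1 .
  have 1: "((\<lambda>t. kernel_conv heat_kernel (\<lambda>y. v y \<tau>) (t - \<tau>) x) has_real_derivative
      (\<Sum>b\<in>Basis. kernel_conv (heat_kernel_d b) (\<lambda>y. v' b y \<tau>) (t - \<tau>) x)) (at t)"
  proof -
    have "((\<lambda>t. kernel_conv heat_kernel (\<lambda>y. v y \<tau>) t x) has_real_derivative
      (\<Sum>b\<in>Basis. kernel_conv (heat_kernel_d b) (\<lambda>y. v' b y \<tau>) (t - \<tau>) x)) (at (t + - \<tau>))"
      using heat_conv_time_derivative[where f' = "\<lambda>b y. v' b y \<tau>", OF _ v_slice M v_space_derivative[OF \<tau>(1,3)] v'_slice[OF _ \<tau>(1,3)] N, of "t - \<tau>" x] \<tau>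
      by simp
    then have "((\<lambda>t. kernel_conv heat_kernel (\<lambda>y. v y \<tau>) (t + - \<tau>) x) has_real_derivative
      (\<Sum>b\<in>Basis. kernel_conv (heat_kernel_d b) (\<lambda>y. v' b y \<tau>) (t - \<tau>) x)) (at t)"
      by (rule DERIV_shift[THEN iffD1])
    then show ?thesis by simp
  qed
  let ?\<psi> = "\<lambda>r. (\<Sum>b\<in>Basis. duhamel (heat_kernel_d b) (source' \<tau> b) \<tau> r x) + source \<tau> x r"
  have "((\<lambda>t. \<integral>r. indicator {\<tau><..<t} r * ?\<psi> r \<partial>lborel) has_real_derivative ?\<psi> t) (at t)"
  proof (rule lborel_integral_has_real_derivative[where T = T])
    show "integrable lborel (\<lambda>r. indicator {\<tau><..<t} r * ?\<psi> r)" if "\<tau> < t" "t < T" for t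
      using S.integrable_increment[OF that(1)] .
    have "continuous_on {\<tau><..<T} (\<lambda>r. duhamel (heat_kernel_d b) (source' \<tau> b) \<tau> r x)" if b: "b \<in> Basis" for b
    proof -
      have "continuous_on {\<tau><..<T} (\<lambda>r. (\<lambda>(x, t). duhamel (heat_kernel_d b) (source' \<tau> b) \<tau> t x) (x, r))"
        by (rule continuous_on_compose2[OF duhamel_source.continuous_on_duhamel[OF S.g'_source[OF b] weakly_singular_heat_d[OF b]]])
          (auto intro!: continuous_intros)
      then show ?thesis by simp
    qed
    moreover have "continuous_on {\<tau><..<T} (source \<tau> x)"
    proof -
      have "continuous_on {\<tau><..<T} (\<lambda>r. (\<lambda>(x, t). v x t) (x, r))"
        by (rule continuous_on_compose2[OF continuous_on_v]) (use \<tau> in \<open>auto intro!: continuous_intros\<close>)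
      then have "continuous_on {\<tau><..<T} (\<lambda>r. v x r powr p)"
      proof (intro continuous_on_powr continuous_on_const)
        show "\<forall>r\<in>{\<tau><..<T}. v x r \<noteq> 0" using \<tau> less_imp_neq[OF v_pos[of _ x]] by fastforce
      qed simp
      then show ?thesis
        by (rule continuous_on_cong[THEN iffD1, rotated 2]) (auto simp: source_def)
    qed
    ultimately show "continuous_on {\<tau><..<T} ?\<psi>" by (intro continuous_intros) auto
  qed (use \<tau> t in auto)
  then have 2: "((\<lambda>t. duhamel heat_kernel (source \<tau>) \<tau> t x) has_real_derivative ?\<psi> t) (at t)"
  proof (rule has_field_derivative_transform_within_open[where S = "{\<tau><..}"])
    show "(\<integral>r. indicator {\<tau><..<t} r * ?\<psi> r \<partial>lborel) = duhamel heat_kernel (source \<tau>) \<tau> t x" if "t \<in> {\<tau><..}" for t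
      using S.duhamel_increment[of \<tau> t x] that by simp
  qed (use \<tau> in auto)
  have "((\<lambda>t. kernel_conv heat_kernel (\<lambda>y. v y \<tau>) (t - \<tau>) x + duhamel heat_kernel (source \<tau>) \<tau> t x) has_real_derivative
     (\<Sum>b\<in>Basis. kernel_conv (heat_kernel_d b) (\<lambda>y. v' b y \<tau>) (t - \<tau>) x) + ?\<psi> t) (at t)"
    by (rule DERIV_add[OF 1 2])
  moreover have "(\<Sum>b\<in>Basis. kernel_conv (heat_kernel_d b) (\<lambda>y. v' b y \<tau>) (t - \<tau>) x) + ?\<psi> t = (\<Sum>b\<in>Basis. v'' b b x t) + v x t powr p"
    using \<tau> t by (simp add: v''_eq[OF \<tau>(1,2) t(2)] sum.distrib source_def)
  ultimately have "((\<lambda>t. kernel_conv heat_kernel (\<lambda>y. v y \<tau>) (t - \<tau>) x + duhamel heat_kernel (source \<tau>) \<tau> t x) has_real_derivative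
     (\<Sum>b\<in>Basis. v'' b b x t) + v x t powr p) (at t)" by simp
  then show ?thesis
  proof (rule has_field_derivative_transform_within_open[where S = "{\<tau><..<T}"])
    show "kernel_conv heat_kernel (\<lambda>y. v y \<tau>) (t - \<tau>) x + duhamel heat_kernel (source \<tau>) \<tau> t x = v x t" if "t \<in> {\<tau><..<T}" for t
      using v_eq[OF \<tau>(1), of t x] that by simp
  qed (use \<tau> t in auto)
qed

lemma v_lipschitz:
  assumes "0 < \<tau>"
  obtains L where "L \<ge> 0" "\<And>t x z. t \<in> {\<tau>..<T} \<Longrightarrow> \<bar>v (x + z) t - v x t\<bar> \<le> L * norm z"
proof -
  obtain N where N: "N \<ge> 0" "\<And>t x b. b \<in> Basis \<Longrightarrow> t \<in> {\<tau>..<T} \<Longrightarrow> \<bar>v' b x t\<bar> \<le> N" using v'_bounded[OF assms] by metis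
  have "\<bar>v (x + z) t - v x t\<bar> \<le> real DIM('a) * N * norm z" if "t \<in> {\<tau>..<T}" for t x z
    using that assms N by (intro lipschitz_of_bounded_partials[where f = "\<lambda>x. v x t" and f' = "\<lambda>b x. v' b x t"] v_space_derivative) auto
  then show thesis using that[of "real DIM('a) * N"] N by simp
qed

text \<open>Over a time step of length \<open>t - s\<close> the heat flow moves a Lipschitz function by \<open>O(sqrt (t - s))\<close>
  and the Duhamel term contributes \<open>O(t - s + sqrt (t - s))\<close>.\<close>

lemma v_time_modulus:
  assumes \<tau>: "0 < \<tau>"
  obtains C where "C \<ge> 0" "\<And>s t x. \<tau> \<le> s \<Longrightarrow> s \<le> t \<Longrightarrow> t < T \<Longrightarrow> \<bar>v x t - v x s\<bar> \<le> C * (t - s + sqrt (t - s))"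
proof -
  obtain L where L: "L \<ge> 0" "\<And>t x z. t \<in> {\<tau>..<T} \<Longrightarrow> \<bar>v (x + z) t - v x t\<bar> \<le> L * norm z" using v_lipschitz[OF \<tau>] by metis
  obtain M where M: "\<And>t x. t \<in> {\<tau>..<T} \<Longrightarrow> \<bar>v x t\<bar> \<le> M" using v_abs_bounded[OF \<tau>] by metis
  obtain M' where M': "duhamel_source (source \<tau>) M'" using source_duhamel_source[OF \<tau>] by metis
  have M'0: "M' \<ge> 0" using duhamel_source.M_nonneg[OF M'] .
  let ?c = "2 * 2 powr (real DIM('a) / 2)"
  let ?C = "L * ?c + 2 * M'"
  have "\<bar>v x t - v x s\<bar> \<le> ?C * (t - s + sqrt (t - s))" if st: "\<tau> \<le> s" "s \<le> t" "t < T" for s t x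
  proof (cases "s = t")
    case False
    then have lt: "s < t" using st by simp
    have s: "0 < s" "s \<in> {\<tau>..<T}" using \<tau> st by auto
    have "duhamel_source (source s) M'"
    proof
      note [measurable] = v_measurable
      show "(\<lambda>(y, s'). source s y s') \<in> borel_measurable (borel \<Otimes>\<^sub>M borel)" unfolding source_def by measurable
      show "\<bar>source s y r\<bar> \<le> M'" for y r
        using duhamel_source.g_bound[OF M', of y r] st M'0 by (auto simp: source_def indicator_def split: if_splits)
    qed
    then have 1: "\<bar>duhamel heat_kernel (source s) s t x\<bar> \<le> 1 * M' * (t - s + 2 * sqrt (t - s))"
      using st by (intro duhamel_source.duhamel_bound weakly_singular_heat) auto
    have 2: "\<bar>kernel_conv heat_kernel (\<lambda>y. v y s) (t - s) x - v x s\<bar> \<le> 0 + L * (?c * sqrt (t - s))"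
    proof (rule kernel_conv_heat_near[OF _ v_slice M[OF s(2)]])
      show "\<bar>v (x - z) s - v x s\<bar> \<le> 0 + L * norm z" for z using L(2)[OF s(2), of x "- z"] by simp
    qed (use lt L in auto)
    have "\<bar>v x t - v x s\<bar> \<le> L * ?c * sqrt (t - s) + M' * (t - s + 2 * sqrt (t - s))"
      using 1 2 v_eq[OF s(1) lt st(3), of x] by simp
    also have "\<dots> \<le> L * ?c * (t - s + sqrt (t - s)) + 2 * M' * (t - s + sqrt (t - s))"
    proof (rule add_mono)
      show "L * ?c * sqrt (t - s) \<le> L * ?c * (t - s + sqrt (t - s))" using L lt by (intro mult_left_mono) auto
      have "M' * (t - s + 2 * sqrt (t - s)) \<le> M' * (2 * (t - s + sqrt (t - s)))" using M'0 lt by (intro mult_left_mono) auto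
      then show "M' * (t - s + 2 * sqrt (t - s)) \<le> 2 * M' * (t - s + sqrt (t - s))" by (simp only: mult_ac)
    qed
    finally show ?thesis by (simp only: distrib_right)
  qed (use L M'0 in auto)
  moreover have "?C \<ge> 0" using L M'0 by simp
  ultimately show thesis using that[of ?C] by blast
qed

end

subsection \<open>Existence of a mild solution below a supersolution\<close>

text \<open>The bridge from the extended integrals of the construction to the real integrals of the
  regularity theory.\<close>

lemma nn_heat_eq_kernel_conv:
  assumes t: "t > 0" and f: "f \<in> borel_measurable borel" "\<And>y. 0 \<le> f y" "\<And>y. f y \<le> M"
  shows "nn_heat t (\<lambda>y. ennreal (f y)) x = ennreal (kernel_conv heat_kernel f t (x::'a::euclidean_space))"
proof -
  have fM: "\<bar>f y\<bar> \<le> M" for y using f(2,3)[of y] by simp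
  have "nn_heat t (\<lambda>y. ennreal (f y)) x = (\<integral>\<^sup>+y. ennreal (heat_kernel t (x - y) * f y) \<partial>lborel)"
    unfolding nn_heat_def using f(2) by (simp add: ennreal_mult)
  also have "\<dots> = ennreal (kernel_conv heat_kernel f t x)"
    unfolding kernel_conv_def
    by (rule nn_integral_eq_integral[OF integrable_kernel_conv[OF gaussian_kernel_heat t f(1) fM]]) (use f in auto)
  finally show ?thesis .
qed

lemma kernel_conv_heat_nonneg:
  "(\<And>y. 0 \<le> f y) \<Longrightarrow> 0 \<le> kernel_conv heat_kernel f t x"
  unfolding kernel_conv_def by (intro Bochner_Integration.integral_nonneg) simp

lemma nn_heat_le_integral:
  fixes x :: "'a::euclidean_space"
  assumes "t > 0" and [measurable]: "f \<in> borel_measurable borel"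
  shows "nn_heat t f x \<le> ennreal ((4 * pi * t) powr (- real DIM('a) / 2)) * (\<integral>\<^sup>+y. f y \<partial>lborel)"
proof -
  have "nn_heat t f x \<le> (\<integral>\<^sup>+y. ennreal ((4 * pi * t) powr (- real DIM('a) / 2)) * f y \<partial>lborel)"
    unfolding nn_heat_def by (intro nn_integral_mono mult_right_mono ennreal_leI heat_kernel_le assms) simp
  then show ?thesis by (simp add: nn_integral_cmult)
qed

lemma nn_heat_pos:
  fixes x :: "'a::euclidean_space"
  assumes t: "t > 0" and [measurable]: "f \<in> borel_measurable borel" and pos: "AE y in lborel. 0 < f y"
  shows "0 < nn_heat t f x"
proof (rule ccontr)
  assume "\<not> 0 < nn_heat t f x"
  then have "(\<integral>\<^sup>+y. ennreal (heat_kernel t (x - y)) * f y \<partial>lborel) = 0" by (simp add: nn_heat_def)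
  then have "AE y in lborel. ennreal (heat_kernel t (x - y)) * f y = 0"
    by (subst (asm) nn_integral_0_iff_AE) measurable
  with pos have "AE y in (lborel :: 'a measure). False"
  proof eventually_elim
    case (elim y)
    have "heat_kernel t (x - y) > 0" using t by (rule heat_kernel_pos)
    then show ?case using elim by (auto simp: ennreal_eq_0_iff not_less[symmetric])
  qed
  then have "emeasure (lborel :: 'a measure) (space lborel) = 0" by (simp add: AE_iff_measurable[OF _ refl])
  then show False by simp
qed

text \<open>The tangent line to the concave function \<open>s powr (1 / p)\<close> at
  \<open>s = m powr p\<close>, evaluated at \<open>s = a powr p\<close>; it is obtained from Young's
  inequality. Being affine in \<open>a powr p\<close>, it can be averaged against the
  kernel.\<close>

lemma powr_tangent:
  fixes a m p :: real
  assumes "p > 1" "a \<ge> 0" "m > 0"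
  shows "a \<le> m powr (1 - p) / p * a powr p + m * (1 - 1 / p)"
proof -
  let ?q = "p / (p - 1)"
  have "a * m powr (p - 1) \<le> a powr p / p + (m powr (p - 1)) powr ?q / ?q"
    using assms by (intro Youngs_inequality) (auto simp: field_simps)
  also have "(m powr (p - 1)) powr ?q = m powr p" using assms by (simp add: powr_powr)
  finally have "a * m powr (p - 1) * m powr (1 - p) \<le> (a powr p / p + m powr p / ?q) * m powr (1 - p)"
    by (rule mult_right_mono) simp
  then have "a * (m powr (p - 1) * m powr (1 - p)) \<le> a powr p / p * m powr (1 - p) + (m powr p * m powr (1 - p)) * (1 / ?q)"
  proof -
    have "(A + B / q) * C = A * C + (B * C) * (1 / q)" "a * (B * C) = a * B * C" for A B C q :: real
      by (simp_all add: distrib_right)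
    then show ?thesis using \<open>a * m powr (p - 1) * m powr (1 - p) \<le> _\<close> by (simp only:)
  qed
  moreover have "m powr (p - 1) * m powr (1 - p) = 1" "m powr p * m powr (1 - p) = m"
    using assms by (simp_all add: powr_add[symmetric])
  moreover have "1 / ?q = 1 - 1 / p" using assms by (simp add: field_simps)
  ultimately show ?thesis by (simp only: mult_1_right times_divide_eq_left mult.commute[of "a powr p"])
qed

text \<open>Averaging the tangent bound at \<open>m\<close> with \<open>m powr p \<ge> c\<close>
  gives the bound \<open>m\<close>, because the kernel has unit mass.\<close>

lemma nn_heat_jensen:
  fixes x :: "'a::euclidean_space"
  assumes t: "t > 0" and p: "p > 1" and f: "f \<in> borel_measurable borel" "\<And>y. 0 \<le> f y"
    and c: "c \<ge> 0" "nn_heat t (\<lambda>y. ennreal (f y powr p)) x \<le> ennreal c"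
  shows "nn_heat t (\<lambda>y. ennreal (f y)) x \<le> ennreal (c powr (1 / p))"
proof (rule ennreal_le_epsilon)
  note [measurable] = f(1)
  fix e :: real assume e: "0 < e"
  \<comment> \<open>Adding \<open>e\<close> keeps the point of tangency positive even when
    \<open>c = 0\<close>.\<close>
  define m where "m = c powr (1 / p) + e"
  have l: "m > 0" using e by (simp add: m_def add_nonneg_pos)
  have "c = (c powr (1 / p)) powr p" using c p by (simp add: powr_powr)
  also have "\<dots> \<le> m powr p" using e p by (intro powr_mono2) (auto simp: m_def)
  finally have cl: "c \<le> m powr p" .
  have "nn_heat t (\<lambda>y. ennreal (f y)) x \<le>
      nn_heat t (\<lambda>y. ennreal (m powr (1 - p) / p) * ennreal (f y powr p) + ennreal (m * (1 - 1 / p))) x"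
    using powr_tangent[OF p f(2) l] p l
    by (intro nn_heat_mono) (auto simp: ennreal_mult[symmetric] ennreal_plus[symmetric] simp del: ennreal_plus intro!: ennreal_leI)
  also have "\<dots> = ennreal (m powr (1 - p) / p) * nn_heat t (\<lambda>y. ennreal (f y powr p)) x + ennreal (m * (1 - 1 / p))"
    using t by (simp add: nn_heat_add nn_heat_cmult nn_heat_const)
  also have "\<dots> \<le> ennreal (m powr (1 - p) / p) * ennreal (m powr p) + ennreal (m * (1 - 1 / p))"
    by (intro add_right_mono mult_left_mono order_trans[OF c(2)] ennreal_leI cl) simp
  also have "\<dots> = ennreal (m powr (1 - p) / p * m powr p + m * (1 - 1 / p))"
    using p l by (simp add: ennreal_mult[symmetric] ennreal_plus[symmetric] del: ennreal_plus)
  also have "m powr (1 - p) / p * m powr p + m * (1 - 1 / p) = m"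
  proof -
    have "m powr (1 - p) * m powr p = m" using l by (simp add: powr_add[symmetric])
    then show ?thesis using p by (simp add: field_simps)
  qed
  finally show "nn_heat t (\<lambda>y. ennreal (f y)) x \<le> ennreal (c powr (1 / p)) + ennreal e"
    using e by (simp add: m_def ennreal_plus)
qed

section \<open>Data of critical growth and the supersolution\<close>

text \<open>Since \<open>ennreal\<close> sends negative reals to \<open>0\<close>, the integral in
  \<open>W_tail\<close> is the mass of \<open>W powr p\<close> above the level \<open>M\<close>.
  This tail condition is the form in which the integrability of the singular profile enters the
  existence proof.\<close>

locale critical_datum =
  fixes W :: "'a::euclidean_space \<Rightarrow> real" and p :: real
  assumes p: "p > 1" and p_critical: "(p - 1) / p = 2 / real DIM('a)"
    and W_measurable [measurable]: "W \<in> borel_measurable borel" and W_nonneg: "\<And>x. 0 \<le> W x"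
    and W_pos: "AE x in lborel. 0 < W x"
    and W_tail: "\<And>e. e > 0 \<Longrightarrow> \<exists>M\<ge>0. (\<integral>\<^sup>+y. ennreal (W y powr p - M) \<partial>lborel) \<le> ennreal e"
begin

definition \<Phi> :: "real \<Rightarrow> 'a \<Rightarrow> ennreal" where
  "\<Phi> t x = nn_heat t (\<lambda>y. ennreal (W y powr p)) x"

definition \<phi> :: "real \<Rightarrow> 'a \<Rightarrow> real" where "\<phi> t x = enn2real (\<Phi> t x)"

lemma \<phi>_nonneg [simp]: "0 \<le> \<phi> t x" by (simp add: \<phi>_def)

text \<open>The part above \<open>M\<close> has mass at most \<open>e\<close>, to which the sup
  bound of the kernel applies; the part below \<open>M\<close> stays below \<open>M\<close> under
  the flow.\<close>

lemma \<Phi>_bound: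
  assumes e: "e > 0"
  obtains M where "M \<ge> 0" "(\<integral>\<^sup>+y. ennreal (W y powr p - M) \<partial>lborel) \<le> ennreal e"
    "\<And>t x. t > 0 \<Longrightarrow> \<Phi> t x \<le> nn_heat t (\<lambda>y. ennreal (W y powr p - M)) x + ennreal M"
    "\<And>t x. t > 0 \<Longrightarrow> \<Phi> t x \<le> ennreal (t powr (- real DIM('a) / 2) * e + M)"
proof -
  obtain M where M: "M \<ge> 0" "(\<integral>\<^sup>+y. ennreal (W y powr p - M) \<partial>lborel) \<le> ennreal e" using W_tail[OF e] by blast
  have 1: "\<Phi> t x \<le> nn_heat t (\<lambda>y. ennreal (W y powr p - M)) x + ennreal M" if t: "t > 0" for t x
  proof -
    have "\<Phi> t x \<le> nn_heat t (\<lambda>y. ennreal (W y powr p - M) + ennreal M) x"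
      unfolding \<Phi>_def
    proof (rule nn_heat_mono)
      fix y
      show "ennreal (W y powr p) \<le> ennreal (W y powr p - M) + ennreal M"
      proof (cases "W y powr p \<le> M")
        case True
        then show ?thesis by (simp add: ennreal_leI ennreal_neg)
      next
        case False
        then show ?thesis using M by (simp add: ennreal_plus[symmetric] del: ennreal_plus)
      qed
    qed
    also have "\<dots> = nn_heat t (\<lambda>y. ennreal (W y powr p - M)) x + ennreal M"
      using t by (simp add: nn_heat_add nn_heat_const)
    finally show ?thesis .
  qed
  moreover have "\<Phi> t x \<le> ennreal (t powr (- real DIM('a) / 2) * e + M)" if t: "t > 0" for t x
  proof -
    have "nn_heat t (\<lambda>y. ennreal (W y powr p - M)) x \<le> ennreal ((4 * pi * t) powr (- real DIM('a) / 2)) * (\<integral>\<^sup>+y. ennreal (W y powr p - M) \<partial>lborel)"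
      by (rule nn_heat_le_integral[OF t]) measurable
    also have "\<dots> \<le> ennreal (t powr (- real DIM('a) / 2)) * ennreal e"
    proof (intro mult_mono M(2) ennreal_leI)
      have "1 * t \<le> 4 * pi * t" using t pi_ge_two by (intro mult_right_mono) auto
      then show "(4 * pi * t) powr (- real DIM('a) / 2) \<le> t powr (- real DIM('a) / 2)"
        using t by (intro powr_mono2') auto
    qed auto
    also have "\<dots> = ennreal (t powr (- real DIM('a) / 2) * e)" using e by (simp add: ennreal_mult)
    finally have "nn_heat t (\<lambda>y. ennreal (W y powr p - M)) x + ennreal M \<le> ennreal (t powr (- real DIM('a) / 2) * e) + ennreal M"
      by (rule add_right_mono)
    with 1[OF t, of x] have "\<Phi> t x \<le> ennreal (t powr (- real DIM('a) / 2) * e) + ennreal M" by (rule order_trans)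
    then show ?thesis using e M by (simp add: ennreal_plus[symmetric] del: ennreal_plus)
  qed
  ultimately show thesis using that M by blast
qed

lemma \<Phi>_eq: "t > 0 \<Longrightarrow> \<Phi> t x = ennreal (\<phi> t x)"
proof -
  assume t: "t > 0"
  obtain M where "\<Phi> t x \<le> ennreal (t powr (- real DIM('a) / 2) * 1 + M)" using \<Phi>_bound[of 1] t by (metis zero_less_one)
  then have "\<Phi> t x < top" by (rule le_less_trans) simp
  then show ?thesis by (simp add: \<phi>_def)
qed

lemma \<phi>_le:
  assumes e: "e > 0"
  obtains M where "M \<ge> 0" "\<And>t x. t > 0 \<Longrightarrow> \<phi> t x \<le> t powr (- real DIM('a) / 2) * e + M"
proof -
  obtain M where M: "M \<ge> 0" "\<And>t x. t > 0 \<Longrightarrow> \<Phi> t x \<le> ennreal (t powr (- real DIM('a) / 2) * e + M)" using \<Phi>_bound[OF e] by metis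
  have "\<phi> t x \<le> t powr (- real DIM('a) / 2) * e + M" if "t > 0" for t x
    using M(2)[OF that, of x] M(1) e that by (simp add: \<Phi>_eq ennreal_le_iff del: ennreal_plus)
  then show thesis using that M(1) by blast
qed

text \<open>With \<open>?n = DIM('a) / 2\<close> the critical relation reads
  \<open>(p - 1) / p = 1 / ?n\<close>, so the quantity is the power \<open>1 / ?n\<close> of
  \<open>t powr ?n * \<phi> t x\<close>. That product is at most \<open>e + M * t powr ?n\<close>
  with \<open>e\<close> as small as desired.\<close>

lemma \<phi>_small:
  assumes d: "\<delta> > 0"
  obtains T where "T > 0" "\<And>t x. 0 < t \<Longrightarrow> t \<le> T \<Longrightarrow> t * \<phi> t x powr ((p - 1) / p) \<le> \<delta>"
proof -
  let ?n = "real DIM('a) / 2"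
  have n: "?n > 0" by simp
  \<comment> \<open>Half of \<open>\<delta> powr ?n\<close> goes to the singular part; the other
    half is for \<open>M * t powr ?n\<close>, which determines \<open>T\<close>.\<close>
  define e where "e = \<delta> powr ?n / 2"
  have e: "e > 0" using d by (simp add: e_def)
  obtain M where M: "M \<ge> 0" "\<And>t x. t > 0 \<Longrightarrow> \<phi> t x \<le> t powr (- real DIM('a) / 2) * e + M" using \<phi>_le[OF e] by metis
  define T where "T = (e / (M + 1)) powr (1 / ?n)"
  have T: "T > 0" using e M by (simp add: T_def)
  have "t * \<phi> t x powr ((p - 1) / p) \<le> \<delta>" if t: "0 < t" "t \<le> T" for t x
  proof -
    have "t powr ?n \<le> T powr ?n" using t n by (intro powr_mono2) auto
    also have "\<dots> = e / (M + 1)" using e M n by (simp add: T_def powr_powr)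
    finally have "M * t powr ?n \<le> M * (e / (M + 1))" using M(1) by (rule mult_left_mono)
    also have "\<dots> \<le> e" using M(1) e by (simp add: field_simps)
    finally have 1: "M * t powr ?n \<le> e" .
    have "t powr ?n * \<phi> t x \<le> t powr ?n * (t powr (- ?n) * e + M)"
      using M(2)[OF t(1), of x] by (intro mult_left_mono) auto
    also have "\<dots> = e + M * t powr ?n"
      using t by (simp add: distrib_left mult.assoc[symmetric] powr_add[symmetric])
    also have "\<dots> \<le> \<delta> powr ?n" using 1 by (simp add: e_def)
    finally have "(t powr ?n * \<phi> t x) powr (1 / ?n) \<le> (\<delta> powr ?n) powr (1 / ?n)"
      using n by (intro powr_mono2) auto
    moreover have "(t powr ?n * \<phi> t x) powr (1 / ?n) = t * \<phi> t x powr (1 / ?n)"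
      using t n by (simp add: powr_mult powr_powr)
    moreover have "(\<delta> powr ?n) powr (1 / ?n) = \<delta>" using d n by (simp add: powr_powr)
    ultimately show ?thesis by (simp add: p_critical)
  qed
  then show thesis using that T by blast
qed

lemma \<Phi>_semigroup: "0 < s \<Longrightarrow> s < t \<Longrightarrow> nn_heat (t - s) (\<Phi> s) x = \<Phi> t x"
  unfolding \<Phi>_def[abs_def] by (subst nn_heat_nn_heat) auto

definition duhamel_nn :: "('a \<Rightarrow> real \<Rightarrow> real) \<Rightarrow> real \<Rightarrow> 'a \<Rightarrow> ennreal" where
  "duhamel_nn w t x = (\<integral>\<^sup>+s. indicator {0<..<t} s * nn_heat (t - s) (\<lambda>y. ennreal (w y s powr p)) x \<partial>lborel)"

lemma duhamel_nn_mono: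
  assumes "\<And>y s. 0 < s \<Longrightarrow> s < t \<Longrightarrow> 0 \<le> w y s" "\<And>y s. 0 < s \<Longrightarrow> s < t \<Longrightarrow> w y s \<le> w' y s"
  shows "duhamel_nn w t x \<le> duhamel_nn w' t x"
  unfolding duhamel_nn_def
proof (rule nn_integral_mono)
  fix s
  show "indicator {0<..<t} s * nn_heat (t - s) (\<lambda>y. ennreal (w y s powr p)) x \<le> indicator {0<..<t} s * nn_heat (t - s) (\<lambda>y. ennreal (w' y s powr p)) x"
    using assms p by (cases "s \<in> {0<..<t}") (auto intro!: nn_heat_mono ennreal_leI powr_mono2)
qed

text \<open>By the semigroup law \<open>nn_heat (t - s) (\<Phi> s)\<close> does not depend on
  \<open>s\<close>, so the time integral contributes just a factor \<open>t\<close>.\<close>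

lemma duhamel_nn_supersolution:
  assumes t: "t > 0" and w: "\<And>y s. 0 < s \<Longrightarrow> s < t \<Longrightarrow> 0 \<le> w y s" "\<And>y s. 0 < s \<Longrightarrow> s < t \<Longrightarrow> w y s \<le> 2 * \<phi> s y powr (1 / p)"
  shows "duhamel_nn w t x \<le> ennreal (2 powr p * t * \<phi> t x)"
proof -
  have "duhamel_nn w t x \<le> (\<integral>\<^sup>+s. ennreal (2 powr p) * \<Phi> t x * indicator {0<..<t} s \<partial>lborel)"
    unfolding duhamel_nn_def
  proof (rule nn_integral_mono)
    fix s
    show "indicator {0<..<t} s * nn_heat (t - s) (\<lambda>y. ennreal (w y s powr p)) x \<le> ennreal (2 powr p) * \<Phi> t x * indicator {0<..<t} s"
    proof (cases "s \<in> {0<..<t}")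
      case True
      have "nn_heat (t - s) (\<lambda>y. ennreal (w y s powr p)) x \<le> nn_heat (t - s) (\<lambda>y. ennreal (2 powr p) * \<Phi> s y) x"
      proof (rule nn_heat_mono)
        fix y
        have "w y s powr p \<le> (2 * \<phi> s y powr (1 / p)) powr p" using True w p by (intro powr_mono2) auto
        also have "\<dots> = 2 powr p * \<phi> s y" using p by (simp add: powr_mult powr_powr)
        finally show "ennreal (w y s powr p) \<le> ennreal (2 powr p) * \<Phi> s y"
          using True by (simp add: \<Phi>_eq ennreal_mult[symmetric] ennreal_leI)
      qed
      also have "\<dots> = ennreal (2 powr p) * nn_heat (t - s) (\<Phi> s) x"
        by (rule nn_heat_cmult) (simp add: \<Phi>_def[abs_def])
      also have "nn_heat (t - s) (\<Phi> s) x = \<Phi> t x" using True by (intro \<Phi>_semigroup) auto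
      finally show ?thesis using True by simp
    qed simp
  qed
  also have "\<dots> = ennreal (2 powr p) * \<Phi> t x * ennreal t"
    using t by (simp add: nn_integral_cmult_indicator)
  also have "\<dots> = ennreal (2 powr p * t * \<phi> t x)"
    using t by (simp add: \<Phi>_eq ennreal_mult[symmetric] mult_ac)
  finally show ?thesis .
qed

lemma nn_heat_W_le: "t > 0 \<Longrightarrow> nn_heat t (\<lambda>y. ennreal (W y)) x \<le> ennreal (\<phi> t x powr (1 / p))"
  by (rule nn_heat_jensen[OF _ p W_measurable W_nonneg]) (auto simp: \<Phi>_eq[symmetric] \<Phi>_def)

lemma borel_measurable_duhamel_nn:
  assumes [measurable]: "(\<lambda>(y, s). w y s) \<in> borel_measurable (borel \<Otimes>\<^sub>M borel)"
  shows "(\<lambda>(x, t). duhamel_nn w t x) \<in> borel_measurable (borel \<Otimes>\<^sub>M borel)"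
proof -
  have "(\<lambda>z. nn_heat (snd (fst z) - snd z) (\<lambda>y. ennreal (w y (snd z) powr p)) (fst (fst z))) \<in> borel_measurable ((borel \<Otimes>\<^sub>M borel) \<Otimes>\<^sub>M lborel)"
    by (rule borel_measurable_nn_heat[where F = "\<lambda>y z. ennreal (w y (snd z) powr p)"]) measurable
  then have [measurable]: "(\<lambda>(q, s). nn_heat (snd q - s) (\<lambda>y. ennreal (w y s powr p)) (fst q)) \<in> borel_measurable ((borel \<Otimes>\<^sub>M borel) \<Otimes>\<^sub>M lborel)"
    by (simp add: case_prod_unfold)
  have [measurable]: "(\<lambda>(q, s :: real). indicator {0<..<snd q} s :: ennreal) \<in> borel_measurable (((borel :: 'a measure) \<Otimes>\<^sub>M borel) \<Otimes>\<^sub>M lborel)"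
  proof -
    have "(\<lambda>(q, s). indicator {0<..<snd q} s :: ennreal) = (\<lambda>z :: ('a \<times> real) \<times> real. if 0 < snd z \<and> snd z < snd (fst z) then 1 else 0)"
      by (auto simp: fun_eq_iff indicator_def)
    then show ?thesis by simp
  qed
  have "(\<lambda>q. \<integral>\<^sup>+s. indicator {0<..<snd q} s * nn_heat (snd q - s) (\<lambda>y. ennreal (w y s powr p)) (fst q) \<partial>lborel) \<in> borel_measurable (borel \<Otimes>\<^sub>M borel)"
    by (rule sigma_finite_measure.borel_measurable_nn_integral[OF sigma_finite_lborel]) measurable
  then show ?thesis by (simp add: duhamel_nn_def case_prod_unfold)
qed

end

section \<open>The monotone Picard iteration\<close>

text \<open>The threshold \<open>2 powr (- p)\<close> cancels the factor \<open>2 powr p\<close>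
  that the supersolution \<open>2 * \<phi> t x powr (1 / p)\<close> produces in the Duhamel term,
  which therefore takes at most half of the supersolution.\<close>

locale critical_datum_time = critical_datum W p for W :: "'a::euclidean_space \<Rightarrow> real" and p +
  fixes T :: real
  assumes T: "T > 0" and \<phi>_T: "\<And>t x. 0 < t \<Longrightarrow> t \<le> T \<Longrightarrow> t * \<phi> t x powr ((p - 1) / p) \<le> 2 powr (- p)"
begin

lemma two_powr_\<phi>_le:
  assumes "0 < t" "t \<le> T"
  shows "2 powr p * t * \<phi> t x \<le> \<phi> t x powr (1 / p)"
proof -
  have "\<phi> t x = \<phi> t x powr ((p - 1) / p) * \<phi> t x powr (1 / p)"
  proof -
    have "(p - 1) / p + 1 / p = 1" using p by (simp add: field_simps)
    then show ?thesis by (simp add: powr_add[symmetric])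
  qed
  then have "2 powr p * t * \<phi> t x = 2 powr p * (t * \<phi> t x powr ((p - 1) / p)) * \<phi> t x powr (1 / p)" by (simp add: mult.assoc)
  also have "\<dots> \<le> 2 powr p * 2 powr (- p) * \<phi> t x powr (1 / p)"
    by (intro mult_right_mono mult_left_mono \<phi>_T assms) auto
  also have "\<dots> = \<phi> t x powr (1 / p)" by (simp add: powr_add[symmetric])
  finally show ?thesis .
qed

text \<open>Beyond \<open>T\<close> finiteness of the integrals is not known, and
  \<open>enn2real\<close> would send an infinite value to \<open>0\<close> and could destroy
  monotonicity; hence the cutoff to \<open>{0<..T}\<close>.\<close>

primrec iter :: "nat \<Rightarrow> 'a \<Rightarrow> real \<Rightarrow> real" where
  "iter 0 = (\<lambda>x t. 0)"
| "iter (Suc k) = (\<lambda>x t. indicator {0<..T} t * enn2real (nn_heat t (\<lambda>y. ennreal (W y)) x + duhamel_nn (iter k) t x))"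

lemma iter_nonneg: "0 \<le> iter k x t"
  by (cases k) auto

lemma picard_le:
  assumes "0 < t" "t \<le> T" "\<And>y s. 0 < s \<Longrightarrow> s < t \<Longrightarrow> 0 \<le> w y s" "\<And>y s. 0 < s \<Longrightarrow> s < t \<Longrightarrow> w y s \<le> 2 * \<phi> s y powr (1 / p)"
  shows "nn_heat t (\<lambda>y. ennreal (W y)) x + duhamel_nn w t x \<le> ennreal (2 * \<phi> t x powr (1 / p))"
proof -
  have "duhamel_nn w t x \<le> ennreal (\<phi> t x powr (1 / p))"
    by (rule order_trans[OF duhamel_nn_supersolution ennreal_leI[OF two_powr_\<phi>_le]]) (use assms in auto)
  then have "nn_heat t (\<lambda>y. ennreal (W y)) x + duhamel_nn w t x \<le> ennreal (\<phi> t x powr (1 / p)) + ennreal (\<phi> t x powr (1 / p))"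
    using assms by (intro add_mono nn_heat_W_le) auto
  then show ?thesis by (simp add: ennreal_plus[symmetric] del: ennreal_plus)
qed

lemma iter_le: "0 < t \<Longrightarrow> t \<le> T \<Longrightarrow> iter k x t \<le> 2 * \<phi> t x powr (1 / p)"
proof (induction k arbitrary: x t)
  case (Suc k)
  have "nn_heat t (\<lambda>y. ennreal (W y)) x + duhamel_nn (iter k) t x \<le> ennreal (2 * \<phi> t x powr (1 / p))"
    using Suc by (intro picard_le iter_nonneg) auto
  then have "enn2real (nn_heat t (\<lambda>y. ennreal (W y)) x + duhamel_nn (iter k) t x) \<le> 2 * \<phi> t x powr (1 / p)"
    by (intro enn2real_leI) auto
  then show ?case using Suc.prems by simp
qed simp

lemma ennreal_iter_Suc:
  assumes "0 < t" "t \<le> T"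
  shows "ennreal (iter (Suc k) x t) = nn_heat t (\<lambda>y. ennreal (W y)) x + duhamel_nn (iter k) t x"
proof -
  have "nn_heat t (\<lambda>y. ennreal (W y)) x + duhamel_nn (iter k) t x \<le> ennreal (2 * \<phi> t x powr (1 / p))"
    using assms by (intro picard_le iter_nonneg iter_le) auto
  then have "nn_heat t (\<lambda>y. ennreal (W y)) x + duhamel_nn (iter k) t x < top" by (rule le_less_trans) simp
  then show ?thesis using assms by simp
qed

lemma iter_mono: "iter k x t \<le> iter (Suc k) x t"
proof (induction k arbitrary: x t)
  case (Suc k)
  show ?case
  proof (cases "t \<in> {0<..T}")
    case True
    then have t: "0 < t" "t \<le> T" by auto
    have "duhamel_nn (iter k) t x \<le> duhamel_nn (iter (Suc k)) t x"
      by (rule duhamel_nn_mono) (rule iter_nonneg, rule Suc.IH)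
    then have "ennreal (iter (Suc k) x t) \<le> ennreal (iter (Suc (Suc k)) x t)"
      unfolding ennreal_iter_Suc[OF t] by (rule add_left_mono)
    then show ?thesis by (simp only: ennreal_le_iff[OF iter_nonneg])
  qed simp
qed (simp add: iter_nonneg)

lemma iter_measurable: "(\<lambda>(x, t). iter k x t) \<in> borel_measurable (borel \<Otimes>\<^sub>M borel)"
proof (induction k)
  case (Suc k)
  have [measurable]: "(\<lambda>(x, t). nn_heat t (\<lambda>y. ennreal (W y)) x) \<in> borel_measurable (borel \<Otimes>\<^sub>M borel)"
    using borel_measurable_nn_heat[where F = "\<lambda>y z. ennreal (W y)" and M = "borel \<Otimes>\<^sub>M borel" and f = snd and g = fst]
    by (simp add: case_prod_unfold)
  note [measurable] = borel_measurable_duhamel_nn[OF Suc.IH]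
  show ?case by simp
qed simp

definition sol :: "'a \<Rightarrow> real \<Rightarrow> real" where
  "sol x t = (if t \<in> {0<..T} then lim (\<lambda>k. iter k x t) else 0)"

lemma iter_tendsto_sol: "(\<lambda>k. iter k x t) \<longlonglongrightarrow> sol x t"
proof (cases "t \<in> {0<..T}")
  case True
  have "incseq (\<lambda>k. iter k x t)" using iter_mono by (rule incseq_SucI)
  moreover have "\<forall>k. iter k x t \<le> 2 * \<phi> t x powr (1 / p)" using iter_le True by auto
  ultimately have "convergent (\<lambda>k. iter k x t)" using incseq_convergent by (metis convergent_def)
  then show ?thesis using True by (simp add: sol_def convergent_LIMSEQ_iff)
next
  case False
  then have "iter k x t = 0" for k by (cases k) auto
  then show ?thesis using False by (simp add: sol_def)
qed

lemma sol_measurable: "(\<lambda>(x, t). sol x t) \<in> borel_measurable (borel \<Otimes>\<^sub>M borel)"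
  by (rule borel_measurable_LIMSEQ_real[where u = "\<lambda>k (x, t). iter k x t"])
    (use iter_tendsto_sol iter_measurable in auto)

lemma sol_nonneg: "0 \<le> sol x t"
  by (rule LIMSEQ_le_const[OF iter_tendsto_sol]) (use iter_nonneg in auto)

lemma sol_le: "0 < t \<Longrightarrow> t \<le> T \<Longrightarrow> sol x t \<le> 2 * \<phi> t x powr (1 / p)"
  by (rule LIMSEQ_le_const2[OF iter_tendsto_sol]) (use iter_le in auto)

text \<open>Monotone convergence applied twice, in the space integral and then in the time
  integral.\<close>

lemma sol_eq:
  assumes t: "0 < t" "t \<le> T"
  shows "ennreal (sol x t) = nn_heat t (\<lambda>y. ennreal (W y)) x + duhamel_nn sol t x"
proof -
  have inner: "(\<lambda>k. nn_heat r (\<lambda>y. ennreal (iter k y s powr p)) x) \<longlonglongrightarrow> nn_heat r (\<lambda>y. ennreal (sol y s powr p)) x" for r s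
    unfolding nn_heat_def
  proof (rule nn_integral_LIMSEQ)
    have [measurable]: "(\<lambda>y. iter k y s) \<in> borel_measurable borel" for k
    proof -
      note [measurable] = iter_measurable
      have "(\<lambda>y. (\<lambda>(x, t). iter k x t) (y, s)) \<in> borel_measurable borel" by measurable
      then show ?thesis by simp
    qed
    show "(\<lambda>y. ennreal (heat_kernel r (x - y)) * ennreal (iter k y s powr p)) \<in> borel_measurable lborel" for k
      by measurable
    show "incseq (\<lambda>k y. ennreal (heat_kernel r (x - y)) * ennreal (iter k y s powr p))"
      using iter_mono[of _ _ s] iter_nonneg[of _ _ s] p
      by (intro incseq_SucI le_funI mult_left_mono ennreal_leI powr_mono2) auto
    show "(\<lambda>k. ennreal (heat_kernel r (x - y)) * ennreal (iter k y s powr p)) \<longlonglongrightarrow> ennreal (heat_kernel r (x - y)) * ennreal (sol y s powr p)" for y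
    proof -
      have "(\<lambda>k. iter k y s powr p) \<longlonglongrightarrow> sol y s powr p"
        using iter_tendsto_sol[of y s] p iter_nonneg by (intro tendsto_powr') auto
      then show ?thesis by (intro ennreal_tendsto_cmult tendsto_ennrealI) auto
    qed
  qed
  have "(\<lambda>k. duhamel_nn (iter k) t x) \<longlonglongrightarrow> duhamel_nn sol t x"
    unfolding duhamel_nn_def
  proof (rule nn_integral_LIMSEQ)
    show "incseq (\<lambda>k s. indicator {0<..<t} s * nn_heat (t - s) (\<lambda>y. ennreal (iter k y s powr p)) x)"
      using iter_mono iter_nonneg p
      by (intro incseq_SucI le_funI mult_left_mono nn_heat_mono ennreal_leI powr_mono2) auto
    show "(\<lambda>s. indicator {0<..<t} s * nn_heat (t - s) (\<lambda>y. ennreal (iter k y s powr p)) x) \<in> borel_measurable lborel" for k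
    proof -
      note [measurable] = iter_measurable
      have [measurable]: "(\<lambda>s. nn_heat (t - s) (\<lambda>y. ennreal (iter k y s powr p)) x) \<in> borel_measurable lborel"
        by (rule borel_measurable_nn_heat[where F = "\<lambda>y s. ennreal (iter k y s powr p)"]) measurable
      show ?thesis by measurable
    qed
    show "(\<lambda>k. indicator {0<..<t} s * nn_heat (t - s) (\<lambda>y. ennreal (iter k y s powr p)) x) \<longlonglongrightarrow>
       indicator {0<..<t} s * nn_heat (t - s) (\<lambda>y. ennreal (sol y s powr p)) x" for s
      by (intro ennreal_tendsto_cmult inner) (simp add: indicator_def)
  qed
  then have "(\<lambda>k. nn_heat t (\<lambda>y. ennreal (W y)) x + duhamel_nn (iter k) t x) \<longlonglongrightarrow> nn_heat t (\<lambda>y. ennreal (W y)) x + duhamel_nn sol t x"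
    by (intro tendsto_add tendsto_const)
  moreover have "(\<lambda>k. ennreal (iter (Suc k) x t)) \<longlonglongrightarrow> ennreal (sol x t)"
    by (intro tendsto_ennrealI LIMSEQ_Suc iter_tendsto_sol)
  ultimately show ?thesis
    unfolding ennreal_iter_Suc[OF t] by (rule LIMSEQ_unique[rotated])
qed

end

text \<open>The sum is at most four times its largest term. The four terms will be the errors in
  \<open>sol_decomposition\<close>.\<close>

lemma powr_sum4_le:
  fixes a b c d p :: real
  assumes "0 \<le> a" "0 \<le> b" "0 \<le> c" "0 \<le> d" "p > 0"
  shows "(a + b + c + d) powr p \<le> 4 powr p * (a powr p + b powr p + c powr p + d powr p)"
proof -
  define m where "m = max (max a b) (max c d)"
  have "(a + b + c + d) powr p \<le> (4 * m) powr p"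
    using assms by (intro powr_mono2) (auto simp: m_def)
  also have "\<dots> = 4 powr p * m powr p" using assms by (simp add: powr_mult m_def)
  also have "m powr p \<le> a powr p + b powr p + c powr p + d powr p"
    by (auto simp: m_def max_def)
  finally show ?thesis by simp
qed

text \<open>Passes from the part of the power above a level to the power of the part above a level,
  which is what truncation of \<open>W\<close> leaves behind.\<close>

lemma tail_imp_excess:
  fixes W :: "'a::euclidean_space \<Rightarrow> real"
  assumes p: "p > 0" and [measurable]: "W \<in> borel_measurable borel"
    and tail: "\<And>e. e > 0 \<Longrightarrow> \<exists>M\<ge>0. (\<integral>\<^sup>+y. ennreal (W y powr p - M) \<partial>lborel) \<le> ennreal e"
    and E: "E > 0"
  obtains k where "k > 0" "(\<integral>\<^sup>+x. ennreal (max (W x - k) 0 powr p) \<partial>lborel) \<le> ennreal E"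
proof -
  obtain M where M: "M \<ge> 0" "(\<integral>\<^sup>+y. ennreal (W y powr p - M) \<partial>lborel) \<le> ennreal (E / 2)"
    using tail[of "E / 2"] E by auto
  \<comment> \<open>Where \<open>W x > k\<close> this choice gives
    \<open>W x powr p \<ge> 2 * M\<close>, hence
    \<open>W x powr p \<le> 2 * (W x powr p - M)\<close>.\<close>
  define k where "k = (2 * M + 1) powr (1 / p)"
  have k: "k > 0" and kp: "k powr p = 2 * M + 1" using M p by (auto simp: k_def powr_powr)
  let ?a = "\<lambda>x. max (W x - k) 0"
  have tail: "(\<integral>\<^sup>+x. ennreal (?a x powr p) \<partial>lborel) \<le> ennreal E"
  proof -
    have "(\<integral>\<^sup>+x. ennreal (?a x powr p) \<partial>lborel) \<le> (\<integral>\<^sup>+x. 2 * ennreal (W x powr p - M) \<partial>lborel)"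
    proof (rule nn_integral_mono)
      fix x
      show "ennreal (?a x powr p) \<le> 2 * ennreal (W x powr p - M)"
      proof (cases "W x \<le> k")
        case False
        have "?a x powr p \<le> W x powr p" using False k p by (intro powr_mono2) auto
        moreover have "k powr p \<le> W x powr p" using False k p by (intro powr_mono2) auto
        ultimately have "?a x powr p \<le> 2 * (W x powr p - M)" "0 \<le> W x powr p - M" using kp M by auto
        then show ?thesis by (simp add: ennreal_mult[symmetric] ennreal_leI flip: ennreal_numeral)
      qed (use p in simp)
    qed
    also have "\<dots> = 2 * (\<integral>\<^sup>+x. ennreal (W x powr p - M) \<partial>lborel)" by (rule nn_integral_cmult) measurable
    also have "\<dots> \<le> 2 * ennreal (E / 2)" by (intro mult_left_mono M(2)) simp
    also have "\<dots> = ennreal E" using E by (simp add: ennreal_mult[symmetric] flip: ennreal_numeral)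
    finally show ?thesis .
  qed
  then show thesis using that k by blast
qed

section \<open>Positivity, bounds and the restarted mild equation for the limit\<close>

context critical_datum_time
begin

lemma sol_slice [measurable]: "(\<lambda>y. sol y s) \<in> borel_measurable borel"
proof -
  note [measurable] = sol_measurable
  have "(\<lambda>y. (\<lambda>(x, t). sol x t) (y, s)) \<in> borel_measurable borel" by measurable
  then show ?thesis by simp
qed

lemma sol_pos:
  assumes "0 < t" "t \<le> T"
  shows "0 < sol x t"
proof -
  have "0 < nn_heat t (\<lambda>y. ennreal (W y)) x"
    using assms W_pos by (intro nn_heat_pos) auto
  also have "\<dots> \<le> ennreal (sol x t)" unfolding sol_eq[OF assms] by simp
  finally show ?thesis by simp
qed

lemma sol_bounded:
  assumes "\<tau> > 0"
  shows "\<exists>M. \<forall>t\<in>{\<tau>..T}. \<forall>x. sol x t \<le> M"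
proof -
  obtain M where M: "M \<ge> 0" "\<And>t x. t > 0 \<Longrightarrow> \<phi> t x \<le> t powr (- real DIM('a) / 2) * 1 + M"
    using \<phi>_le[of 1] by (metis zero_less_one)
  have "sol x t \<le> 2 * (\<tau> powr (- real DIM('a) / 2) * 1 + M) powr (1 / p)" if t: "t \<in> {\<tau>..T}" for t x
  proof -
    have "\<phi> t x \<le> t powr (- real DIM('a) / 2) * 1 + M" using M(2)[of t x] t assms by simp
    also have "\<dots> \<le> \<tau> powr (- real DIM('a) / 2) * 1 + M"
      using t assms by (intro add_right_mono mult_right_mono powr_mono2') auto
    finally have "\<phi> t x powr (1 / p) \<le> (\<tau> powr (- real DIM('a) / 2) * 1 + M) powr (1 / p)"
      using p by (intro powr_mono2) auto
    then show ?thesis using sol_le[of t x] t assms by simp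
  qed
  then show ?thesis by blast
qed

text \<open>By Tonelli and the semigroup law, the Duhamel term accumulated up to
  \<open>\<tau>\<close> and then evolved freely is the early part of the Duhamel term at
  \<open>t\<close>.\<close>

lemma nn_heat_duhamel_nn:
  assumes "0 < \<tau>" "\<tau> < t"
  shows "nn_heat (t - \<tau>) (duhamel_nn sol \<tau>) x =
    (\<integral>\<^sup>+s. indicator {0<..<\<tau>} s * nn_heat (t - s) (\<lambda>y. ennreal (sol y s powr p)) x \<partial>lborel)"
proof -
  note [measurable] = sol_measurable
  let ?g = "\<lambda>s y. ennreal (sol y s powr p)"
  have "(\<lambda>z. nn_heat (\<tau> - snd z) (?g (snd z)) (fst z)) \<in> borel_measurable (borel \<Otimes>\<^sub>M borel)"
    by (rule borel_measurable_nn_heat[where F = "\<lambda>y z. ennreal (sol y (snd z) powr p)"]) measurable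
  then have [measurable]: "(\<lambda>(y, s). nn_heat (\<tau> - s) (?g s) y) \<in> borel_measurable (borel \<Otimes>\<^sub>M borel)"
    by (simp add: case_prod_unfold)
  have [measurable]: "(\<lambda>y. nn_heat (\<tau> - s) (?g s) y) \<in> borel_measurable borel" for s
    by (rule borel_measurable_nn_heat') measurable
  have [measurable]: "(\<lambda>s. nn_heat (\<tau> - s) (?g s) y) \<in> borel_measurable lborel" for y
    by (rule borel_measurable_nn_heat[where F = "\<lambda>y s. ennreal (sol y s powr p)"]) measurable
  have "nn_heat (t - \<tau>) (duhamel_nn sol \<tau>) x =
      (\<integral>\<^sup>+y. \<integral>\<^sup>+s. ennreal (heat_kernel (t - \<tau>) (x - y)) * (indicator {0<..<\<tau>} s * nn_heat (\<tau> - s) (?g s) y) \<partial>lborel \<partial>lborel)"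
    unfolding nn_heat_def[of "t - \<tau>"] duhamel_nn_def
    by (intro nn_integral_cong nn_integral_cmult[symmetric]) measurable
  also have "\<dots> = (\<integral>\<^sup>+s. \<integral>\<^sup>+y. ennreal (heat_kernel (t - \<tau>) (x - y)) * (indicator {0<..<\<tau>} s * nn_heat (\<tau> - s) (?g s) y) \<partial>lborel \<partial>lborel)"
    by (rule lborel_pair.Fubini') measurable
  also have "\<dots> = (\<integral>\<^sup>+s. indicator {0<..<\<tau>} s * nn_heat (t - s) (?g s) x \<partial>lborel)"
  proof (rule nn_integral_cong)
    fix s
    show "(\<integral>\<^sup>+y. ennreal (heat_kernel (t - \<tau>) (x - y)) * (indicator {0<..<\<tau>} s * nn_heat (\<tau> - s) (?g s) y) \<partial>lborel)
        = indicator {0<..<\<tau>} s * nn_heat (t - s) (?g s) x"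
    proof (cases "s \<in> {0<..<\<tau>}")
      case True
      have "nn_heat (t - \<tau>) (nn_heat (\<tau> - s) (?g s)) x = nn_heat ((t - \<tau>) + (\<tau> - s)) (?g s) x"
        by (rule nn_heat_nn_heat) (use True assms in auto)
      then show ?thesis using True by (simp add: nn_heat_def[of "t - \<tau>"])
    qed simp
  qed
  finally show ?thesis .
qed

text \<open>The Duhamel integral from \<open>0\<close> splits at \<open>\<tau>\<close>, and its
  early part is absorbed into the heat flow of the slice at \<open>\<tau>\<close>.\<close>

lemma sol_restart:
  assumes \<tau>: "0 < \<tau>" "\<tau> < t" "t \<le> T"
  shows "ennreal (sol x t) = nn_heat (t - \<tau>) (\<lambda>y. ennreal (sol y \<tau>)) x +
    (\<integral>\<^sup>+s. indicator {\<tau><..<t} s * nn_heat (t - s) (\<lambda>y. ennreal (sol y s powr p)) x \<partial>lborel)"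
proof -
  note [measurable] = sol_measurable
  let ?h = "\<lambda>s. nn_heat (t - s) (\<lambda>y. ennreal (sol y s powr p)) x"
  have [measurable]: "?h \<in> borel_measurable lborel"
    by (rule borel_measurable_nn_heat[where F = "\<lambda>y s. ennreal (sol y s powr p)"]) measurable
  have [measurable]: "duhamel_nn sol \<tau> \<in> borel_measurable borel"
  proof -
    note [measurable] = borel_measurable_duhamel_nn[OF sol_measurable]
    have "(\<lambda>y. (\<lambda>(x, t). duhamel_nn sol t x) (y, \<tau>)) \<in> borel_measurable borel" by measurable
    then show ?thesis by simp
  qed
  have "nn_heat (t - \<tau>) (\<lambda>y. ennreal (sol y \<tau>)) x = nn_heat (t - \<tau>) (\<lambda>y. nn_heat \<tau> (\<lambda>y. ennreal (W y)) y + duhamel_nn sol \<tau> y) x"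
    using sol_eq[of \<tau>] \<tau> by simp
  also have "\<dots> = nn_heat (t - \<tau>) (nn_heat \<tau> (\<lambda>y. ennreal (W y))) x + nn_heat (t - \<tau>) (duhamel_nn sol \<tau>) x"
    by (rule nn_heat_add) measurable
  also have "nn_heat (t - \<tau>) (nn_heat \<tau> (\<lambda>y. ennreal (W y))) x = nn_heat t (\<lambda>y. ennreal (W y)) x"
    using \<tau> by (subst nn_heat_nn_heat) auto
  finally have 1: "nn_heat (t - \<tau>) (\<lambda>y. ennreal (sol y \<tau>)) x =
      nn_heat t (\<lambda>y. ennreal (W y)) x + (\<integral>\<^sup>+s. indicator {0<..<\<tau>} s * ?h s \<partial>lborel)"
    using nn_heat_duhamel_nn[OF \<tau>(1,2)] by simp
  have "(\<integral>\<^sup>+s. indicator {0<..<\<tau>} s * ?h s \<partial>lborel) + (\<integral>\<^sup>+s. indicator {\<tau><..<t} s * ?h s \<partial>lborel)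
      = (\<integral>\<^sup>+s. indicator {0<..<\<tau>} s * ?h s + indicator {\<tau><..<t} s * ?h s \<partial>lborel)"
    by (rule nn_integral_add[symmetric]) measurable
  also have "\<dots> = (\<integral>\<^sup>+s. indicator {0<..<t} s * ?h s \<partial>lborel)"
  proof (rule nn_integral_cong_AE)
    show "AE s in lborel. indicator {0<..<\<tau>} s * ?h s + indicator {\<tau><..<t} s * ?h s = indicator {0<..<t} s * ?h s"
      using AE_lborel_singleton[of \<tau>] by eventually_elim (use \<tau> in \<open>auto simp: indicator_def\<close>)
  qed
  finally show ?thesis using 1 sol_eq[of t x] \<tau> by (simp add: duhamel_nn_def add.assoc)
qed

text \<open>From \<open>\<tau>\<close> on all quantities are bounded, so the extended identity of
  \<open>sol_restart\<close> passes to real integrals.\<close>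

lemma sol_mild:
  assumes \<tau>: "0 < \<tau>" "\<tau> < t" "t < T"
  shows "sol x t = kernel_conv heat_kernel (\<lambda>y. sol y \<tau>) (t - \<tau>) x
         + duhamel heat_kernel (\<lambda>y s. indicator {\<tau><..<T} s * sol y s powr p) \<tau> t x"
proof -
  note [measurable] = sol_measurable
  obtain M where M: "\<And>t x. t \<in> {\<tau>..T} \<Longrightarrow> sol x t \<le> M" using sol_bounded[OF \<tau>(1)] by blast
  let ?g = "\<lambda>y s. indicator {\<tau><..<T} s * sol y s powr p"
  have g: "0 \<le> ?g y s" "?g y s \<le> M powr p" for y s
    using M[of s y] sol_nonneg[of y s] p by (auto simp: indicator_def intro!: powr_mono2)
  interpret duhamel_source ?g "M powr p"
    by standard (measurable, use g in \<open>simp add: abs_of_nonneg\<close>)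
  have 1: "nn_heat (t - \<tau>) (\<lambda>y. ennreal (sol y \<tau>)) x = ennreal (kernel_conv heat_kernel (\<lambda>y. sol y \<tau>) (t - \<tau>) x)"
    by (rule nn_heat_eq_kernel_conv[where M = M]) (use \<tau> M sol_nonneg in auto)
  have "(\<integral>\<^sup>+s. indicator {\<tau><..<t} s * nn_heat (t - s) (\<lambda>y. ennreal (sol y s powr p)) x \<partial>lborel)
     = (\<integral>\<^sup>+s. ennreal (indicator {\<tau><..<t} s * kernel_conv heat_kernel (\<lambda>y. ?g y s) (t - s) x) \<partial>lborel)"
  proof (rule nn_integral_cong)
    fix s
    show "indicator {\<tau><..<t} s * nn_heat (t - s) (\<lambda>y. ennreal (sol y s powr p)) x = ennreal (indicator {\<tau><..<t} s * kernel_conv heat_kernel (\<lambda>y. ?g y s) (t - s) x)"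
    proof (cases "s \<in> {\<tau><..<t}")
      case True
      then have "nn_heat (t - s) (\<lambda>y. ennreal (?g y s)) x = ennreal (kernel_conv heat_kernel (\<lambda>y. ?g y s) (t - s) x)"
        by (intro nn_heat_eq_kernel_conv[where M = "M powr p"] g g_slice) auto
      then show ?thesis using True \<tau> by simp
    qed simp
  qed
  also have "\<dots> = ennreal (duhamel heat_kernel ?g \<tau> t x)"
    unfolding duhamel_def
    by (rule nn_integral_eq_integral[OF integrable_integrand[OF weakly_singular_heat, of _ \<tau>]])
      (use \<tau> g in \<open>auto intro!: AE_I2 mult_nonneg_nonneg kernel_conv_heat_nonneg\<close>)
  finally have "ennreal (sol x t) = ennreal (kernel_conv heat_kernel (\<lambda>y. sol y \<tau>) (t - \<tau>) x) + ennreal (duhamel heat_kernel ?g \<tau> t x)"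
    using sol_restart[of \<tau> t x] \<tau> 1 by simp
  moreover have "0 \<le> kernel_conv heat_kernel (\<lambda>y. sol y \<tau>) (t - \<tau>) x"
    by (rule kernel_conv_heat_nonneg) (rule sol_nonneg)
  moreover have "0 \<le> duhamel heat_kernel ?g \<tau> t x"
    unfolding duhamel_def using g by (intro Bochner_Integration.integral_nonneg mult_nonneg_nonneg kernel_conv_heat_nonneg) auto
  ultimately have "ennreal (sol x t) = ennreal (kernel_conv heat_kernel (\<lambda>y. sol y \<tau>) (t - \<tau>) x + duhamel heat_kernel ?g \<tau> t x)"
    and "0 \<le> kernel_conv heat_kernel (\<lambda>y. sol y \<tau>) (t - \<tau>) x + duhamel heat_kernel ?g \<tau> t x"
    by (simp_all only: ennreal_plus add_nonneg_nonneg)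
  then show ?thesis using ennreal_inj[OF sol_nonneg] by blast
qed

sublocale mild_solution sol p T
proof
  show "\<exists>M. \<forall>t\<in>{\<tau>..<T}. \<forall>x. sol x t \<le> M" if "0 < \<tau>" for \<tau>
    using sol_bounded[OF that] by (meson atLeastAtMost_iff atLeastLessThan_iff less_imp_le)
qed (use p sol_measurable sol_pos sol_mild in auto)

text \<open>Four sources of error when \<open>W\<close> is cut at height \<open>k\<close>: the flow
  of the excess, the excess itself, the motion of the truncated datum under the flow, and the
  Duhamel term. The function \<open>B\<close> stands for the truncation up to a null set, as the
  latter may be discontinuous at the origin.\<close>

lemma sol_decomposition:
  assumes t: "0 < t" "t \<le> T" and k: "k > 0"
    and B: "B \<in> borel_measurable borel" "\<And>x. 0 \<le> B x" "\<And>x. B x \<le> k" "AE x in lborel. B x = min (W x) k"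
  shows "\<bar>sol x t - W x\<bar> \<le> enn2real (nn_heat t (\<lambda>y. ennreal (max (W y - k) 0)) x) + max (W x - k) 0
    + \<bar>kernel_conv heat_kernel B t x - min (W x) k\<bar> + 2 powr p * t * \<phi> t x"
proof -
  note [measurable] = B(1)
  have fin: "nn_heat t (\<lambda>y. ennreal (W y)) x < top"
    using nn_heat_W_le[OF t(1)] by (rule le_less_trans) simp
  have "nn_heat t (\<lambda>y. ennreal (W y)) x = nn_heat t (\<lambda>y. ennreal (max (W y - k) 0) + ennreal (min (W y) k)) x"
  proof -
    have "ennreal (W y) = ennreal (max (W y - k) 0) + ennreal (min (W y) k)" for y
      using W_nonneg[of y] k by (auto simp: ennreal_plus[symmetric] max_def min_def simp del: ennreal_plus)
    then show ?thesis by simp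
  qed
  also have "\<dots> = nn_heat t (\<lambda>y. ennreal (max (W y - k) 0)) x + nn_heat t (\<lambda>y. ennreal (min (W y) k)) x"
    by (rule nn_heat_add) measurable
  also have "nn_heat t (\<lambda>y. ennreal (min (W y) k)) x = nn_heat t (\<lambda>y. ennreal (B y)) x"
    unfolding nn_heat_def by (rule nn_integral_cong_AE) (use B(4) in eventually_elim, simp)
  also have "\<dots> = ennreal (kernel_conv heat_kernel B t x)"
    by (rule nn_heat_eq_kernel_conv[OF t(1) B(1-3)])
  finally have W_eq: "nn_heat t (\<lambda>y. ennreal (W y)) x = nn_heat t (\<lambda>y. ennreal (max (W y - k) 0)) x + ennreal (kernel_conv heat_kernel B t x)" .
  then have "nn_heat t (\<lambda>y. ennreal (max (W y - k) 0)) x < top" using fin by (simp add: top.not_eq_extremum[symmetric])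
  then have A: "nn_heat t (\<lambda>y. ennreal (max (W y - k) 0)) x = ennreal (enn2real (nn_heat t (\<lambda>y. ennreal (max (W y - k) 0)) x))" by simp
  have D: "duhamel_nn sol t x \<le> ennreal (2 powr p * t * \<phi> t x)"
    by (rule duhamel_nn_supersolution) (use t sol_nonneg sol_le in auto)
  then have "duhamel_nn sol t x < top" by (rule le_less_trans) simp
  then have R: "duhamel_nn sol t x = ennreal (enn2real (duhamel_nn sol t x))" by simp
  have Rle: "enn2real (duhamel_nn sol t x) \<le> 2 powr p * t * \<phi> t x"
    using D t by (intro enn2real_leI) auto
  define a where "a = enn2real (nn_heat t (\<lambda>y. ennreal (max (W y - k) 0)) x)"
  define r where "r = enn2real (duhamel_nn sol t x)"
  have ar: "a \<ge> 0" "r \<ge> 0" by (auto simp: a_def r_def)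
  have c: "kernel_conv heat_kernel B t x \<ge> 0" by (rule kernel_conv_heat_nonneg) (rule B(2))
  have "ennreal (sol x t) = ennreal a + ennreal (kernel_conv heat_kernel B t x) + ennreal r"
    using sol_eq[OF t, of x] W_eq A R by (simp add: a_def r_def)
  also have "\<dots> = ennreal (a + kernel_conv heat_kernel B t x + r)"
    using ar c by (simp add: ennreal_plus[symmetric] del: ennreal_plus)
  finally have "sol x t = a + kernel_conv heat_kernel B t x + r"
    by (subst (asm) ennreal_inj) (use ar c sol_nonneg in auto)
  moreover have "W x = max (W x - k) 0 + min (W x) k" by (auto simp: max_def min_def)
  ultimately show ?thesis
    using ar Rle unfolding a_def[symmetric] r_def[symmetric]
    by (auto simp: abs_if max_def min_def split: if_splits)
qed

text \<open>By Jensen's inequality. Together with conservation of mass it bounds the evolved excess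
  in the \<open>p\<close>-th mean by the excess at time \<open>0\<close>.\<close>

lemma heat_tail_powr_le:
  assumes t: "t > 0" and k: "k > 0"
  shows "ennreal (enn2real (nn_heat t (\<lambda>y. ennreal (max (W y - k) 0)) x) powr p) \<le> nn_heat t (\<lambda>y. ennreal (max (W y - k) 0 powr p)) x"
proof -
  let ?c = "nn_heat t (\<lambda>y. ennreal (max (W y - k) 0 powr p)) x"
  have "?c \<le> \<Phi> t x" unfolding \<Phi>_def
    using k p W_nonneg by (intro nn_heat_mono ennreal_leI powr_mono2) auto
  also have "\<dots> < top" using t by (simp add: \<Phi>_eq)
  finally have c: "?c = ennreal (enn2real ?c)" by simp
  have "nn_heat t (\<lambda>y. ennreal (max (W y - k) 0)) x \<le> ennreal (enn2real ?c powr (1 / p))"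
    by (rule nn_heat_jensen[OF t p]) (use c in auto)
  then have "enn2real (nn_heat t (\<lambda>y. ennreal (max (W y - k) 0)) x) \<le> enn2real ?c powr (1 / p)"
    by (intro enn2real_leI) auto
  then have "enn2real (nn_heat t (\<lambda>y. ennreal (max (W y - k) 0)) x) powr p \<le> (enn2real ?c powr (1 / p)) powr p"
    using p by (intro powr_mono2) auto
  also have "\<dots> = enn2real ?c" using p by (simp add: powr_powr)
  finally show ?thesis by (subst c) (rule ennreal_leI)
qed

end

section \<open>Continuity at the initial time\<close>

text \<open>At its singularity the datum carries an arbitrary value, so a truncation can be
  uniformly continuous only after modification on a null set.\<close>

locale critical_datum_continuous = critical_datum_time W p T for W :: "'a::euclidean_space \<Rightarrow> real" and p T +
  assumes W_truncation: "\<And>k. k > 0 \<Longrightarrow> \<exists>B. uniformly_continuous_on UNIV B \<and> (\<forall>x. 0 \<le> B x \<and> B x \<le> k) \<and>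
     (AE x in lborel. B x = min (W x) k)"
begin

lemma heat_truncation_uniform:
  assumes B: "uniformly_continuous_on UNIV (B :: 'a \<Rightarrow> real)" "\<And>x. 0 \<le> B x" "\<And>x. B x \<le> k" and e: "\<eta> > 0"
  obtains d where "d > 0" "\<And>t x. 0 < t \<Longrightarrow> t < d \<Longrightarrow> \<bar>kernel_conv heat_kernel B t x - B x\<bar> \<le> \<eta>"
proof -
  have Bm: "B \<in> borel_measurable borel"
    by (rule borel_measurable_continuous_onI[OF uniformly_continuous_imp_continuous[OF B(1)]])
  have Bk: "\<bar>B x\<bar> \<le> k" for x using B(2,3)[of x] by simp
  obtain \<rho> where \<rho>: "\<rho> > 0" "\<And>x x'. dist x' x < \<rho> \<Longrightarrow> dist (B x') (B x) < \<eta> / 2"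
    using B(1) e unfolding uniformly_continuous_on_def by (metis UNIV_I half_gt_zero)
  have k: "k \<ge> 0" using B(2,3)[of 0] by linarith
  \<comment> \<open>Points farther away than \<open>\<rho>\<close> are charged to the linear term,
    because \<open>B\<close> oscillates by at most \<open>k\<close>.\<close>
  have near: "\<bar>B (x - z) - B x\<bar> \<le> \<eta> / 2 + k / \<rho> * norm z" for x z
  proof (cases "norm z < \<rho>")
    case True
    then have "\<bar>B (x - z) - B x\<bar> < \<eta> / 2" using \<rho>(2)[of "x - z" x] by (simp add: dist_norm dist_real_def)
    moreover have "0 \<le> k / \<rho> * norm z" using k \<rho> by simp
    ultimately show ?thesis by linarith
  next
    case False
    have "\<bar>B (x - z) - B x\<bar> \<le> k" using B(2,3)[of x] B(2,3)[of "x - z"] by linarith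
    also have "k = k / \<rho> * \<rho>" using \<rho> by simp
    also have "\<dots> \<le> k / \<rho> * norm z" using False k \<rho> by (intro mult_left_mono) auto
    finally show ?thesis using e by linarith
  qed
  let ?c = "k / \<rho> * (2 * 2 powr (real DIM('a) / 2))"
  have c: "?c \<ge> 0" using k \<rho> by simp
  \<comment> \<open>Chosen so that \<open>?c * sqrt t \<le> \<eta> / 2\<close>; the added
    \<open>1\<close> covers the case \<open>?c = 0\<close>.\<close>
  define d where "d = (\<eta> / 2 / (?c + 1))\<^sup>2"
  have d: "d > 0" using e c by (simp add: d_def)
  have "\<bar>kernel_conv heat_kernel B t x - B x\<bar> \<le> \<eta>" if t: "0 < t" "t < d" for t x
  proof -
    have "\<bar>kernel_conv heat_kernel B t x - B x\<bar> \<le> \<eta> / 2 + k / \<rho> * (2 * 2 powr (real DIM('a) / 2) * sqrt t)"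
      by (rule kernel_conv_heat_near[OF t(1) Bm Bk near]) (use k \<rho> in simp)
    then have "\<bar>kernel_conv heat_kernel B t x - B x\<bar> \<le> \<eta> / 2 + ?c * sqrt t" by (simp only: mult.assoc)
    moreover have "sqrt t \<le> \<eta> / 2 / (?c + 1)"
      using t e c by (intro real_le_lsqrt) (auto simp: d_def)
    then have "?c * sqrt t \<le> ?c * (\<eta> / 2 / (?c + 1))" using c by (rule mult_left_mono)
    moreover have "?c * (\<eta> / 2 / (?c + 1)) \<le> \<eta> / 2"
    proof -
      have "C * (h / (C + 1)) \<le> h" if "C \<ge> 0" "h \<ge> 0" for C h :: real using that by (simp add: field_simps)
      then show ?thesis using c e by (simp only: divide_nonneg_pos less_imp_le zero_less_numeral)
    qed
    ultimately show ?thesis by linarith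
  qed
  then show thesis using that d by blast
qed

text \<open>Each of the four errors in \<open>sol_decomposition\<close> gets the share
  \<open>E\<close> on a unit ball: the two excess terms through the tail condition and conservation
  of mass, the truncation through its uniform convergence, and the Duhamel term through
  \<open>\<phi>_small\<close>.\<close>

lemma sol_initial:
  assumes e: "e > 0"
  obtains d where "d > 0" "\<And>t y. 0 < t \<Longrightarrow> t < d \<Longrightarrow> t \<le> T \<Longrightarrow>
    (\<integral>\<^sup>+x. ennreal (\<bar>sol x t - W x\<bar> powr p) * indicator (ball y 1) x \<partial>lborel) \<le> ennreal e"
proof -
  define E where "E = e / (4 * 4 powr p)"
  have E: "E > 0" using e by (simp add: E_def)
  define \<beta> where "\<beta> = measure lborel (ball (0::'a) 1)"
  have \<beta>: "emeasure lborel (ball (y::'a) 1) = ennreal \<beta>" for y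
    by (simp add: \<beta>_def emeasure_ball content_ball)
  have \<beta>0: "\<beta> \<ge> 0" by (simp add: \<beta>_def)
  obtain M where M: "M \<ge> 0" "(\<integral>\<^sup>+y. ennreal (W y powr p - M) \<partial>lborel) \<le> ennreal (E / 2)"
    "\<And>t x. t > 0 \<Longrightarrow> \<Phi> t x \<le> nn_heat t (\<lambda>y. ennreal (W y powr p - M)) x + ennreal M"
    using \<Phi>_bound[of "E / 2"] E by (metis half_gt_zero)
  obtain k where k: "k > 0" and tail: "(\<integral>\<^sup>+x. ennreal (max (W x - k) 0 powr p) \<partial>lborel) \<le> ennreal E"
    using tail_imp_excess[OF _ W_measurable W_tail E] p by auto
  obtain B where B: "uniformly_continuous_on UNIV B" "\<And>x. 0 \<le> B x" "\<And>x. B x \<le> k" "AE x in lborel. B x = min (W x) k"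
    using W_truncation[OF k] by blast
  have Bm [measurable]: "B \<in> borel_measurable borel"
    by (rule borel_measurable_continuous_onI[OF uniformly_continuous_imp_continuous[OF B(1)]])
  define \<eta> where "\<eta> = (E / (\<beta> + 1)) powr (1 / p)"
  have \<eta>: "\<eta> > 0" "\<eta> powr p = E / (\<beta> + 1)" using E \<beta>0 p by (auto simp: \<eta>_def powr_powr)
  obtain d1 where d1: "d1 > 0" "\<And>t x. 0 < t \<Longrightarrow> t < d1 \<Longrightarrow> \<bar>kernel_conv heat_kernel B t x - B x\<bar> \<le> \<eta>"
    using heat_truncation_uniform[OF B(1-3) \<eta>(1)] by metis
  \<comment> \<open>\<open>E / 2 + M * \<beta>\<close> bounds the integral of
    \<open>\<Phi> t\<close> over any unit ball, for all positive times. This \<open>D\<close> makes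
    \<open>2 powr (p * p) * D\<close> times that bound at most \<open>E\<close>.\<close>
  define D where "D = E / (2 powr (p * p) * (E / 2 + M * \<beta> + 1))"
  have den: "E / 2 + M * \<beta> + 1 > 0" using E M \<beta>0 by (simp add: add_pos_nonneg)
  have D: "D > 0" using E den by (simp add: D_def)
  define \<delta> where "\<delta> = D powr (1 / p)"
  have \<delta>: "\<delta> > 0" "\<delta> powr p = D" using D p by (auto simp: \<delta>_def powr_powr)
  obtain d2 where d2: "d2 > 0" "\<And>t x. 0 < t \<Longrightarrow> t \<le> d2 \<Longrightarrow> t * \<phi> t x powr ((p - 1) / p) \<le> \<delta>"
    using \<phi>_small[OF \<delta>(1)] by metis
  let ?a = "\<lambda>x. max (W x - k) 0"
  have goal: "(\<integral>\<^sup>+x. ennreal (\<bar>sol x t - W x\<bar> powr p) * indicator (ball y 1) x \<partial>lborel) \<le> ennreal e"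
    if t: "0 < t" "t < min d1 d2" "t \<le> T" for t y
  proof -
    let ?A = "\<lambda>x. nn_heat t (\<lambda>y. ennreal (?a y powr p)) x"
    let ?I = "\<lambda>x. indicator (ball y 1) x :: ennreal"
    have pt: "AE x in lborel. ennreal (\<bar>sol x t - W x\<bar> powr p) * ?I x \<le>
       ennreal (4 powr p) * (?A x + ennreal (?a x powr p) + ennreal (\<eta> powr p) * ?I x + ennreal (2 powr (p * p) * D) * (\<Phi> t x * ?I x))"
      using B(4)
    proof eventually_elim
      case (elim x)
      let ?\<alpha> = "enn2real (nn_heat t (\<lambda>y. ennreal (?a y)) x)"
      let ?\<rho> = "2 powr p * t * \<phi> t x"
      show ?case
      proof (cases "x \<in> ball y 1")
        case True
        have "\<bar>sol x t - W x\<bar> \<le> ?\<alpha> + ?a x + \<eta> + ?\<rho>"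
          using sol_decomposition[OF t(1,3) k Bm B(2-4), of x] d1(2)[of t x] t elim by simp
        then have "\<bar>sol x t - W x\<bar> powr p \<le> (?\<alpha> + ?a x + \<eta> + ?\<rho>) powr p" using p by (intro powr_mono2) auto
        also have "\<dots> \<le> 4 powr p * (?\<alpha> powr p + ?a x powr p + \<eta> powr p + ?\<rho> powr p)"
          using p \<eta> t by (intro powr_sum4_le) auto
        also have "?\<rho> powr p \<le> 2 powr (p * p) * D * \<phi> t x"
        proof -
          \<comment> \<open>One small factor is split off; the \<open>p\<close>-th power of the
            remaining \<open>\<phi> t x powr (1 / p)\<close> is integrable over unit balls,
            uniformly in \<open>t\<close>.\<close>
          have "?\<rho> = 2 powr p * (t * \<phi> t x powr ((p - 1) / p)) * \<phi> t x powr (1 / p)"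
          proof -
            have "(p - 1) / p + 1 / p = 1" using p by (simp add: field_simps)
            then have "\<phi> t x = \<phi> t x powr ((p - 1) / p) * \<phi> t x powr (1 / p)" by (simp add: powr_add[symmetric])
            then show ?thesis by (simp add: mult.assoc)
          qed
          also have "\<dots> \<le> 2 powr p * \<delta> * \<phi> t x powr (1 / p)"
            using d2(2)[of t x] t by (intro mult_right_mono mult_left_mono) auto
          finally have "?\<rho> powr p \<le> (2 powr p * \<delta> * \<phi> t x powr (1 / p)) powr p" using p t by (intro powr_mono2) auto
          also have "\<dots> = 2 powr (p * p) * D * \<phi> t x"
            using p \<delta> by (simp add: powr_mult powr_powr)
          finally show ?thesis .
        qed
        finally have "\<bar>sol x t - W x\<bar> powr p \<le> 4 powr p * (?\<alpha> powr p + ?a x powr p + \<eta> powr p + 2 powr (p * p) * D * \<phi> t x)"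
          by simp
        then have "ennreal (\<bar>sol x t - W x\<bar> powr p) \<le> ennreal (4 powr p) * (ennreal (?\<alpha> powr p) + ennreal (?a x powr p) + ennreal (\<eta> powr p) + ennreal (2 powr (p * p) * D * \<phi> t x))"
          using D by (simp add: ennreal_plus[symmetric] ennreal_mult[symmetric] ennreal_leI del: ennreal_plus)
        also have "ennreal (2 powr (p * p) * D * \<phi> t x) = ennreal (2 powr (p * p) * D) * \<Phi> t x"
          using D t by (simp add: \<Phi>_eq ennreal_mult)
        also have "ennreal (?\<alpha> powr p) \<le> ?A x" by (rule heat_tail_powr_le[OF t(1) k])
        finally show ?thesis using True by (simp add: mult_left_mono add_right_mono)
      qed simp
    qed
    have "(\<integral>\<^sup>+x. ennreal (\<bar>sol x t - W x\<bar> powr p) * ?I x \<partial>lborel) \<le>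
       (\<integral>\<^sup>+x. ennreal (4 powr p) * (?A x + ennreal (?a x powr p) + ennreal (\<eta> powr p) * ?I x + ennreal (2 powr (p * p) * D) * (\<Phi> t x * ?I x)) \<partial>lborel)"
      using pt by (rule nn_integral_mono_AE)
    also have "\<dots> = ennreal (4 powr p) * ((\<integral>\<^sup>+x. ?A x \<partial>lborel) + (\<integral>\<^sup>+x. ennreal (?a x powr p) \<partial>lborel) + ennreal (\<eta> powr p) * ennreal \<beta>
        + ennreal (2 powr (p * p) * D) * (\<integral>\<^sup>+x. \<Phi> t x * ?I x \<partial>lborel))"
    proof -
      have [measurable]: "?A \<in> borel_measurable borel" by (rule borel_measurable_nn_heat') measurable
      have [measurable]: "\<Phi> t \<in> borel_measurable borel" by (simp add: \<Phi>_def[abs_def])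
      have [measurable]: "?I \<in> borel_measurable borel" by (intro borel_measurable_indicator) simp
      have "(\<integral>\<^sup>+x. ennreal (\<eta> powr p) * ?I x \<partial>lborel) = ennreal (\<eta> powr p) * ennreal \<beta>"
        by (simp add: nn_integral_cmult_indicator \<beta>)
      moreover have "(\<integral>\<^sup>+x. ennreal (2 powr (p * p) * D) * (\<Phi> t x * ?I x) \<partial>lborel) = ennreal (2 powr (p * p) * D) * (\<integral>\<^sup>+x. \<Phi> t x * ?I x \<partial>lborel)"
        by (rule nn_integral_cmult) measurable
      moreover have "(\<integral>\<^sup>+x. ?A x + ennreal (?a x powr p) + ennreal (\<eta> powr p) * ?I x + ennreal (2 powr (p * p) * D) * (\<Phi> t x * ?I x) \<partial>lborel)
        = (\<integral>\<^sup>+x. ?A x + ennreal (?a x powr p) + ennreal (\<eta> powr p) * ?I x \<partial>lborel) + (\<integral>\<^sup>+x. ennreal (2 powr (p * p) * D) * (\<Phi> t x * ?I x) \<partial>lborel)"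
        by (rule nn_integral_add) measurable
      moreover have "(\<integral>\<^sup>+x. ?A x + ennreal (?a x powr p) + ennreal (\<eta> powr p) * ?I x \<partial>lborel)
        = (\<integral>\<^sup>+x. ?A x + ennreal (?a x powr p) \<partial>lborel) + (\<integral>\<^sup>+x. ennreal (\<eta> powr p) * ?I x \<partial>lborel)"
        by (rule nn_integral_add) measurable
      moreover have "(\<integral>\<^sup>+x. ?A x + ennreal (?a x powr p) \<partial>lborel) = (\<integral>\<^sup>+x. ?A x \<partial>lborel) + (\<integral>\<^sup>+x. ennreal (?a x powr p) \<partial>lborel)"
        by (rule nn_integral_add) measurable
      moreover have "(\<integral>\<^sup>+x. ennreal (4 powr p) * (?A x + ennreal (?a x powr p) + ennreal (\<eta> powr p) * ?I x + ennreal (2 powr (p * p) * D) * (\<Phi> t x * ?I x)) \<partial>lborel)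
        = ennreal (4 powr p) * (\<integral>\<^sup>+x. ?A x + ennreal (?a x powr p) + ennreal (\<eta> powr p) * ?I x + ennreal (2 powr (p * p) * D) * (\<Phi> t x * ?I x) \<partial>lborel)"
        by (rule nn_integral_cmult) measurable
      ultimately show ?thesis by (simp only:)
    qed
    also have "\<dots> \<le> ennreal (4 powr p) * (ennreal E + ennreal E + ennreal E + ennreal E)"
    proof (intro mult_left_mono add_mono)
      show "(\<integral>\<^sup>+x. ?A x \<partial>lborel) \<le> ennreal E" using tail t by (simp add: nn_integral_nn_heat)
      show "ennreal (\<eta> powr p) * ennreal \<beta> \<le> ennreal E"
      proof -
        have "\<eta> powr p * \<beta> \<le> E" unfolding \<eta>(2) using \<beta>0 E by (simp add: field_simps)
        then show ?thesis using \<beta>0 by (simp add: ennreal_mult[symmetric] ennreal_leI)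
      qed
      have "(\<integral>\<^sup>+x. \<Phi> t x * ?I x \<partial>lborel) \<le> (\<integral>\<^sup>+x. nn_heat t (\<lambda>y. ennreal (W y powr p - M)) x + ennreal M * ?I x \<partial>lborel)"
      proof (rule nn_integral_mono)
        fix x
        show "\<Phi> t x * ?I x \<le> nn_heat t (\<lambda>y. ennreal (W y powr p - M)) x + ennreal M * ?I x"
          using M(3)[OF t(1), of x] by (cases "x \<in> ball y 1") auto
      qed
      also have "\<dots> = (\<integral>\<^sup>+x. nn_heat t (\<lambda>y. ennreal (W y powr p - M)) x \<partial>lborel) + ennreal M * ennreal \<beta>"
      proof -
        have [measurable]: "?I \<in> borel_measurable borel" by (intro borel_measurable_indicator) simp
        have "(\<integral>\<^sup>+x. ennreal M * ?I x \<partial>lborel) = ennreal M * ennreal \<beta>"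
          by (simp add: nn_integral_cmult_indicator \<beta>)
        moreover have "(\<integral>\<^sup>+x. nn_heat t (\<lambda>y. ennreal (W y powr p - M)) x + ennreal M * ?I x \<partial>lborel)
          = (\<integral>\<^sup>+x. nn_heat t (\<lambda>y. ennreal (W y powr p - M)) x \<partial>lborel) + (\<integral>\<^sup>+x. ennreal M * ?I x \<partial>lborel)"
          by (rule nn_integral_add) measurable
        ultimately show ?thesis by (simp only:)
      qed
      also have "\<dots> \<le> ennreal (E / 2) + ennreal M * ennreal \<beta>"
        using M(2) t by (intro add_right_mono) (simp add: nn_integral_nn_heat)
      also have "\<dots> = ennreal (E / 2 + M * \<beta>)"
        using M E \<beta>0 by (simp add: ennreal_mult)
      finally have "ennreal (2 powr (p * p) * D) * (\<integral>\<^sup>+x. \<Phi> t x * ?I x \<partial>lborel) \<le> ennreal (2 powr (p * p) * D) * ennreal (E / 2 + M * \<beta>)"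
        by (rule mult_left_mono) simp
      also have "\<dots> = ennreal (2 powr (p * p) * D * (E / 2 + M * \<beta>))"
        using D E M \<beta>0 by (intro ennreal_mult[symmetric]) auto
      also have "\<dots> \<le> ennreal E"
      proof (rule ennreal_leI)
        have "2 powr (p * p) * D * (E / 2 + M * \<beta>) = E * ((E / 2 + M * \<beta>) / (E / 2 + M * \<beta> + 1))"
          by (simp add: D_def)
        also have "\<dots> \<le> E * 1" using E den by (intro mult_left_mono) (auto simp: divide_le_eq)
        finally show "2 powr (p * p) * D * (E / 2 + M * \<beta>) \<le> E" by simp
      qed
      finally show "ennreal (2 powr (p * p) * D) * (\<integral>\<^sup>+x. \<Phi> t x * ?I x \<partial>lborel) \<le> ennreal E" .
    qed (use tail in auto)
    also have "\<dots> = ennreal (4 powr p * (4 * E))"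
      using E by (simp add: ennreal_plus[symmetric] ennreal_mult[symmetric] del: ennreal_plus)
    also have "4 powr p * (4 * E) = e" by (simp add: E_def)
    finally show ?thesis .
  qed
  show thesis by (rule that[of "min d1 d2"]) (use d1 d2 goal in auto)
qed

end

subsection \<open>Uniformly local Lebesgue spaces\<close>

text \<open>The \<open>q\<close>-th power of the local norm as an extended integral over
  \<open>lborel\<close>, so that estimates can be made before integrability is settled. The lemmas
  below transfer them to \<open>ul_ball_norm\<close>.\<close>

definition ul_ball_nn :: "real \<Rightarrow> (real ^ 'n \<Rightarrow> real) \<Rightarrow> real ^ 'n \<Rightarrow> ennreal" where
  "ul_ball_nn q f y = (\<integral>\<^sup>+x. ennreal (\<bar>f x\<bar> powr q) * indicator (ball y 1) x \<partial>lborel)"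

lemma ul_ball_norm_le:
  assumes q: "q > 0" and c: "c \<ge> 0" "ul_ball_nn q f y \<le> ennreal c"
  shows "ul_ball_norm q f y \<le> c powr (1 / q)"
proof -
  let ?g = "\<lambda>x. indicat_real (ball y 1) x *\<^sub>R \<bar>f x\<bar> powr q"
  have "integral\<^sup>L lebesgue ?g \<le> c"
  \<comment> \<open>Without integrability the Lebesgue integral has the default value
    \<open>0\<close>, so the bound holds in either case and no measurability of \<open>f\<close> is
    assumed.\<close>
  proof (cases "integrable lebesgue ?g")
    case True
    then have "ennreal (integral\<^sup>L lebesgue ?g) = (\<integral>\<^sup>+x. ennreal (?g x) \<partial>lebesgue)"
      by (intro nn_integral_eq_integral[symmetric]) auto
    also have "\<dots> = (\<integral>\<^sup>+x. ennreal (?g x) \<partial>lborel)" by (rule nn_integral_completion)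
    also have "\<dots> = ul_ball_nn q f y"
      unfolding ul_ball_nn_def by (intro nn_integral_cong) (auto simp: indicator_def)
    finally have "ennreal (integral\<^sup>L lebesgue ?g) \<le> ennreal c" using c by simp
    then show ?thesis using c(1) by (simp only: ennreal_le_iff)
  qed (use c in \<open>simp add: not_integrable_integral_eq\<close>)
  moreover have "0 \<le> integral\<^sup>L lebesgue ?g" by (rule Bochner_Integration.integral_nonneg) simp
  ultimately show ?thesis
    unfolding ul_ball_norm_def set_lebesgue_integral_def using q by (intro powr_mono2) auto
qed

text \<open>A supremum preserves only non-strict bounds; the level \<open>e / 2\<close> makes the
  result strict.\<close>

lemma ul_norm_less:
  assumes q: "q > 0" and e: "e > 0" "\<And>y. ul_ball_nn q f y \<le> ennreal ((e / 2) powr q)"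
  shows "ul_norm q f < e"
proof -
  have "ul_norm q f \<le> ((e / 2) powr q) powr (1 / q)"
    unfolding ul_norm_def by (rule cSUP_least) (auto intro!: ul_ball_norm_le q e)
  also have "\<dots> = e / 2" using q e by (simp add: powr_powr)
  finally show ?thesis using e by simp
qed

text \<open>A compact set is covered by finitely many unit balls, so control on these gives local
  integrability.\<close>

lemma Lq_ulI:
  assumes q: "q > 0" and f: "f \<in> borel_measurable borel" and c: "c \<ge> 0" "\<And>y. ul_ball_nn q f y \<le> ennreal c"
  shows "f \<in> Lq_ul q"
proof -
  note [measurable] = f
  have fl: "f \<in> borel_measurable lebesgue" using f by (intro measurable_completion) simp
  have "set_integrable lebesgue K (\<lambda>x. \<bar>f x\<bar> powr q)" if K: "compact K" for K
    unfolding set_integrable_def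
  proof (rule integrableI_bounded)
    have Kb: "K \<in> sets borel" using K by (simp add: compact_imp_closed)
    have "(\<lambda>x. indicat_real K x *\<^sub>R \<bar>f x\<bar> powr q) \<in> borel_measurable lborel" using Kb by measurable
    then show "(\<lambda>x. indicat_real K x *\<^sub>R \<bar>f x\<bar> powr q) \<in> borel_measurable lebesgue" by (rule measurable_completion)
    obtain Y where Y: "finite Y" "K \<subseteq> (\<Union>y\<in>Y. ball y 1)"
      using K unfolding compact_eq_totally_bounded by (metis zero_less_one)
    have "(\<integral>\<^sup>+x. ennreal (norm (indicat_real K x *\<^sub>R \<bar>f x\<bar> powr q)) \<partial>lebesgue)
        = (\<integral>\<^sup>+x. ennreal (norm (indicat_real K x *\<^sub>R \<bar>f x\<bar> powr q)) \<partial>lborel)"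
      by (rule nn_integral_completion)
    also have "\<dots> \<le> (\<integral>\<^sup>+x. (\<Sum>y\<in>Y. ennreal (\<bar>f x\<bar> powr q) * indicator (ball y 1) x) \<partial>lborel)"
    proof (rule nn_integral_mono)
      fix x
      show "ennreal (norm (indicat_real K x *\<^sub>R \<bar>f x\<bar> powr q)) \<le> (\<Sum>y\<in>Y. ennreal (\<bar>f x\<bar> powr q) * indicator (ball y 1) x)"
      proof (cases "x \<in> K")
        case True
        then obtain y where "y \<in> Y" "x \<in> ball y 1" using Y by blast
        then have "ennreal (\<bar>f x\<bar> powr q) = (\<Sum>y\<in>{y}. ennreal (\<bar>f x\<bar> powr q) * indicator (ball y 1) x)" by simp
        also have "\<dots> \<le> (\<Sum>y\<in>Y. ennreal (\<bar>f x\<bar> powr q) * indicator (ball y 1) x)"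
          using \<open>y \<in> Y\<close> Y(1) by (intro sum_mono2) auto
        finally show ?thesis using True by simp
      qed simp
    qed
    also have "\<dots> = (\<Sum>y\<in>Y. ul_ball_nn q f y)"
      unfolding ul_ball_nn_def by (rule nn_integral_sum) (measurable, simp)
    also have "\<dots> \<le> (\<Sum>y\<in>Y. ennreal c)" by (intro sum_mono c)
    also have "\<dots> < \<infinity>" by (simp add: ennreal_mult_less_top of_nat_less_top)
    finally show "(\<integral>\<^sup>+x. ennreal (norm (indicat_real K x *\<^sub>R \<bar>f x\<bar> powr q)) \<partial>lebesgue) < \<infinity>" .
  qed
  moreover have "bdd_above (range (ul_ball_norm q f))"
    by (rule bdd_aboveI[of _ "c powr (1 / q)"]) (auto intro!: ul_ball_norm_le q c)
  ultimately show ?thesis using fl by (simp add: Lq_ul_def Lq_loc_def)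
qed

definition unit_ball_measure :: "(real ^ 'n) itself \<Rightarrow> real" where
  "unit_ball_measure _ = measure lborel (ball (0 :: real ^ 'n) 1)"

lemma unit_ball_measure: "emeasure lborel (ball (y :: real ^ 'n) 1) = ennreal (unit_ball_measure TYPE(real ^ 'n))"
  by (simp add: unit_ball_measure_def emeasure_ball content_ball)

lemma unit_ball_measure_nonneg [simp]: "0 \<le> unit_ball_measure TYPE(real ^ 'n)"
  by (simp add: unit_ball_measure_def)

lemma ul_ball_nn_bounded:
  fixes f :: "real ^ 'n \<Rightarrow> real"
  assumes q: "q > 0" and f: "\<And>x. \<bar>f x\<bar> \<le> M"
  shows "ul_ball_nn q f y \<le> ennreal (M powr q * unit_ball_measure TYPE(real ^ 'n))"
proof -
  have "ul_ball_nn q f y \<le> (\<integral>\<^sup>+x. ennreal (M powr q) * indicator (ball y 1) x \<partial>lborel)"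
    unfolding ul_ball_nn_def using q f by (intro nn_integral_mono mult_right_mono ennreal_leI powr_mono2) auto
  also have "\<dots> = ennreal (M powr q * unit_ball_measure TYPE(real ^ 'n))"
    by (simp add: nn_integral_cmult_indicator unit_ball_measure ennreal_mult)
  finally show ?thesis .
qed

lemma ul_ball_nn_uniformly_small:
  assumes q: "q > 0" and e: "e > 0"
  obtains \<eta> where "\<eta> > 0" "\<forall>f. (\<forall>x :: real ^ 'n. \<bar>f x\<bar> \<le> \<eta>) \<longrightarrow> (\<forall>y. ul_ball_nn q f y \<le> ennreal e)"
proof -
  let ?\<beta> = "unit_ball_measure TYPE(real ^ 'n)"
  have b: "0 \<le> ?\<beta>" by simp
  define \<eta> where "\<eta> = (e / (?\<beta> + 1)) powr (1 / q)"
  have b1: "?\<beta> + 1 > 0" by (rule add_nonneg_pos) simp_all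
  have \<eta>: "\<eta> > 0" "\<eta> powr q = e / (?\<beta> + 1)" using e q b1 by (auto simp: \<eta>_def powr_powr)
  have "\<eta> powr q * ?\<beta> \<le> e" unfolding \<eta>(2) using e b b1 by (simp add: divide_le_eq distrib_left mult.commute)
  then have "ul_ball_nn q f y \<le> ennreal e" if "\<forall>x. \<bar>f x\<bar> \<le> \<eta>" for f :: "real ^ 'n \<Rightarrow> real" and y
    using order_trans[OF ul_ball_nn_bounded[OF q] ennreal_leI] that by blast
  then show thesis using that[OF \<eta>(1)] by blast
qed

lemma calLq_ulI:
  assumes q: "q > 0" and f: "f \<in> Lq_ul q"
    and g: "\<And>e. e > 0 \<Longrightarrow> \<exists>g\<in>BUC. \<forall>y. ul_ball_nn q (\<lambda>x. f x - g x) y \<le> ennreal e"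
  shows "f \<in> calLq_ul q"
  unfolding calLq_ul_def
proof (intro CollectI conjI f allI impI)
  fix e :: real assume e: "e > 0"
  obtain h where "h \<in> BUC" "\<forall>y. ul_ball_nn q (\<lambda>x. f x - h x) y \<le> ennreal ((e / 2) powr q)"
    using g[of "(e / 2) powr q"] e by auto
  then show "\<exists>g\<in>BUC. ul_norm q (\<lambda>x. f x - g x) < e" using ul_norm_less[OF q e] by blast
qed

lemma BUC_imp_calLq_ul:
  assumes q: "q > 0" and f: "f \<in> BUC"
  shows "f \<in> calLq_ul q"
proof (rule calLq_ulI[OF q])
  have "bounded (range f)" "uniformly_continuous_on UNIV f" using f by (auto simp: BUC_def)
  then obtain M where M: "\<And>x. \<bar>f x\<bar> \<le> M" and m: "f \<in> borel_measurable borel"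
    by (auto simp: bounded_iff intro: borel_measurable_continuous_onI uniformly_continuous_imp_continuous)
  show "f \<in> Lq_ul q"
    by (rule Lq_ulI[OF q m _ ul_ball_nn_bounded[OF q M]]) simp
  show "\<exists>g\<in>BUC. \<forall>y. ul_ball_nn q (\<lambda>x. f x - g x) y \<le> ennreal e" for e
    by (rule bexI[OF _ f]) (simp add: ul_ball_nn_def)
qed

text \<open>The approximants are the truncations \<open>B\<close>: almost everywhere
  \<open>f - B\<close> is the excess over \<open>k\<close>, whose \<open>p\<close>-th power has a
  small integral over the whole space and so over every ball.\<close>

lemma truncatable_imp_calLq_ul:
  fixes f :: "real ^ 'n \<Rightarrow> real"
  assumes p: "p > 0" and f: "f \<in> borel_measurable borel" "AE x in lborel. 0 \<le> f x"
    and tail: "\<And>e. e > 0 \<Longrightarrow> \<exists>M\<ge>0. (\<integral>\<^sup>+y. ennreal (f y powr p - M) \<partial>lborel) \<le> ennreal e"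
    and trunc: "\<And>k. k > 0 \<Longrightarrow> \<exists>B. uniformly_continuous_on UNIV B \<and> (\<forall>x. 0 \<le> B x \<and> B x \<le> k) \<and>
     (AE x in lborel. B x = min (f x) k)"
  shows "f \<in> calLq_ul p"
proof (rule calLq_ulI[OF p])
  note [measurable] = f(1)
  obtain M where M: "M \<ge> 0" "(\<integral>\<^sup>+y. ennreal (f y powr p - M) \<partial>lborel) \<le> ennreal 1" using tail[of 1] by auto
  let ?\<beta> = "unit_ball_measure TYPE(real ^ 'n)"
  have bnd: "ul_ball_nn p f y \<le> ennreal (1 + M * ?\<beta>)" for y
  proof -
    have [measurable]: "(indicator (ball y 1) :: real ^ 'n \<Rightarrow> ennreal) \<in> borel_measurable borel"
      by (intro borel_measurable_indicator) simp
    have "ul_ball_nn p f y \<le> (\<integral>\<^sup>+x. ennreal (f x powr p - M) + ennreal M * indicator (ball y 1) x \<partial>lborel)"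
      unfolding ul_ball_nn_def
    proof (rule nn_integral_mono_AE)
      show "AE x in lborel. ennreal (\<bar>f x\<bar> powr p) * indicator (ball y 1) x \<le> ennreal (f x powr p - M) + ennreal M * indicator (ball y 1) x"
        using f(2)
      proof eventually_elim
        case (elim x)
        have "ennreal (f x powr p) \<le> ennreal (max (f x powr p - M) 0 + M)" by (intro ennreal_leI) simp
        also have "\<dots> = ennreal (f x powr p - M) + ennreal M"
          using M by (auto simp: max_def ennreal_neg ennreal_plus[symmetric] simp del: ennreal_plus)
        finally show ?case using elim by (cases "x \<in> ball y 1") auto
      qed
    qed
    also have "\<dots> = (\<integral>\<^sup>+x. ennreal (f x powr p - M) \<partial>lborel) + (\<integral>\<^sup>+x. ennreal M * indicator (ball y 1) x \<partial>lborel)"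
      by (rule nn_integral_add) measurable
    also have "(\<integral>\<^sup>+x. ennreal M * indicator (ball y 1) x \<partial>lborel) = ennreal M * ennreal ?\<beta>"
      by (simp add: nn_integral_cmult_indicator unit_ball_measure)
    also have "(\<integral>\<^sup>+x. ennreal (f x powr p - M) \<partial>lborel) + ennreal M * ennreal ?\<beta> \<le> ennreal 1 + ennreal M * ennreal ?\<beta>"
      by (rule add_right_mono[OF M(2)])
    also have "\<dots> = ennreal (1 + M * ?\<beta>)"
      using M by (simp add: ennreal_mult[symmetric] ennreal_plus[symmetric] del: ennreal_plus ennreal_1)
    finally show ?thesis .
  qed
  show "f \<in> Lq_ul p" by (rule Lq_ulI[OF p f(1) _ bnd]) (use M in simp)
  fix e :: real assume e: "e > 0"
  obtain k where k: "k > 0" "(\<integral>\<^sup>+x. ennreal (max (f x - k) 0 powr p) \<partial>lborel) \<le> ennreal e"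
    using tail_imp_excess[OF p f(1) tail e] by metis
  obtain B where B: "uniformly_continuous_on UNIV B" "\<And>x. 0 \<le> B x" "\<And>x. B x \<le> k" "AE x in lborel. B x = min (f x) k"
    using trunc[OF k(1)] by blast
  have "B \<in> BUC" using B(1-3) by (auto simp: BUC_def bounded_iff intro!: exI[of _ k])
  moreover have "ul_ball_nn p (\<lambda>x. f x - B x) y \<le> ennreal e" for y
  proof -
    have "ul_ball_nn p (\<lambda>x. f x - B x) y \<le> (\<integral>\<^sup>+x. ennreal (max (f x - k) 0 powr p) \<partial>lborel)"
      unfolding ul_ball_nn_def
    proof (rule nn_integral_mono_AE)
      show "AE x in lborel. ennreal (\<bar>f x - B x\<bar> powr p) * indicator (ball y 1) x \<le> ennreal (max (f x - k) 0 powr p)"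
        using B(4) by eventually_elim (auto simp: indicator_def min_def max_def)
    qed
    then show ?thesis using k(2) by (rule order_trans)
  qed
  ultimately show "\<exists>g\<in>BUC. \<forall>y. ul_ball_nn p (\<lambda>x. f x - g x) y \<le> ennreal e" by blast
qed

lemma C_calLq_ulI:
  assumes q: "q > 0" and m: "\<And>t. t \<in> {0..T} \<Longrightarrow> (\<lambda>x. w x t) \<in> calLq_ul q"
    and c: "\<And>t e. t \<in> {0..T} \<Longrightarrow> e > 0 \<Longrightarrow> \<exists>d>0. \<forall>s\<in>{0..T}. \<bar>s - t\<bar> < d \<longrightarrow> (\<forall>y. ul_ball_nn q (\<lambda>x. w x s - w x t) y \<le> ennreal e)"
  shows "w \<in> C_calLq_ul T q"
  unfolding C_calLq_ul_def
proof (intro CollectI conjI ballI allI impI)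
  fix t e :: real assume t: "t \<in> {0..T}" and e: "0 < e"
  obtain d where d: "d > 0" "\<forall>s\<in>{0..T}. \<bar>s - t\<bar> < d \<longrightarrow> (\<forall>y. ul_ball_nn q (\<lambda>x. w x s - w x t) y \<le> ennreal ((e / 2) powr q))"
    using c[OF t, of "(e / 2) powr q"] e by auto
  show "\<exists>d>0. \<forall>s\<in>{0..T}. \<bar>s - t\<bar> < d \<longrightarrow> ul_norm q (\<lambda>x. w x s - w x t) < e"
    by (rule exI[of _ d]) (use d ul_norm_less[OF q e] in blast)
qed (rule m)

subsection \<open>Classical solutions from directional derivatives\<close>

lemma partialI:
  assumes "((\<lambda>h. f (x + h *\<^sub>R axis i 1)) has_real_derivative d) (at 0)"
  shows "has_partial i f x" "partial i f x = d"
  using assms by (auto simp: has_partial_def partial_def field_differentiable_def intro: DERIV_imp_deriv)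

text \<open>\<open>partial i\<close> agrees with the candidate \<open>w1 i\<close> on
  \<open>D\<close> only. Since \<open>D\<close> is open, a short segment around each point stays in
  \<open>D\<close>, and along it the two may be exchanged before the second differentiation.\<close>

lemma classical_solution_onI:
  fixes w :: "real ^ 'n \<Rightarrow> real \<Rightarrow> real"
  assumes D: "open D"
    and wt: "\<And>x t. x \<in> D \<Longrightarrow> t \<in> I \<Longrightarrow> (w x has_real_derivative wt x t) (at t)"
    and w1: "\<And>x t i. x \<in> D \<Longrightarrow> t \<in> I \<Longrightarrow> ((\<lambda>h. w (x + h *\<^sub>R axis i 1) t) has_real_derivative w1 i x t) (at 0)"
    and w2: "\<And>x t i j. x \<in> D \<Longrightarrow> t \<in> I \<Longrightarrow> ((\<lambda>h. w1 i (x + h *\<^sub>R axis j 1) t) has_real_derivative w2 j i x t) (at 0)"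
    and c: "continuous_on (D \<times> I) (\<lambda>(x, t). w x t)"
    and c1: "\<And>i. continuous_on (D \<times> I) (\<lambda>(x, t). w1 i x t)"
    and c2: "\<And>i j. continuous_on (D \<times> I) (\<lambda>(x, t). w2 j i x t)"
    and ct: "continuous_on (D \<times> I) (\<lambda>(x, t). wt x t)"
    and pde: "\<And>x t. x \<in> D \<Longrightarrow> t \<in> I \<Longrightarrow> wt x t = (\<Sum>i\<in>UNIV. w2 i i x t) + w x t powr p"
  shows "classical_solution_on p D I w"
proof -
  have p1: "has_partial i (\<lambda>y. w y t) x" "partial i (\<lambda>y. w y t) x = w1 i x t" if "x \<in> D" "t \<in> I" for x t i
    using partialI[OF w1[OF that]] by auto
  have "((\<lambda>h. partial i (\<lambda>y. w y t) (x + h *\<^sub>R axis j 1)) has_real_derivative w2 j i x t) (at 0)"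
    if "x \<in> D" "t \<in> I" for x t i j
  proof (rule has_field_derivative_transform_within_open[OF w2[OF that]])
    show "open ((\<lambda>h. x + h *\<^sub>R axis j 1) -` D)" by (intro open_vimage D continuous_intros)
  qed (use that p1 in auto)
  from partialI[OF this] have p2: "has_partial j (partial i (\<lambda>y. w y t)) x" "partial j (partial i (\<lambda>y. w y t)) x = w2 j i x t"
    if "x \<in> D" "t \<in> I" for x t i j
    using that by auto
  have dt: "deriv (w x) t = wt x t" if "x \<in> D" "t \<in> I" for x t using wt[OF that] by (rule DERIV_imp_deriv)
  have "continuous_on (D \<times> I) (\<lambda>(x, t). deriv (w x) t)"
    using ct by (rule continuous_on_cong[THEN iffD1, rotated 2]) (auto simp: dt)
  moreover have "continuous_on (D \<times> I) (\<lambda>(x, t). partial i (\<lambda>y. w y t) x)" for i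
    using c1 by (rule continuous_on_cong[THEN iffD1, rotated 2]) (auto simp: p1)
  moreover have "continuous_on (D \<times> I) (\<lambda>(x, t). partial j (partial i (\<lambda>y. w y t)) x)" for i j
    using c2 by (rule continuous_on_cong[THEN iffD1, rotated 2]) (auto simp: p2)
  moreover have "w x field_differentiable (at t)" if "x \<in> D" "t \<in> I" for x t
    using wt[OF that] by (auto simp: field_differentiable_def)
  ultimately show ?thesis
    unfolding classical_solution_on_def C21_on_def laplacian_def
    using c p1 p2 by (auto simp: dt pde)
qed

lemma sum_Basis_vec: "(\<Sum>b\<in>(Basis :: (real ^ 'n) set). F b) = (\<Sum>i\<in>UNIV. F (axis i 1))"
proof -
  have "(Basis :: (real ^ 'n) set) = (\<lambda>i. axis i 1) ` UNIV" by (auto simp: Basis_vec_def)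
  moreover have "inj (\<lambda>i::'n. axis i (1::real))" by (auto simp: inj_on_def axis_eq_axis)
  ultimately show ?thesis using sum.reindex[of "\<lambda>i::'n. axis i (1::real)" UNIV F] by simp
qed

text \<open>The regularity theory covers \<open>t < T\<close>, while continuity is claimed on a
  closed interval, hence \<open>T' < T\<close>. Continuity at \<open>0\<close> is
  \<open>sol_initial\<close>; at positive times it follows from the modulus in time, which is
  uniform in \<open>x\<close>.\<close>

lemma critical_datum_cauchy_solution:
  fixes W w0 :: "real ^ 'n \<Rightarrow> real"
  assumes W: "critical_datum_continuous W p T" and T': "0 < T'" "T' < T"
    and w0: "\<And>x. x \<noteq> 0 \<Longrightarrow> W x = w0 x"
  obtains v where "cauchy_solution p p T' UNIV w0 v"
    "\<And>t. 0 < t \<Longrightarrow> t \<le> T' \<Longrightarrow> \<exists>M. \<forall>x. v x t \<le> M"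
proof -
  interpret S: critical_datum_continuous W p T by fact
  \<comment> \<open>\<open>S.sol\<close> is \<open>0\<close> at time \<open>0\<close> by definition;
    the datum is put in by hand.\<close>
  define v where "v x t = (if t = 0 then W x else S.sol x t)" for x t
  have p: "p > 0" using S.p by simp
  have buc: "(\<lambda>x. S.sol x t) \<in> BUC" if t: "0 < t" "t < T" for t
  proof -
    obtain M where "\<And>x. \<bar>S.sol x t\<bar> \<le> M" using S.v_abs_bounded[OF t(1)] t by (metis atLeastLessThan_iff order_refl)
    moreover obtain L where L: "L \<ge> 0" "\<And>x z. \<bar>S.sol (x + z) t - S.sol x t\<bar> \<le> L * norm z"
      using S.v_lipschitz[OF t(1)] t by (metis atLeastLessThan_iff order_refl)
    have "uniformly_continuous_on UNIV (\<lambda>x. S.sol x t)"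
      unfolding uniformly_continuous_on_def
    proof (intro allI impI)
      fix e :: real assume e: "e > 0"
      have "dist (S.sol x' t) (S.sol x t) < e" if "dist x' x < e / (L + 1)" for x x'
      proof -
        have "dist (S.sol x' t) (S.sol x t) \<le> L * norm (x' - x)"
          using L(2)[of x "x' - x"] by (simp add: dist_real_def)
        also have "\<dots> \<le> (L + 1) * norm (x' - x)" by (simp add: mult_right_mono)
        also have "\<dots> < e" using that L(1) by (simp add: dist_norm pos_less_divide_eq mult.commute)
        finally show ?thesis .
      qed
      moreover have "e / (L + 1) > 0" using e L by simp
      ultimately show "\<exists>d>0. \<forall>x\<in>UNIV. \<forall>x'\<in>UNIV. dist x' x < d \<longrightarrow> dist (S.sol x' t) (S.sol x t) < e" by blast
    qed
    ultimately show ?thesis by (auto simp: BUC_def bounded_iff)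
  qed
  have "v \<in> C_calLq_ul T' p"
  proof (rule C_calLq_ulI[OF p])
    fix t assume t: "t \<in> {0..T'}"
    show "(\<lambda>x. v x t) \<in> calLq_ul p"
    proof (cases "t = 0")
      case True
      have "W \<in> calLq_ul p"
        by (rule truncatable_imp_calLq_ul[OF p S.W_measurable _ S.W_tail S.W_truncation]) (use S.W_nonneg in auto)
      then show ?thesis using True by (simp add: v_def)
    next
      case False
      then show ?thesis using BUC_imp_calLq_ul[OF p buc] t T' by (simp add: v_def)
    qed
    fix e :: real assume e: "e > 0"
    show "\<exists>d>0. \<forall>s\<in>{0..T'}. \<bar>s - t\<bar> < d \<longrightarrow> (\<forall>y. ul_ball_nn p (\<lambda>x. v x s - v x t) y \<le> ennreal e)"
    proof (cases "t = 0")
      case True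
      obtain d where d: "d > 0" "\<And>s y. 0 < s \<Longrightarrow> s < d \<Longrightarrow> s \<le> T \<Longrightarrow>
        (\<integral>\<^sup>+x. ennreal (\<bar>S.sol x s - W x\<bar> powr p) * indicator (ball y 1) x \<partial>lborel) \<le> ennreal e"
        by (rule S.sol_initial[OF e]) (rule that)
      have "ul_ball_nn p (\<lambda>x. v x s - v x t) y \<le> ennreal e" if "s \<in> {0..T'}" "\<bar>s - t\<bar> < d" for s y
        using d(2)[of s y] that True T' e by (cases "s = 0") (auto simp: v_def ul_ball_nn_def)
      then show ?thesis using d(1) by blast
    next
      case False
      then have t0: "0 < t / 2" "0 < t" using t by auto
      obtain \<eta> where \<eta>: "\<eta> > 0" "\<forall>f. (\<forall>x :: real ^ 'n. \<bar>f x\<bar> \<le> \<eta>) \<longrightarrow> (\<forall>y. ul_ball_nn p f y \<le> ennreal e)"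
        by (rule ul_ball_nn_uniformly_small[OF p e]) (rule that)
      obtain C where C: "C \<ge> 0" "\<And>s r x. t / 2 \<le> s \<Longrightarrow> s \<le> r \<Longrightarrow> r < T \<Longrightarrow> \<bar>S.sol x r - S.sol x s\<bar> \<le> C * (r - s + sqrt (r - s))"
        by (rule S.v_time_modulus[OF t0(1)]) (rule that)
      have "((\<lambda>h. C * (h + sqrt h)) \<longlongrightarrow> C * (0 + sqrt 0)) (at 0)" by (intro tendsto_intros)
      then have "\<forall>\<^sub>F h in at 0. C * (h + sqrt h) < \<eta>" using \<eta>(1) by (intro order_tendstoD) auto
      then obtain d where d: "d > 0" "\<And>h. h \<noteq> 0 \<Longrightarrow> \<bar>h\<bar> < d \<Longrightarrow> C * (h + sqrt h) < \<eta>"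
        by (auto simp: eventually_at dist_real_def)
      have "ul_ball_nn p (\<lambda>x. v x s - v x t) y \<le> ennreal e" if s: "s \<in> {0..T'}" "\<bar>s - t\<bar> < min d (t / 2)" for s y
      proof (rule \<eta>(2)[rule_format])
        fix x
        have s2: "t / 2 \<le> s" "0 < s" using s t0 by (auto simp: abs_if split: if_splits)
        have "\<bar>S.sol x s - S.sol x t\<bar> \<le> C * (\<bar>s - t\<bar> + sqrt \<bar>s - t\<bar>)"
          using C(2)[of s t x] C(2)[of t s x] s2 t s t0 T' by (cases "s \<le> t") (auto simp: abs_minus_commute)
        also have "\<dots> \<le> \<eta>" using d(2)[of "\<bar>s - t\<bar>"] s \<eta>(1) by (cases "s = t") auto
        finally show "\<bar>v x s - v x t\<bar> \<le> \<eta>" using s2 t0 by (simp add: v_def)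
      qed
      then show ?thesis by (intro exI[of _ "min d (t / 2)"]) (use d t0 in auto)
    qed
  qed
  moreover have "classical_solution_on p UNIV {0<..<T'} v"
  proof -
    have sub: "UNIV \<times> {0<..<T'} \<subseteq> UNIV \<times> {0<..<T}" using T' by auto
    have b: "axis i 1 \<in> (Basis :: (real ^ 'n) set)" for i by simp
    have cc: "continuous_on (UNIV \<times> {0<..<T'}) (\<lambda>(x, t). (\<Sum>i\<in>UNIV. S.v'' (axis i 1) (axis i 1) x t) + S.sol x t powr p)"
    proof -
      have "continuous_on (UNIV \<times> {0<..<T'}) (\<lambda>q. (\<Sum>i\<in>UNIV. S.v'' (axis i 1) (axis i 1) (fst q) (snd q)) + S.sol (fst q) (snd q) powr p)"
      proof (intro continuous_intros)
        show "continuous_on (UNIV \<times> {0<..<T'}) (\<lambda>q. S.v'' (axis i 1) (axis i 1) (fst q) (snd q))" for i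
          using continuous_on_subset[OF S.continuous_on_v''[OF b b] sub] by (simp add: case_prod_unfold)
        show "continuous_on (UNIV \<times> {0<..<T'}) (\<lambda>q. S.sol (fst q) (snd q))"
          using continuous_on_subset[OF S.continuous_on_v sub] by (simp add: case_prod_unfold)
        show "\<forall>q\<in>UNIV \<times> {0<..<T'}. S.sol (fst q) (snd q) \<noteq> 0"
          using less_imp_neq[OF S.v_pos] T' by fastforce
      qed
      then show ?thesis by (simp add: case_prod_unfold)
    qed
    have cv: "continuous_on (UNIV \<times> {0<..<T'}) (\<lambda>(x, t). v x t)"
      using continuous_on_subset[OF S.continuous_on_v sub]
      by (rule continuous_on_cong[THEN iffD1, rotated 2]) (auto simp: v_def)
    show ?thesis
    proof (rule classical_solution_onI[where ?w1.0 = "\<lambda>i. S.v' (axis i 1)" and ?w2.0 = "\<lambda>j i. S.v'' (axis j 1) (axis i 1)"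
          and wt = "\<lambda>x t. (\<Sum>i\<in>UNIV. S.v'' (axis i 1) (axis i 1) x t) + S.sol x t powr p"])
      show "(v x has_real_derivative (\<Sum>i\<in>UNIV. S.v'' (axis i 1) (axis i 1) x t) + S.sol x t powr p) (at t)"
        if "t \<in> {0<..<T'}" for x t
      proof (rule has_field_derivative_transform_within_open[where S = "{0<..}"])
        show "(S.sol x has_real_derivative (\<Sum>i\<in>UNIV. S.v'' (axis i 1) (axis i 1) x t) + S.sol x t powr p) (at t)"
          using S.v_time_derivative[of t x] that T' by (simp add: sum_Basis_vec)
      qed (use that in \<open>auto simp: v_def\<close>)
      show "((\<lambda>h. v (x + h *\<^sub>R axis i 1) t) has_real_derivative S.v' (axis i 1) x t) (at 0)" if "t \<in> {0<..<T'}" for x t i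
        using S.v_space_derivative[of t "axis i 1" x] that T' by (simp add: v_def)
      show "((\<lambda>h. S.v' (axis i 1) (x + h *\<^sub>R axis j 1) t) has_real_derivative S.v'' (axis j 1) (axis i 1) x t) (at 0)" if "t \<in> {0<..<T'}" for x t i j
        using that T' by (intro S.v'_space_derivative) auto
    qed (use cv continuous_on_subset[OF S.continuous_on_v' sub]
        continuous_on_subset[OF S.continuous_on_v'' sub] cc in \<open>auto simp: v_def\<close>)
  qed
  moreover have "v x 0 = w0 x" if "x \<noteq> 0" for x using w0[OF that] by (simp add: v_def)
  moreover have "0 \<le> v x t" for x t by (simp add: v_def S.W_nonneg S.sol_nonneg)
  ultimately have "cauchy_solution p p T' UNIV w0 v" by (simp add: cauchy_solution_def)
  moreover have "\<exists>M. \<forall>x. v x t \<le> M" if t: "0 < t" "t \<le> T'" for t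
  proof -
    obtain M where "\<forall>s\<in>{t..T}. \<forall>x. S.sol x s \<le> M" using S.sol_bounded[OF t(1)] by blast
    then have "\<forall>x. v x t \<le> M" using t T' by (simp add: v_def)
    then show ?thesis by blast
  qed
  ultimately show thesis by (rule that)
qed

subsection \<open>The singular profile\<close>

text \<open>Beyond some \<open>R\<close> all values lie within \<open>e\<close> of the infimum, and
  \<open>{a..R + 1}\<close> is compact. Two points at distance less than \<open>1\<close> lie both
  in that interval or both beyond \<open>R\<close>.\<close>

lemma antimono_uniformly_continuous:
  fixes h :: "real \<Rightarrow> real"
  assumes c: "continuous_on {a..} h" and m: "\<And>x y. a \<le> x \<Longrightarrow> x \<le> y \<Longrightarrow> h y \<le> h x"
    and b: "\<And>x. a \<le> x \<Longrightarrow> 0 \<le> h x"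
  shows "uniformly_continuous_on {a..} h"
  unfolding uniformly_continuous_on_def
proof (intro allI impI)
  fix e :: real assume e: "e > 0"
  define l where "l = Inf (h ` {a..})"
  have bdd: "bdd_below (h ` {a..})" using b by (auto intro!: bdd_belowI[of _ 0])
  have "Inf (h ` {a..}) < l + e" using e by (simp add: l_def)
  then obtain R where R: "R \<ge> a" "h R < l + e"
    using cInf_lessD[of "h ` {a..}" "l + e"] by auto
  have l: "l \<le> h x" if "a \<le> x" for x unfolding l_def using that bdd by (intro cInf_lower) auto
  have "uniformly_continuous_on {a..R + 1} h"
    by (intro compact_uniformly_continuous continuous_on_subset[OF c]) auto
  then obtain d where d: "d > 0" "\<And>x x'. x \<in> {a..R + 1} \<Longrightarrow> x' \<in> {a..R + 1} \<Longrightarrow> dist x' x < d \<Longrightarrow> dist (h x') (h x) < e"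
    using e unfolding uniformly_continuous_on_def by metis
  have "dist (h x') (h x) < e" if x: "x \<in> {a..}" "x' \<in> {a..}" "dist x' x < min d 1" for x x'
  proof (cases "x \<le> R + 1 \<and> x' \<le> R + 1")
    case True
    then show ?thesis using x by (intro d(2)) auto
  next
    case False
    then have "R \<le> x" "R \<le> x'" using x by (auto simp: dist_real_def)
    then have "h x \<le> h R" "h x' \<le> h R" using R m by auto
    moreover have "l \<le> h x" "l \<le> h x'" using l x by auto
    ultimately show ?thesis using R(2) by (simp add: dist_real_def)
  qed
  then show "\<exists>d>0. \<forall>x\<in>{a..}. \<forall>x'\<in>{a..}. dist x' x < d \<longrightarrow> dist (h x') (h x) < e"
    using d(1) by (intro exI[of _ "min d 1"]) auto
qed

locale singular_profile =
  fixes n :: nat and N p :: real and u :: "real \<Rightarrow> real"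
  assumes n: "n \<ge> 3" and N: "N = real n" and p_def: "p = N / (N - 2)"
    and u: "singular_positive_solution N p u"
begin

lemma p_gt_1: "p > 1" using n by (simp add: p_def N)

lemma u_pos: "r > 0 \<Longrightarrow> 0 < u r" using u by (simp add: singular_positive_solution_def)

lemma u_deriv: "r > 0 \<Longrightarrow> (u has_real_derivative deriv u r) (at r)"
  using u by (simp add: singular_positive_solution_def C2_pos_def DERIV_deriv_iff_field_differentiable)

lemma u_deriv2: "r > 0 \<Longrightarrow> (deriv u has_real_derivative deriv (deriv u) r) (at r)"
  using u by (simp add: singular_positive_solution_def C2_pos_def DERIV_deriv_iff_field_differentiable)

lemma u_ode: "r > 0 \<Longrightarrow> deriv (deriv u) r + ((N - 1) / r + r / 2) * deriv u r + 1 / (p - 1) * u r + u r powr p = 0"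
  using u by (simp add: singular_positive_solution_def)

lemma u_at_top: "filterlim u at_top (at_right 0)"
  using u by (simp add: singular_positive_solution_def)

lemma continuous_on_u: "continuous_on {0<..} u"
  by (intro continuous_at_imp_continuous_on ballI DERIV_isCont[OF u_deriv]) auto

lemma continuous_on_deriv_u: "continuous_on {0<..} (deriv u)"
  by (intro continuous_at_imp_continuous_on ballI DERIV_isCont[OF u_deriv2]) auto

lemma continuous_on_deriv2_u: "continuous_on {0<..} (deriv (deriv u))"
  using u by (simp add: singular_positive_solution_def C2_pos_def)

text \<open>\<open>r ^ (n - 1) * exp (r\<^sup>2 / 4)\<close> is the integrating factor of the
  coefficient \<open>(N - 1) / r + r / 2\<close>; it puts the equation in divergence form.\<close>

definition flux :: "real \<Rightarrow> real" where
  "flux r = - (r ^ (n - 1) * exp (r\<^sup>2 / 4) * deriv u r)"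

definition flux_rate :: "real \<Rightarrow> real" where
  "flux_rate r = r ^ (n - 1) * exp (r\<^sup>2 / 4) * (1 / (p - 1) * u r + u r powr p)"

lemma flux_deriv:
  assumes r: "r > 0"
  shows "(flux has_real_derivative flux_rate r) (at r)"
proof -
  have pw: "real (n - 1) * r ^ (n - 1 - 1) = (N - 1) / r * r ^ (n - 1)"
    using r n by (cases "n - 1") (auto simp: N of_nat_diff)
  have 1: "((\<lambda>r. r ^ (n - 1)) has_real_derivative (N - 1) / r * r ^ (n - 1)) (at r)"
    using DERIV_pow[of "n - 1" r] pw by (simp add: mult.commute)
  have 2: "((\<lambda>r. exp (r\<^sup>2 / 4)) has_real_derivative r / 2 * exp (r\<^sup>2 / 4)) (at r)"
    by (auto intro!: derivative_eq_intros)
  have "(flux has_real_derivative - (((N - 1) / r * r ^ (n - 1) * exp (r\<^sup>2 / 4) + r / 2 * exp (r\<^sup>2 / 4) * r ^ (n - 1)) * deriv u r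
      + deriv (deriv u) r * (r ^ (n - 1) * exp (r\<^sup>2 / 4)))) (at r)"
    unfolding flux_def[abs_def] by (intro DERIV_minus DERIV_mult 1 2 u_deriv2 r)
  moreover have "- (((N - 1) / r * P * E + r / 2 * E * P) * D + D2 * (P * E)) = P * E * (A + B)"
    if "D2 + ((N - 1) / r + r / 2) * D + A + B = 0" for P E D D2 A B
  proof -
    have "- ((X * P * E + Y * E * P) * D + D2 * (P * E)) = P * E * (A + B)" if "D2 + (X + Y) * D + A + B = 0" for X Y
    proof -
      have "- ((X * P * E + Y * E * P) * D + D2 * (P * E)) = P * E * (A + B) - P * E * (D2 + (X + Y) * D + A + B)"
        by (simp add: algebra_simps)
      then show ?thesis using that by simp
    qed
    then show ?thesis using that by blast
  qed
  ultimately show ?thesis using u_ode[OF r] by (simp only: flux_rate_def)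
qed

lemma flux_rate_pos: "r > 0 \<Longrightarrow> 0 < flux_rate r"
  unfolding flux_rate_def using u_pos[of r] p_gt_1 by (intro mult_pos_pos add_pos_pos) auto

lemma flux_strict_mono: "0 < r \<Longrightarrow> r < s \<Longrightarrow> flux r < flux s"
proof (rule DERIV_pos_imp_increasing[of r s flux])
  fix x assume "0 < r" "r \<le> x"
  then have "0 < x" by simp
  then show "\<exists>y. (flux has_real_derivative y) (at x) \<and> 0 < y" using flux_deriv flux_rate_pos by blast
qed

text \<open>If the flux were nonpositive at \<open>r\<close>, then it would be negative on \<open>(0,r)\<close> and \<open>u\<close> would increase
  there, so \<open>u\<close> could not blow up at the origin.\<close>

lemma flux_pos:
  assumes r: "r > 0"
  shows "0 < flux r"
proof (rule ccontr)
  assume "\<not> 0 < flux r"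
  then have neg: "flux s < 0" if "0 < s" "s < r" for s using flux_strict_mono[OF that] by linarith
  have d: "0 < deriv u s" if "0 < s" "s < r" for s
  proof -
    have "0 < s ^ (n - 1) * exp (s\<^sup>2 / 4) * deriv u s" using neg[OF that] by (simp add: flux_def)
    then show ?thesis by (rule zero_less_mult_pos) (use that in simp)
  qed
  have le: "u s \<le> u (r / 2)" if s: "0 < s" "s \<le> r / 2" for s
  proof (rule DERIV_nonneg_imp_nondecreasing[OF s(2)])
    fix x assume "s \<le> x" "x \<le> r / 2"
    then have "0 < x" "x < r" using s r by auto
    then show "\<exists>y. (u has_real_derivative y) (at x) \<and> 0 \<le> y" using u_deriv[of x] d[of x] less_imp_le by blast
  qed
  have "\<forall>\<^sub>F s in at_right 0. u s > u (r / 2)" using u_at_top by (simp add: filterlim_at_top_dense)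
  then obtain b where b: "b > 0" "\<And>s. 0 < s \<Longrightarrow> s < b \<Longrightarrow> u s > u (r / 2)"
    by (auto simp: eventually_at_right_field)
  define s where "s = min (b / 2) (r / 2)"
  have "0 < s" "s < b" "s \<le> r / 2" using b(1) r by (auto simp: s_def)
  then show False using b(2)[of s] le[of s] by simp
qed

lemma u_antimono:
  assumes "0 < r" "r \<le> s"
  shows "u s \<le> u r"
proof (rule DERIV_nonpos_imp_nonincreasing[OF assms(2)])
  fix x assume "r \<le> x" "x \<le> s"
  then have x: "0 < x" using assms by simp
  then have "deriv u x \<le> 0" using flux_pos[OF x] by (auto simp: flux_def mult_less_0_iff)
  then show "\<exists>y. (u has_real_derivative y) (at x) \<and> y \<le> 0" using u_deriv[OF x] by blast
qed

text \<open>The mean value theorem on \<open>{R / 2..R}\<close>: at the intermediate point the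
  radius is at least \<open>R / 2\<close> and \<open>u\<close> is at least \<open>u R\<close>, while
  the exponential is at least \<open>1\<close> and the linear term is nonnegative.\<close>

lemma shell_le_flux:
  assumes R: "R > 0"
  shows "(R / 2) ^ n * u R powr p \<le> flux R - flux (R / 2)"
proof -
  have "\<exists>z. R / 2 < z \<and> z < R \<and> flux R - flux (R / 2) = (R - R / 2) * flux_rate z"
    by (rule MVT2[of "R / 2" R flux flux_rate]) (use R flux_deriv in auto)
  then obtain z where z: "R / 2 < z" "z < R" "flux R - flux (R / 2) = (R / 2) * flux_rate z" by auto
  have "(R / 2) ^ (n - 1) * 1 * u R powr p \<le> z ^ (n - 1) * exp (z\<^sup>2 / 4) * (1 / (p - 1) * u z + u z powr p)"
  proof (intro mult_mono power_mono)
    have "u R \<le> u z" using z R by (intro u_antimono) auto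
    then have "u R powr p \<le> u z powr p" using u_pos[OF R] p_gt_1 by (intro powr_mono2) auto
    moreover have "0 \<le> 1 / (p - 1) * u z" using u_pos[of z] z R p_gt_1 by simp
    ultimately show "u R powr p \<le> 1 / (p - 1) * u z + u z powr p" by linarith
  qed (use z R in auto)
  then have "(R / 2) * ((R / 2) ^ (n - 1) * u R powr p) \<le> (R / 2) * flux_rate z"
    unfolding flux_rate_def using R by (intro mult_left_mono) auto
  moreover have "(R / 2) * (R / 2) ^ (n - 1) = (R / 2) ^ n" using n by (cases n) auto
  ultimately show ?thesis using z(3) by (simp add: mult.assoc[symmetric])
qed

end

text \<open>The phantom argument fixes the type of the points of the space, on which \<open>N\<close>, \<open>p\<close> and \<open>u\<close> do not depend.\<close>

locale singular_profile_space = singular_profile "CARD('n)" N p u for N p u and dummy :: "'n::finite itself"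
begin

text \<open>On a dyadic shell \<open>u\<close> is at most its value at the inner radius. Applied at
  that radius, \<open>shell_le_flux\<close> bounds the contribution by the flux increment over the
  next shell inwards. The increments telescope, and positivity of the flux bounds their sum.\<close>

lemma radial_powr_finite:
  assumes c: "c > 0"
  shows "(\<integral>\<^sup>+x. ennreal (u (c * norm x) powr p) * indicator (ball 0 (1 / c) - {0}) (x :: real ^ 'n) \<partial>lborel) < \<infinity>"
proof -
  let ?n = "CARD('n)"
  define R where "R k = (1/2 :: real) ^ k" for k :: nat
  have R0: "R k > 0" and RS: "R (Suc k) = R k / 2" for k by (auto simp: R_def)
  define \<omega> where "\<omega> = unit_ball_vol (real ?n)"
  have \<omega>: "\<omega> \<ge> 0" by (simp add: \<omega>_def)
  have ball: "emeasure lborel (ball (0 :: real ^ 'n) (R k / c)) = ennreal (\<omega> * (R k / c) ^ ?n)" for k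
    using R0[of k] c by (simp add: emeasure_ball \<omega>_def)
  define C where "C k = u (R (Suc k)) powr p" for k
  \<comment> \<open>The factor 4 compares the radius \<open>R k\<close> with
    \<open>R (Suc k) / 2\<close>, the radius in the flux estimate at
    \<open>R (Suc k)\<close>.\<close>
  define L where "L = \<omega> * (4 / c) ^ ?n"
  have L: "L \<ge> 0" using \<omega> c by (simp add: L_def)
  have "(\<integral>\<^sup>+x. ennreal (u (c * norm x) powr p) * indicator (ball 0 (1 / c) - {0}) (x :: real ^ 'n) \<partial>lborel)
     \<le> (\<integral>\<^sup>+x. (\<Sum>k. ennreal (C k) * indicator (ball 0 (R k / c)) (x :: real ^ 'n)) \<partial>lborel)"
  proof (rule nn_integral_mono)
    fix x :: "real ^ 'n"
    show "ennreal (u (c * norm x) powr p) * indicator (ball 0 (1 / c) - {0}) x \<le> (\<Sum>k. ennreal (C k) * indicator (ball 0 (R k / c)) x)"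
    proof (cases "x \<in> ball 0 (1 / c) - {0}")
      case True
      then have x: "0 < c * norm x" "c * norm x < 1" using c by (auto simp: field_simps)
      have "\<exists>k. R k < c * norm x" unfolding R_def using x by (intro real_arch_pow_inv) auto
      then have ex: "\<exists>k. R k \<le> c * norm x" by (auto intro: less_imp_le)
      \<comment> \<open>The first dyadic radius not exceeding the scaled norm. It is not
        \<open>R 0 = 1\<close>, so its predecessor is the outer radius of the shell.\<close>
      define j where "j = (LEAST k. R k \<le> c * norm x)"
      have j: "R j \<le> c * norm x" unfolding j_def using ex by (rule LeastI_ex)
      have "R 0 = 1" by (simp add: R_def)
      then have "j \<noteq> 0" using j x by (metis not_le)
      then obtain k where k: "j = Suc k" by (cases j) auto
      have "\<not> R k \<le> c * norm x" unfolding j_def using k j_def not_less_Least[of k "\<lambda>k. R k \<le> c * norm x"] by simp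
      then have xk: "x \<in> ball 0 (R k / c)" using c by (simp add: field_simps)
      have "u (c * norm x) \<le> u (R (Suc k))" using j k R0 by (intro u_antimono) auto
      then have "ennreal (u (c * norm x) powr p) \<le> ennreal (C k)"
        unfolding C_def using u_pos[OF x(1)] p_gt_1 by (intro ennreal_leI powr_mono2) auto
      also have "\<dots> = (\<Sum>k\<in>{k}. ennreal (C k) * indicator (ball 0 (R k / c)) x)" using xk by simp
      also have "\<dots> \<le> (\<Sum>k. ennreal (C k) * indicator (ball 0 (R k / c)) x)" by (rule sum_le_suminf) auto
      finally show ?thesis using True by simp
    qed simp
  qed
  also have "\<dots> = (\<Sum>k. \<integral>\<^sup>+x. ennreal (C k) * indicator (ball 0 (R k / c)) (x :: real ^ 'n) \<partial>lborel)"
  proof (rule nn_integral_suminf)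
    fix k
    have [measurable]: "(indicator (ball 0 (R k / c)) :: real ^ 'n \<Rightarrow> ennreal) \<in> borel_measurable borel"
      by (intro borel_measurable_indicator) simp
    show "(\<lambda>x :: real ^ 'n. ennreal (C k) * indicator (ball 0 (R k / c)) x) \<in> borel_measurable lborel" by measurable
  qed
  also have "\<dots> = (\<Sum>k. ennreal (C k * (\<omega> * (R k / c) ^ ?n)))"
  proof (rule suminf_cong)
    fix k
    have "(\<integral>\<^sup>+x. ennreal (C k) * indicator (ball 0 (R k / c)) (x :: real ^ 'n) \<partial>lborel) = ennreal (C k) * ennreal (\<omega> * (R k / c) ^ ?n)"
      by (simp add: nn_integral_cmult_indicator ball)
    then show "(\<integral>\<^sup>+x. ennreal (C k) * indicator (ball 0 (R k / c)) (x :: real ^ 'n) \<partial>lborel) = ennreal (C k * (\<omega> * (R k / c) ^ ?n))"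
      by (simp add: ennreal_mult' C_def)
  qed
  also have "\<dots> \<le> ennreal (L * flux (R 1))"
  proof (rule suminf_le_const)
    fix K
    have shell: "C k * (\<omega> * (R k / c) ^ ?n) \<le> L * (flux (R (Suc k)) - flux (R (Suc (Suc k))))" for k
    proof -
      have "R k / c = 4 / c * (R (Suc k) / 2)" by (simp add: RS)
      then have "(R k / c) ^ ?n = (4 / c) ^ ?n * (R (Suc k) / 2) ^ ?n" by (simp only: power_mult_distrib)
      then have "C k * (\<omega> * (R k / c) ^ ?n) = L * ((R (Suc k) / 2) ^ ?n * u (R (Suc k)) powr p)"
        by (simp add: C_def L_def)
      also have "\<dots> \<le> L * (flux (R (Suc k)) - flux (R (Suc k) / 2))"
        by (intro mult_left_mono shell_le_flux R0 L)
      finally show ?thesis by (simp add: RS)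
    qed
    have "(\<Sum>k<K. ennreal (C k * (\<omega> * (R k / c) ^ ?n))) = ennreal (\<Sum>k<K. C k * (\<omega> * (R k / c) ^ ?n))"
      by (rule sum_ennreal)
        (intro mult_nonneg_nonneg zero_le_power divide_nonneg_nonneg \<omega> less_imp_le[OF R0] less_imp_le[OF c], simp add: C_def)
    also have "\<dots> \<le> ennreal (\<Sum>k<K. L * (flux (R (Suc k)) - flux (R (Suc (Suc k)))))"
      by (intro ennreal_leI sum_mono shell)
    also have "(\<Sum>k<K. L * (flux (R (Suc k)) - flux (R (Suc (Suc k))))) = L * (flux (R 1) - flux (R (Suc K)))"
      unfolding sum_distrib_left[symmetric] using sum_lessThan_telescope'[of "\<lambda>k. flux (R (Suc k))" K] by simp
    also have "ennreal \<dots> \<le> ennreal (L * flux (R 1))"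
      using flux_pos[OF R0[of "Suc K"]] L by (intro ennreal_leI mult_left_mono) auto
    finally show "(\<Sum>k<K. ennreal (C k * (\<omega> * (R k / c) ^ ?n))) \<le> ennreal (L * flux (R 1))" .
  qed simp
  also have "\<dots> < \<infinity>" by simp
  finally show ?thesis .
qed

section \<open>Rescaled radial profiles\<close>

context
  fixes a c :: real and f :: "real ^ 'n \<Rightarrow> real"
  assumes a: "a > 0" and c: "c > 0" and f: "\<And>x. x \<noteq> 0 \<Longrightarrow> f x = a * u (c * norm x)"
begin

lemma radial_continuous: "continuous_on (- {0}) f"
proof -
  have "continuous_on (- {0}) (\<lambda>x :: real ^ 'n. a * u (c * norm x))"
    by (intro continuous_intros continuous_on_compose2[OF continuous_on_u]) (use c in \<open>auto simp: zero_less_mult_iff\<close>)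
  then show ?thesis by (rule continuous_on_cong[THEN iffD1, rotated 2]) (auto simp: f)
qed

lemma radial_measurable: "f \<in> borel_measurable borel"
  by (rule borel_measurable_continuous_countable_exceptions[OF _ radial_continuous]) simp

lemma radial_pos: "x \<noteq> 0 \<Longrightarrow> 0 < f x"
  using a c u_pos[of "c * norm x"] by (simp add: f)

lemma AE_nonzero: "AE x in (lborel :: (real ^ 'n) measure). x \<noteq> 0"
  by (rule AE_lborel_singleton)

text \<open>Outside the ball of radius \<open>1 / c\<close> the power \<open>f x powr p\<close> is
  at most \<open>M0\<close>, so the parts above \<open>M0 + real j\<close> live inside it. There
  \<open>radial_powr_finite\<close> gives a dominating function, and the parts tend to
  \<open>0\<close> pointwise.\<close>

lemma radial_tail:
  assumes e: "e > 0"
  shows "\<exists>M\<ge>0. (\<integral>\<^sup>+x. ennreal (f x powr p - M) \<partial>lborel) \<le> ennreal e"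
proof -
  define M0 where "M0 = (a * u 1) powr p"
  let ?w = "\<lambda>x :: real ^ 'n. ennreal (a powr p) * (ennreal (u (c * norm x) powr p) * indicator (ball 0 (1 / c) - {0}) x)"
  have um: "(\<lambda>x :: real ^ 'n. u (c * norm x)) \<in> borel_measurable borel"
  proof (rule borel_measurable_continuous_countable_exceptions[of "{0}"])
    show "continuous_on (- {0}) (\<lambda>x :: real ^ 'n. u (c * norm x))"
      by (intro continuous_intros continuous_on_compose2[OF continuous_on_u]) (use c in \<open>auto simp: zero_less_mult_iff\<close>)
  qed simp
  have [measurable]: "(indicator (ball 0 (1 / c) - {0}) :: real ^ 'n \<Rightarrow> ennreal) \<in> borel_measurable borel"
    by (intro borel_measurable_indicator) simp
  note [measurable] = um radial_measurable
  have "(\<lambda>j. \<integral>\<^sup>+x. ennreal (f x powr p - (M0 + real j)) \<partial>lborel) \<longlonglongrightarrow> (\<integral>\<^sup>+x. 0 \<partial>(lborel :: (real ^ 'n) measure))"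
  proof (rule nn_integral_dominated_convergence[where w = ?w])
    show "(\<integral>\<^sup>+x. ?w x \<partial>lborel) < \<infinity>"
    proof -
      have "(\<integral>\<^sup>+x. ?w x \<partial>lborel) = ennreal (a powr p) *
          (\<integral>\<^sup>+x. ennreal (u (c * norm x) powr p) * indicator (ball 0 (1 / c) - {0}) (x :: real ^ 'n) \<partial>lborel)"
        by (rule nn_integral_cmult) measurable
      then show ?thesis using radial_powr_finite[OF c] by (simp add: ennreal_mult_less_top)
    qed
    show "AE x in lborel. ennreal (f x powr p - (M0 + real j)) \<le> ?w x" for j
      using AE_nonzero
    proof eventually_elim
      case (elim x)
      then have fx: "f x powr p = a powr p * u (c * norm x) powr p"
        using a c u_pos[of "c * norm x"] by (simp add: f powr_mult)
      show ?case
      proof (cases "x \<in> ball 0 (1 / c)")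
        case True
        have "0 \<le> M0" by (simp add: M0_def)
        then have "ennreal (f x powr p - (M0 + real j)) \<le> ennreal (f x powr p)" by (intro ennreal_leI) linarith
        then show ?thesis using True elim by (simp add: fx ennreal_mult)
      next
        case False
        then have "1 \<le> c * norm x" using c by (simp add: field_simps)
        then have "f x \<le> a * u 1" using a elim u_antimono[of 1 "c * norm x"] by (simp add: f)
        then have "f x powr p \<le> M0" unfolding M0_def using radial_pos[OF elim] p_gt_1 by (intro powr_mono2) auto
        then show ?thesis by (simp add: ennreal_neg)
      qed
    qed
    show "AE x in lborel. (\<lambda>j. ennreal (f x powr p - (M0 + real j))) \<longlonglongrightarrow> 0"
    proof (rule AE_I2)
      fix x
      obtain J where J: "f x powr p \<le> real J" using real_arch_simple by blast
      have "\<forall>\<^sub>F j in sequentially. 0 = ennreal (f x powr p - (M0 + real j))"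
        using eventually_ge_at_top[of J]
      proof eventually_elim
        case (elim j)
        have "0 \<le> M0" by (simp add: M0_def)
        then have "f x powr p - (M0 + real j) \<le> 0" using J elim by linarith
        then show ?case by (simp add: ennreal_neg)
      qed
      then show "(\<lambda>j. ennreal (f x powr p - (M0 + real j))) \<longlonglongrightarrow> 0" by (rule Lim_transform_eventually[OF tendsto_const])
    qed
  qed measurable
  then have "(\<lambda>j. \<integral>\<^sup>+x. ennreal (f x powr p - (M0 + real j)) \<partial>lborel) \<longlonglongrightarrow> 0" by simp
  then have "\<forall>\<^sub>F j in sequentially. (\<integral>\<^sup>+x. ennreal (f x powr p - (M0 + real j)) \<partial>lborel) < ennreal e"
    by (rule order_tendstoD) (use e in simp)
  then obtain j where "(\<integral>\<^sup>+x. ennreal (f x powr p - (M0 + real j)) \<partial>lborel) < ennreal e"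
    by (auto simp: eventually_sequentially)
  moreover have "0 \<le> M0 + real j" by (simp add: M0_def)
  ultimately show ?thesis by (auto intro: less_imp_le)
qed

text \<open>Below a radius \<open>r0\<close> with \<open>a * u r0 \<ge> k\<close> the truncation is
  constant, so the radial variable can be frozen at \<open>r0\<close>. On \<open>{r0..}\<close> the
  decreasing positive \<open>u\<close> is uniformly continuous.\<close>

lemma radial_truncation:
  assumes k: "k > 0"
  shows "\<exists>B. uniformly_continuous_on UNIV B \<and> (\<forall>x. 0 \<le> B x \<and> B x \<le> k) \<and> (AE x in lborel. B x = min (f x) k)"
proof -
  have "\<forall>\<^sub>F r in at_right 0. k / a \<le> u r" using u_at_top by (simp add: filterlim_at_top)
  then obtain b where b: "b > 0" "\<And>r. 0 < r \<Longrightarrow> r < b \<Longrightarrow> k / a \<le> u r" by (auto simp: eventually_at_right_field)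
  define r0 where "r0 = b / 2"
  have r0: "r0 > 0" "k \<le> a * u r0" using b b(2)[of r0] a by (auto simp: r0_def field_simps)
  define B where "B x = min (a * u (max (c * norm x) r0)) k" for x :: "real ^ 'n"
  have uc: "uniformly_continuous_on {r0..} u"
  proof (rule antimono_uniformly_continuous)
    show "continuous_on {r0..} u" by (rule continuous_on_subset[OF continuous_on_u]) (use r0 in auto)
    show "u y \<le> u x" if "r0 \<le> x" "x \<le> y" for x y using that r0 by (intro u_antimono) auto
    show "0 \<le> u x" if "r0 \<le> x" for x using u_pos[of x] that r0 by simp
  qed
  have "uniformly_continuous_on UNIV B" unfolding uniformly_continuous_on_def
  proof (intro allI impI)
    fix e :: real assume e: "e > 0"
    obtain d where d: "d > 0" "\<And>x x'. x \<in> {r0..} \<Longrightarrow> x' \<in> {r0..} \<Longrightarrow> dist x' x < d \<Longrightarrow> dist (u x') (u x) < e / a"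
      using uc e a unfolding uniformly_continuous_on_def by (metis divide_pos_pos)
    have "dist (B x') (B x) < e" if "dist x' x < d / c" for x x' :: "real ^ 'n"
    proof -
      have "\<bar>norm x' - norm x\<bar> < d / c" using that norm_triangle_ineq3[of x' x] by (simp add: dist_norm)
      then have "c * \<bar>norm x' - norm x\<bar> < d" using c by (simp add: field_simps)
      then have "\<bar>c * norm x' - c * norm x\<bar> < d" using c by (simp add: abs_mult right_diff_distrib[symmetric])
      then have "dist (max (c * norm x') r0) (max (c * norm x) r0) < d" unfolding dist_real_def by (auto simp: max_def abs_if split: if_splits)
      then have "dist (u (max (c * norm x') r0)) (u (max (c * norm x) r0)) < e / a" by (intro d(2)) auto
      then have "a * \<bar>u (max (c * norm x') r0) - u (max (c * norm x) r0)\<bar> < e" using a by (simp add: dist_real_def field_simps)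
      then have "\<bar>a * u (max (c * norm x') r0) - a * u (max (c * norm x) r0)\<bar> < e"
        using a by (simp add: abs_mult right_diff_distrib[symmetric])
      then show ?thesis unfolding B_def dist_real_def by (auto simp: min_def abs_if split: if_splits)
    qed
    moreover have "d / c > 0" using d c by simp
    ultimately show "\<exists>d>0. \<forall>x\<in>UNIV. \<forall>x'\<in>UNIV. dist x' x < d \<longrightarrow> dist (B x') (B x) < e" by blast
  qed
  moreover have "0 \<le> B x \<and> B x \<le> k" for x
    using k a u_pos[of "max (c * norm x) r0"] r0 by (simp add: B_def less_max_iff_disj)
  moreover have "AE x in lborel. B x = min (f x) k"
    using AE_nonzero
  proof eventually_elim
    case (elim x)
    show ?case
    proof (cases "c * norm x \<ge> r0")
      case False
      then have "a * u r0 \<le> a * u (c * norm x)" using a elim c by (intro mult_left_mono u_antimono) auto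
      moreover have "max (c * norm x) r0 = r0" using False by simp
      ultimately have "B x = k" "min (f x) k = k" using r0 elim by (auto simp: B_def f min_def)
      then show ?thesis by simp
    qed (use elim in \<open>simp add: B_def f max_def\<close>)
  qed
  ultimately show ?thesis by blast
qed

end

end

subsection \<open>The self-similar singular solution\<close>

lemma norm_axis_derivative:
  fixes x :: "real ^ 'n"
  assumes x: "x \<noteq> 0"
  shows "((\<lambda>h. norm (x + h *\<^sub>R axis i 1)) has_real_derivative x $ i / norm x) (at 0)"
proof -
  have n: "norm (x + h *\<^sub>R axis i 1) = sqrt ((norm x)\<^sup>2 + 2 * h * (x $ i) + h\<^sup>2)" for h
  proof -
    have "(norm (x + h *\<^sub>R axis i 1))\<^sup>2 = (norm x)\<^sup>2 + 2 * h * (x $ i) + h\<^sup>2"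
    proof -
      have "x \<bullet> axis i 1 = x $ i" "axis i 1 \<bullet> x = x $ i" "axis i (1::real) \<bullet> axis i 1 = 1"
        by (simp_all add: inner_axis inner_axis' inner_axis_axis)
      then show ?thesis
        unfolding power2_norm_eq_inner by (simp add: inner_add_left inner_add_right power2_eq_square algebra_simps)
    qed
    then show ?thesis by (metis norm_ge_zero real_sqrt_unique)
  qed
  show ?thesis unfolding n using x by (auto intro!: derivative_eq_intros simp: field_simps)
qed

context singular_profile_space
begin

text \<open>\<open>wt\<close>, \<open>w1\<close> and \<open>w2\<close> are the derivatives of
  \<open>wstar\<close> in time, in direction \<open>i\<close>, and in direction \<open>i\<close>
  followed by \<open>j\<close>, by the chain rule through the similarity variable
  \<open>norm x / sqrt t\<close>.\<close>

definition wt :: "real ^ 'n \<Rightarrow> real \<Rightarrow> real" where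
  "wt x t = t powr (- 1 / (p - 1)) / t * (- 1 / (p - 1) * u (norm x / sqrt t) - (norm x / sqrt t) / 2 * deriv u (norm x / sqrt t))"

definition w1 :: "'n \<Rightarrow> real ^ 'n \<Rightarrow> real \<Rightarrow> real" where
  "w1 i x t = t powr (- 1 / (p - 1)) * (deriv u (norm x / sqrt t) * (x $ i / (norm x * sqrt t)))"

definition w2 :: "'n \<Rightarrow> 'n \<Rightarrow> real ^ 'n \<Rightarrow> real \<Rightarrow> real" where
  "w2 j i x t = t powr (- 1 / (p - 1)) *
     (deriv (deriv u) (norm x / sqrt t) * (x $ j / (norm x * sqrt t)) * (x $ i / (norm x * sqrt t))
      + deriv u (norm x / sqrt t) * ((axis j 1 $ i * norm x - x $ i * (x $ j / norm x)) / (norm x)\<^sup>2 / sqrt t))"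

lemma wstar_time_derivative:
  assumes x: "x \<noteq> 0" and t: "t > 0"
  shows "(wstar p u x has_real_derivative wt x t) (at t)"
proof -
  have 1: "((\<lambda>t. t powr (- 1 / (p - 1))) has_real_derivative (- 1 / (p - 1)) * (t powr (- 1 / (p - 1)) / t)) (at t)"
    using t DERIV_powr[OF DERIV_ident t DERIV_const, of "- 1 / (p - 1)"] by (auto intro!: derivative_eq_intros simp: powr_diff)
  have 2: "((\<lambda>t. norm x / sqrt t) has_real_derivative - (norm x / sqrt t) / (2 * t)) (at t)"
    using t by (auto intro!: derivative_eq_intros simp: field_simps)
  have "norm x / sqrt t > 0" using x t by simp
  from DERIV_mult[OF 1 DERIV_chain2[OF u_deriv[OF this] 2]]
  show ?thesis unfolding wstar_def[abs_def]
  proof (rule DERIV_cong)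
    have "c * (A / t) * U + D * (- r / (2 * t)) * A = A / t * (c * U - r / 2 * D)" for c A U D r
      using t by (simp add: field_simps)
    then show "- 1 / (p - 1) * (t powr (- 1 / (p - 1)) / t) * u (norm x / sqrt t) +
        deriv u (norm x / sqrt t) * (- (norm x / sqrt t) / (2 * t)) * t powr (- 1 / (p - 1)) = wt x t"
      unfolding wt_def by blast
  qed
qed

lemma radius_derivative:
  fixes x :: "real ^ 'n"
  assumes x: "x \<noteq> 0" and t: "t > 0"
  shows "((\<lambda>h. norm (x + h *\<^sub>R axis i 1) / sqrt t) has_real_derivative x $ i / (norm x * sqrt t)) (at 0)"
  using DERIV_cdivide[OF norm_axis_derivative[OF x, of i], of "sqrt t"] by simp

lemma wstar_space_derivative:
  fixes x :: "real ^ 'n"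
  assumes x: "x \<noteq> 0" and t: "t > 0"
  shows "((\<lambda>h. wstar p u (x + h *\<^sub>R axis i 1) t) has_real_derivative w1 i x t) (at 0)"
proof -
  have "norm (x + 0 *\<^sub>R axis i 1) / sqrt t > 0" using x t by simp
  from DERIV_cmult[OF DERIV_chain2[OF u_deriv[OF this] radius_derivative[OF x t]]]
  show ?thesis unfolding wstar_def w1_def by simp
qed

lemma w1_space_derivative:
  fixes x :: "real ^ 'n"
  assumes x: "x \<noteq> 0" and t: "t > 0"
  shows "((\<lambda>h. w1 i (x + h *\<^sub>R axis j 1) t) has_real_derivative w2 j i x t) (at 0)"
proof -
  have pos: "norm (x + 0 *\<^sub>R axis j 1) / sqrt t > 0" using x t by simp
  have 1: "((\<lambda>h. deriv u (norm (x + h *\<^sub>R axis j 1) / sqrt t)) has_real_derivative deriv (deriv u) (norm x / sqrt t) * (x $ j / (norm x * sqrt t))) (at 0)"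
    using DERIV_chain2[OF u_deriv2[OF pos] radius_derivative[OF x t]] by simp
  have c: "((\<lambda>h. (x + h *\<^sub>R axis j 1) $ i) has_real_derivative axis j 1 $ i) (at 0)"
    by (auto intro!: derivative_eq_intros)
  have 2: "((\<lambda>h. (x + h *\<^sub>R axis j 1) $ i / (norm (x + h *\<^sub>R axis j 1) * sqrt t)) has_real_derivative
      (axis j 1 $ i * norm x - x $ i * (x $ j / norm x)) / (norm x)\<^sup>2 / sqrt t) (at 0)"
  proof -
    have "((\<lambda>h. (x + h *\<^sub>R axis j 1) $ i / norm (x + h *\<^sub>R axis j 1)) has_real_derivative
      (axis j 1 $ i * norm (x + 0 *\<^sub>R axis j 1) - (x + 0 *\<^sub>R axis j 1) $ i * (x $ j / norm x)) / (norm (x + 0 *\<^sub>R axis j 1) * norm (x + 0 *\<^sub>R axis j 1))) (at 0)"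
      by (rule DERIV_divide[OF c norm_axis_derivative[OF x]]) (use x in simp)
    from DERIV_cdivide[OF this, of "sqrt t"] show ?thesis
      by (simp add: power2_eq_square)
  qed
  from DERIV_cmult[OF DERIV_mult[OF 1 2], of "t powr (- 1 / (p - 1))"]
  show ?thesis unfolding w1_def w2_def by (rule DERIV_cong) (simp add: algebra_simps)
qed

text \<open>Since \<open>\<alpha> * p = \<alpha> + 1\<close>, every term carries the factor
  \<open>t powr (- \<alpha>) / t\<close>. What remains is the profile equation at
  \<open>r = norm x / sqrt t\<close>.\<close>

lemma wstar_pde:
  fixes x :: "real ^ 'n"
  assumes x: "x \<noteq> 0" and t: "t > 0"
  shows "wt x t = (\<Sum>i\<in>UNIV. w2 i i x t) + wstar p u x t powr p"
proof -
  define r where "r = norm x / sqrt t"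
  define \<alpha> where "\<alpha> = 1 / (p - 1)"
  have r: "r > 0" using x t by (simp add: r_def)
  have nx: "norm x > 0" using x by simp
  have sq: "(\<Sum>i\<in>UNIV. x $ i * x $ i) = (norm x)\<^sup>2" by (simp add: power2_norm_eq_inner inner_vec_def)
  have st: "sqrt t * sqrt t = t" "sqrt t > 0" using t by auto
  have rt: "r * t = norm x * sqrt t" unfolding r_def using st by (simp add: field_simps)
  have "(\<Sum>i\<in>UNIV. w2 i i x t) = t powr (- \<alpha>) * (deriv (deriv u) r * ((\<Sum>i\<in>UNIV. x $ i * x $ i) / ((norm x)\<^sup>2 * t))
      + deriv u r * ((real CARD('n) * norm x - (\<Sum>i\<in>UNIV. x $ i * x $ i) / norm x) / (norm x)\<^sup>2 / sqrt t))"
  proof -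
    have "w2 i i x t = t powr (- \<alpha>) * (deriv (deriv u) r * ((x $ i * x $ i) / ((norm x)\<^sup>2 * t))
      + deriv u r * ((norm x - (x $ i * x $ i) / norm x) / (norm x)\<^sup>2 / sqrt t))" for i
      unfolding w2_def r_def[symmetric] \<alpha>_def using st by (simp add: power2_eq_square mult_ac axis_nth)
    then show ?thesis
      by (simp only: sum_distrib_left[symmetric] sum.distrib sum_divide_distrib[symmetric] sum_subtractf sum_constant)
  qed
  also have "\<dots> = t powr (- \<alpha>) * (deriv (deriv u) r / t + deriv u r * ((N - 1) / (norm x * sqrt t)))"
    unfolding sq using nx t by (simp add: N power2_eq_square field_simps)
  also have "\<dots> = t powr (- \<alpha>) / t * (deriv (deriv u) r + (N - 1) / r * deriv u r)"
    unfolding rt[symmetric] using r t by (simp add: field_simps)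
  finally have lap: "(\<Sum>i\<in>UNIV. w2 i i x t) = t powr (- \<alpha>) / t * (deriv (deriv u) r + (N - 1) / r * deriv u r)" .
  have "wstar p u x t powr p = t powr (- \<alpha> * p) * u r powr p"
    unfolding wstar_def r_def[symmetric] \<alpha>_def using u_pos[OF r] by (simp add: powr_mult powr_powr)
  also have "t powr (- \<alpha> * p) = t powr (- \<alpha>) / t"
  proof -
    have "- \<alpha> * p = - \<alpha> - 1" using p_gt_1 by (simp add: \<alpha>_def field_simps)
    then show ?thesis using t by (simp only: powr_diff) simp
  qed
  finally have pw: "wstar p u x t powr p = t powr (- \<alpha>) / t * u r powr p" .
  have "- \<alpha> * u r - r / 2 * deriv u r = (deriv (deriv u) r + (N - 1) / r * deriv u r) + u r powr p"
    using u_ode[OF r] unfolding \<alpha>_def[symmetric] by (simp add: distrib_right)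
  moreover have "wt x t = t powr (- \<alpha>) / t * (- \<alpha> * u r - r / 2 * deriv u r)"
    by (simp add: wt_def r_def \<alpha>_def)
  ultimately show ?thesis unfolding lap pw by (simp only: distrib_left)
qed

lemma wstar_classical:
  assumes t0: "t0 > 0"
  shows "classical_solution_on p (- {0}) {0<..<T} (\<lambda>(x :: real ^ 'n) t. wstar p u x (t + t0))"
proof (rule classical_solution_onI[where ?wt = "\<lambda>x t. wt x (t + t0)" and ?w1.0 = "\<lambda>i x t. w1 i x (t + t0)" and ?w2.0 = "\<lambda>j i x t. w2 j i x (t + t0)"])
  show "open (- {0 :: real ^ 'n})" by (intro open_Compl closed_singleton)
  let ?S = "(- {0 :: real ^ 'n}) \<times> {0<..<T}"
  have pos: "norm (fst q) / sqrt (snd q + t0) > 0" "snd q + t0 > 0" if "q \<in> ?S" for q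
  proof -
    have "0 < norm (fst q)" using that by auto
    moreover show "snd q + t0 > 0" using that t0 by auto
    ultimately show "norm (fst q) / sqrt (snd q + t0) > 0" by simp
  qed
  have comp: "continuous_on ?S (\<lambda>q. h (norm (fst q) / sqrt (snd q + t0)))" if "continuous_on {0<..} h" for h :: "real \<Rightarrow> real"
  proof (rule continuous_on_compose2[OF that])
    show "continuous_on ?S (\<lambda>q. norm (fst q) / sqrt (snd q + t0))"
      using t0 by (intro continuous_intros) auto
  qed (use pos in auto)
  note cs = comp[OF continuous_on_u] comp[OF continuous_on_deriv_u] comp[OF continuous_on_deriv2_u]
  have pw: "continuous_on ?S (\<lambda>q. (snd q + t0) powr (- 1 / (p - 1)))"
    using t0 by (intro continuous_intros) auto
  show "continuous_on ?S (\<lambda>(x, t). wstar p u x (t + t0))"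
    unfolding wstar_def case_prod_unfold by (intro continuous_intros pw cs)
  show "continuous_on ?S (\<lambda>(x, t). wt x (t + t0))"
    unfolding wt_def case_prod_unfold by (intro continuous_intros pw cs) (use t0 in auto)
  show "continuous_on ?S (\<lambda>(x, t). w1 i x (t + t0))" for i
    unfolding w1_def case_prod_unfold by (intro continuous_intros pw cs) (use t0 in auto)
  show "continuous_on ?S (\<lambda>(x, t). w2 j i x (t + t0))" for i j
    unfolding w2_def case_prod_unfold by (intro continuous_intros pw cs) (use t0 in auto)
  fix x :: "real ^ 'n" and t assume xt: "x \<in> - {0}" "t \<in> {0<..<T}"
  show "((\<lambda>t. wstar p u x (t + t0)) has_real_derivative wt x (t + t0)) (at t)"
    by (rule DERIV_shift[THEN iffD1], rule wstar_time_derivative) (use xt t0 in auto)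
  show "((\<lambda>h. wstar p u (x + h *\<^sub>R axis i 1) (t + t0)) has_real_derivative w1 i x (t + t0)) (at 0)" for i
    by (rule wstar_space_derivative) (use xt t0 in auto)
  show "((\<lambda>h. w1 i (x + h *\<^sub>R axis j 1) (t + t0)) has_real_derivative w2 j i x (t + t0)) (at 0)" for i j
    by (rule w1_space_derivative) (use xt t0 in auto)
  show "wt x (t + t0) = (\<Sum>i\<in>UNIV. w2 i i x (t + t0)) + wstar p u x (t + t0) powr p"
    by (rule wstar_pde) (use xt t0 in auto)
qed

lemma wstar_pos: "t > 0 \<Longrightarrow> x \<noteq> 0 \<Longrightarrow> 0 < wstar p u x t"
  unfolding wstar_def using u_pos[of "norm x / sqrt t"] by simp

lemma wstar_at_top:
  assumes t: "t > 0"
  shows "filterlim (\<lambda>x :: real ^ 'n. wstar p u x t) at_top (at 0)"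
proof -
  have "((\<lambda>x :: real ^ 'n. norm x / sqrt t) \<longlongrightarrow> norm (0 :: real ^ 'n) / sqrt t) (at 0)"
    using t by (intro tendsto_intros) auto
  then have "((\<lambda>x :: real ^ 'n. norm x / sqrt t) \<longlongrightarrow> 0) (at 0)" by simp
  moreover have "\<forall>\<^sub>F x :: real ^ 'n in at 0. norm x / sqrt t \<in> {0<..} \<and> norm x / sqrt t \<noteq> 0"
    using t by (simp add: eventually_at_filter)
  ultimately have "filterlim (\<lambda>x :: real ^ 'n. norm x / sqrt t) (at_right 0) (at 0)"
    unfolding filterlim_at by blast
  then have "filterlim (\<lambda>x :: real ^ 'n. u (norm x / sqrt t)) at_top (at 0)"
    by (rule filterlim_compose[OF u_at_top])
  then show ?thesis unfolding wstar_def
    by (rule filterlim_tendsto_pos_mult_at_top[OF tendsto_const, rotated]) (use t in simp)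
qed

lemma wstar_radial: "wstar p u x t = t powr (- 1 / (p - 1)) * u (1 / sqrt t * norm x)"
  by (simp add: wstar_def)

lemma wstar_calLq_ul:
  assumes t: "t > 0"
  shows "(\<lambda>x :: real ^ 'n. wstar p u x t) \<in> calLq_ul p"
proof (rule truncatable_imp_calLq_ul)
  let ?a = "t powr (- 1 / (p - 1))"
  have a: "?a > 0" "1 / sqrt t > 0" using t by auto
  note R = a wstar_radial
  show "(\<lambda>x :: real ^ 'n. wstar p u x t) \<in> borel_measurable borel" by (rule radial_measurable[OF R])
  show "AE x :: real ^ 'n in lborel. 0 \<le> wstar p u x t"
    using AE_lborel_singleton[of "0 :: real ^ 'n"] by eventually_elim (rule less_imp_le, rule wstar_pos[OF t])
  show "\<exists>M\<ge>0. (\<integral>\<^sup>+y. ennreal (wstar p u (y :: real ^ 'n) t powr p - M) \<partial>lborel) \<le> ennreal e" if "e > 0" for e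
    by (rule radial_tail[OF R that])
  show "\<exists>B. uniformly_continuous_on UNIV B \<and> (\<forall>x. 0 \<le> B x \<and> B x \<le> k) \<and> (AE x :: real ^ 'n in lborel. B x = min (wstar p u x t) k)" if "k > 0" for k
    by (rule radial_truncation[OF R that])
qed (use p_gt_1 in simp)

text \<open>In logarithmic variables \<open>u (norm x / sqrt t) = g (ln (norm x) - ln t / 2)\<close> with \<open>g = u \<circ> exp\<close>
  uniformly continuous on half lines, so the modulus of continuity in time does not depend on \<open>x\<close>.\<close>

lemma wstar_time_uniform:
  assumes t0: "t0 > 0" and t: "t0 \<le> t" and \<rho>: "\<rho> > 0" and \<eta>: "\<eta> > 0" and T: "T \<ge> t"
  obtains d where "d > 0" "\<And>s x :: real ^ 'n. t0 \<le> s \<Longrightarrow> s \<le> T \<Longrightarrow> \<bar>s - t\<bar> < d \<Longrightarrow> \<rho> \<le> norm x \<Longrightarrow>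
     \<bar>wstar p u x s - wstar p u x t\<bar> \<le> \<eta>"
proof -
  \<comment> \<open>A lower bound for the logarithmic variable when
    \<open>norm x \<ge> \<rho>\<close> and the time is at most \<open>T\<close>; beyond it
    \<open>g\<close> is bounded by \<open>G\<close> and uniformly continuous.\<close>
  define y0 where "y0 = ln \<rho> - ln T / 2"
  have T0: "T > 0" using t0 t T by simp
  define G where "G = u (exp y0)"
  have G: "G > 0" by (simp add: G_def u_pos)
  define g where "g y = u (exp y)" for y
  let ?a = "\<lambda>t. t powr (- 1 / (p - 1))"
  have gle: "0 < g y \<and> g y \<le> G" if "y0 \<le> y" for y using that by (simp add: g_def G_def u_pos u_antimono)
  have ug: "uniformly_continuous_on {y0..} g"
  proof (rule antimono_uniformly_continuous)
    show "continuous_on {y0..} g" unfolding g_def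
      by (rule continuous_on_compose2[OF continuous_on_u]) (auto intro!: continuous_intros)
    show "g y \<le> g x" if "y0 \<le> x" "x \<le> y" for x y using that by (simp add: g_def u_antimono)
    show "0 \<le> g x" if "y0 \<le> x" for x using gle[OF that] by simp
  qed
  have a0: "?a t0 > 0" using t0 by simp
  have eta2: "\<eta> / (2 * ?a t0) > 0" using \<eta> a0 by simp
  obtain d1 where d1: "d1 > 0" "\<And>y y'. y \<in> {y0..} \<Longrightarrow> y' \<in> {y0..} \<Longrightarrow> dist y' y < d1 \<Longrightarrow> dist (g y') (g y) < \<eta> / (2 * ?a t0)"
    using ug eta2 unfolding uniformly_continuous_on_def by metis
  have tpos: "t > 0" using t0 t by simp
  have "(?a \<longlongrightarrow> ?a t) (at t)" using tpos by (intro tendsto_intros) auto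
  then have "\<forall>\<^sub>F s in at t. dist (?a s) (?a t) < \<eta> / (2 * G)" using \<eta> G by (intro tendstoD) auto
  moreover have "((\<lambda>s. ln s / 2) \<longlongrightarrow> ln t / 2) (at t)" using tpos by (intro tendsto_intros) auto
  then have "\<forall>\<^sub>F s in at t. dist (ln s / 2) (ln t / 2) < d1" using d1(1) by (rule tendstoD)
  ultimately have "\<forall>\<^sub>F s in at t. dist (?a s) (?a t) < \<eta> / (2 * G) \<and> dist (ln s / 2) (ln t / 2) < d1"
    by (rule eventually_conj)
  then obtain d where d: "d > 0" "\<And>s. s \<noteq> t \<Longrightarrow> dist s t < d \<Longrightarrow> dist (?a s) (?a t) < \<eta> / (2 * G) \<and> dist (ln s / 2) (ln t / 2) < d1"
    unfolding eventually_at by blast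
  have goal: "\<bar>wstar p u x s - wstar p u x t\<bar> \<le> \<eta>"
    if s: "t0 \<le> s" "s \<le> T" "\<bar>s - t\<bar> < d" and x: "\<rho> \<le> norm x" for s and x :: "real ^ 'n"
  proof (cases "s = t")
    case False
    have nx: "norm x > 0" using \<rho> x by (rule less_le_trans)
    have spos: "s > 0" using s t0 by simp
    have eq: "wstar p u x r = ?a r * g (ln (norm x) - ln r / 2)" if "r > 0" for r
    proof -
      have "exp (ln (norm x) - ln r / 2) = norm x / sqrt r"
        using nx that by (simp add: exp_diff ln_sqrt[symmetric])
      then show ?thesis by (simp add: wstar_def g_def)
    qed
    have y: "y0 \<le> ln (norm x) - ln r / 2" if "0 < r" "r \<le> T" for r
    proof -
      have "ln \<rho> \<le> ln (norm x)" using x \<rho> nx by (subst ln_le_cancel_iff) auto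
      moreover have "ln r \<le> ln T" using that T0 by (subst ln_le_cancel_iff) auto
      ultimately show ?thesis by (simp add: y0_def)
    qed
    let ?ys = "ln (norm x) - ln s / 2" and ?yt = "ln (norm x) - ln t / 2"
    have D: "dist (?a s) (?a t) < \<eta> / (2 * G)" "dist (ln s / 2) (ln t / 2) < d1" using d(2)[of s] False s by (auto simp: dist_real_def)
    have gd: "dist (g ?ys) (g ?yt) < \<eta> / (2 * ?a t0)"
      by (rule d1(2)) (use y spos s tpos T D in \<open>auto simp: dist_real_def abs_minus_commute\<close>)
    have "wstar p u x s - wstar p u x t = (?a s - ?a t) * g ?ys + ?a t * (g ?ys - g ?yt)"
      unfolding eq[OF spos] eq[OF tpos] by (simp add: algebra_simps)
    then have "\<bar>wstar p u x s - wstar p u x t\<bar> \<le> \<bar>(?a s - ?a t) * g ?ys\<bar> + \<bar>?a t * (g ?ys - g ?yt)\<bar>"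
      by (simp only: abs_triangle_ineq)
    also have "\<dots> = \<bar>?a s - ?a t\<bar> * \<bar>g ?ys\<bar> + ?a t * \<bar>g ?ys - g ?yt\<bar>"
      by (simp only: abs_mult abs_of_nonneg[OF powr_ge_zero])
    also have "\<dots> \<le> (\<eta> / (2 * G)) * G + ?a t0 * (\<eta> / (2 * ?a t0))"
    proof (intro add_mono mult_mono)
      show "\<bar>g ?ys\<bar> \<le> G" using gle[OF y[OF spos s(2)]] by simp
      show "?a t \<le> ?a t0" using t t0 p_gt_1 by (intro powr_mono2') (auto simp: divide_nonpos_pos)
    qed (use D gd G \<eta> in \<open>auto simp: dist_real_def\<close>)
    also have "\<dots> = \<eta>" using G a0 by simp
    finally show ?thesis .
  qed (use \<eta> in simp)
  show thesis by (rule that[OF d(1) goal])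
qed

text \<open>An envelope that is uniform in time: the prefactor is largest at \<open>t0\<close>, and
  the scaled radius is smallest at \<open>T\<close>, where the decreasing \<open>u\<close> is
  largest.\<close>

lemma wstar_le:
  fixes x :: "real ^ 'n"
  assumes t0: "0 < t0" and t: "t0 \<le> t" "t \<le> T" and x: "x \<noteq> 0"
  shows "wstar p u x t \<le> t0 powr (- 1 / (p - 1)) * u (1 / sqrt T * norm x)"
  unfolding wstar_def
proof (rule mult_mono)
  show "t powr (- 1 / (p - 1)) \<le> t0 powr (- 1 / (p - 1))"
    using t t0 p_gt_1 by (intro powr_mono2') (auto simp: divide_nonpos_pos)
  show "u (norm x / sqrt t) \<le> u (1 / sqrt T * norm x)"
    using t t0 x by (intro u_antimono) (auto simp: frac_le)
  show "0 \<le> u (norm x / sqrt t)" using u_pos[of "norm x / sqrt t"] t t0 x by simp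
qed simp

text \<open>Inside a small ball around the origin the difference of two slices is dominated by the
  envelope \<open>D\<close>, whose \<open>p\<close>-th power has a small integral there. Outside
  this ball the difference is uniformly small by \<open>wstar_time_uniform\<close>.\<close>

lemma wstar_C_calLq_ul:
  assumes t0: "t0 > 0"
  shows "(\<lambda>(x :: real ^ 'n) t. wstar p u x (t + t0)) \<in> C_calLq_ul T p"
proof (rule C_calLq_ulI)
  show pp: "p > 0" using p_gt_1 by simp
  fix t assume t: "t \<in> {0..T}"
  show "(\<lambda>x :: real ^ 'n. wstar p u x (t + t0)) \<in> calLq_ul p" by (rule wstar_calLq_ul) (use t t0 in simp)
  fix e :: real assume e: "e > 0"
  define D where "D x = t0 powr (- 1 / (p - 1)) * u (1 / sqrt (T + t0) * norm x)" for x :: "real ^ 'n"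
  have T0: "T + t0 > 0" using t t0 by simp
  have a: "t0 powr (- 1 / (p - 1)) > 0" "1 / sqrt (T + t0) > 0" using T0 t0 by auto
  note R = a D_def
  have Dm [measurable]: "D \<in> borel_measurable borel" by (rule radial_measurable[OF R])
  obtain M where M: "M \<ge> 0" "(\<integral>\<^sup>+x. ennreal (D x powr p - M) \<partial>lborel) \<le> ennreal (e / 4)"
    using radial_tail[OF R, of "e / 4"] e by auto
  define \<omega> where "\<omega> = unit_ball_vol (real CARD('n))"
  have \<omega>: "\<omega> \<ge> 0" by (simp add: \<omega>_def)
  \<comment> \<open>Makes \<open>M\<close> times the volume of the ball at most
    \<open>e / 4\<close>; the bound by \<open>1\<close> lets \<open>\<rho> ^ CARD('n)\<close> be
    replaced by \<open>\<rho>\<close>.\<close>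
  define \<rho> where "\<rho> = min 1 (e / (4 * (M * \<omega> + 1)))"
  have den: "M * \<omega> + 1 > 0" using M \<omega> by (simp add: add_nonneg_pos)
  have \<rho>: "\<rho> > 0" "\<rho> \<le> 1" using e den by (auto simp: \<rho>_def)
  have ball: "emeasure lborel (ball (0 :: real ^ 'n) \<rho>) = ennreal (\<omega> * \<rho> ^ CARD('n))"
    using \<rho> by (simp add: emeasure_ball \<omega>_def)
  have small: "M * (\<omega> * \<rho> ^ CARD('n)) \<le> e / 4"
  proof -
    have "\<rho> ^ CARD('n) \<le> \<rho> ^ 1" using \<rho> by (intro power_decreasing) auto
    then have "M * (\<omega> * \<rho> ^ CARD('n)) \<le> M * (\<omega> * \<rho>)" using M \<omega> by (intro mult_left_mono) auto
    also have "\<dots> \<le> (M * \<omega> + 1) * \<rho>" using \<rho> by (simp add: distrib_right)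
    also have "\<dots> \<le> (M * \<omega> + 1) * (e / (4 * (M * \<omega> + 1)))" using den by (intro mult_left_mono) (auto simp: \<rho>_def)
    also have "\<dots> = e / 4"
    proof -
      have "X * (e / (4 * X)) = e / 4" if "X > 0" for X using that by simp
      then show ?thesis using den by blast
    qed
    finally show ?thesis .
  qed
  let ?I = "indicator (ball 0 \<rho>) :: real ^ 'n \<Rightarrow> ennreal"
  have Im [measurable]: "?I \<in> borel_measurable borel" by (intro borel_measurable_indicator) simp
  have inner: "(\<integral>\<^sup>+x. ennreal (D x powr p) * ?I x \<partial>lborel) \<le> ennreal (e / 2)"
  proof -
    have "(\<integral>\<^sup>+x. ennreal (D x powr p) * ?I x \<partial>lborel) \<le> (\<integral>\<^sup>+x. ennreal (D x powr p - M) + ennreal M * ?I x \<partial>lborel)"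
    proof (rule nn_integral_mono)
      fix x
      have "ennreal (D x powr p) \<le> ennreal (max (D x powr p - M) 0 + M)" by (intro ennreal_leI) simp
      also have "\<dots> = ennreal (D x powr p - M) + ennreal M"
        using M by (auto simp: max_def ennreal_neg ennreal_plus[symmetric] simp del: ennreal_plus)
      finally show "ennreal (D x powr p) * ?I x \<le> ennreal (D x powr p - M) + ennreal M * ?I x"
        by (cases "x \<in> ball 0 \<rho>") auto
    qed
    also have "\<dots> = (\<integral>\<^sup>+x. ennreal (D x powr p - M) \<partial>lborel) + (\<integral>\<^sup>+x. ennreal M * ?I x \<partial>lborel)"
      by (rule nn_integral_add) measurable
    also have "(\<integral>\<^sup>+x. ennreal M * ?I x \<partial>lborel) = ennreal M * ennreal (\<omega> * \<rho> ^ CARD('n))"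
      by (simp add: nn_integral_cmult_indicator ball)
    also have "\<dots> = ennreal (M * (\<omega> * \<rho> ^ CARD('n)))" using M by (simp add: ennreal_mult')
    also have "(\<integral>\<^sup>+x. ennreal (D x powr p - M) \<partial>lborel) + ennreal (M * (\<omega> * \<rho> ^ CARD('n))) \<le> ennreal (e / 4) + ennreal (e / 4)"
      by (intro add_mono M(2) ennreal_leI small)
    also have "\<dots> = ennreal (e / 2)" using e by (simp add: ennreal_plus[symmetric] del: ennreal_plus)
    finally show ?thesis .
  qed
  have e2: "e / 2 > 0" using e by simp
  obtain \<eta> where \<eta>: "\<eta> > 0" "\<forall>f. (\<forall>x :: real ^ 'n. \<bar>f x\<bar> \<le> \<eta>) \<longrightarrow> (\<forall>y. ul_ball_nn p f y \<le> ennreal (e / 2))"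
    by (rule ul_ball_nn_uniformly_small[OF pp e2]) (rule that)
  obtain d where d: "d > 0" "\<And>s x :: real ^ 'n. t0 \<le> s \<Longrightarrow> s \<le> T + t0 \<Longrightarrow> \<bar>s - (t + t0)\<bar> < d \<Longrightarrow> \<rho> \<le> norm x \<Longrightarrow>
     \<bar>wstar p u x s - wstar p u x (t + t0)\<bar> \<le> \<eta>"
    by (rule wstar_time_uniform[of t0 "t + t0" \<rho> \<eta> "T + t0"]) (use t t0 \<rho> \<eta> in auto)
  have "ul_ball_nn p (\<lambda>x :: real ^ 'n. wstar p u x (s + t0) - wstar p u x (t + t0)) y \<le> ennreal e"
    if s: "s \<in> {0..T}" "\<bar>s - t\<bar> < d" for s y
  proof -
    let ?f = "\<lambda>x :: real ^ 'n. wstar p u x (s + t0) - wstar p u x (t + t0)"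
    let ?h = "\<lambda>x :: real ^ 'n. if \<rho> \<le> norm x then ?f x else 0"
    have fm: "?f \<in> borel_measurable borel"
      by (intro borel_measurable_diff radial_measurable[OF _ _ wstar_radial]) (use s t t0 in auto)
    have h: "ul_ball_nn p ?h y \<le> ennreal (e / 2)"
    proof (rule \<eta>(2)[rule_format])
      show "\<bar>?h x\<bar> \<le> \<eta>" for x using d(2)[of "s + t0" x] s t0 \<eta>(1) by simp
    qed
    have [measurable]: "?h \<in> borel_measurable borel" using fm by measurable
    have Bm [measurable]: "(indicator (ball y 1) :: real ^ 'n \<Rightarrow> ennreal) \<in> borel_measurable borel"
      by (intro borel_measurable_indicator) simp
    have "ul_ball_nn p ?f y \<le> (\<integral>\<^sup>+x. ennreal (D x powr p) * ?I x + ennreal (\<bar>?h x\<bar> powr p) * indicator (ball y 1) x \<partial>lborel)"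
      unfolding ul_ball_nn_def
    proof (rule nn_integral_mono_AE)
      show "AE x in lborel. ennreal (\<bar>?f x\<bar> powr p) * indicator (ball y 1) x \<le> ennreal (D x powr p) * ?I x + ennreal (\<bar>?h x\<bar> powr p) * indicator (ball y 1) x"
        using AE_lborel_singleton[of "0 :: real ^ 'n"]
      proof eventually_elim
        case (elim x)
        show ?case
        proof (cases "\<rho> \<le> norm x")
          case False
          have "wstar p u x (s + t0) \<le> D x" "wstar p u x (t + t0) \<le> D x"
            unfolding D_def using s t t0 elim by (intro wstar_le; simp)+
          moreover have "0 < wstar p u x (s + t0)" "0 < wstar p u x (t + t0)"
            using s t t0 elim by (auto intro!: wstar_pos)
          ultimately have "\<bar>?f x\<bar> \<le> D x" by linarith
          then have "ennreal (\<bar>?f x\<bar> powr p) \<le> ennreal (D x powr p)" using pp by (intro ennreal_leI powr_mono2) auto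
          then show ?thesis using False by (cases "x \<in> ball y 1") auto
        qed simp
      qed
    qed
    also have "\<dots> = (\<integral>\<^sup>+x. ennreal (D x powr p) * ?I x \<partial>lborel) + ul_ball_nn p ?h y"
      unfolding ul_ball_nn_def by (rule nn_integral_add) measurable
    also have "\<dots> \<le> ennreal (e / 2) + ennreal (e / 2)" by (intro add_mono inner h)
    also have "\<dots> = ennreal e" using e by (simp add: ennreal_plus[symmetric] del: ennreal_plus)
    finally show ?thesis .
  qed
  then show "\<exists>d>0. \<forall>s\<in>{0..T}. \<bar>s - t\<bar> < d \<longrightarrow> (\<forall>y. ul_ball_nn p (\<lambda>x :: real ^ 'n. wstar p u x (s + t0) - wstar p u x (t + t0)) y \<le> ennreal e)"
    using d(1) by blast
qed

lemma wstar_cauchy_solution: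
  assumes "t0 > 0"
  shows "cauchy_solution p p T (- {0}) (\<lambda>x :: real ^ 'n. wstar p u x t0) (\<lambda>x t. wstar p u x (t + t0))"
  unfolding cauchy_solution_def
proof (intro conjI ballI allI impI wstar_C_calLq_ul wstar_classical assms)
  fix x :: "real ^ 'n" and t assume "x \<in> - {0}" "t \<in> {0..T}"
  then show "0 \<le> wstar p u x (t + t0)" using wstar_pos[of "t + t0" x] assms by simp
qed simp

text \<open>At the origin \<open>wstar\<close> returns a multiple of the unspecified
  \<open>u 0\<close>. Setting the value there to \<open>0\<close> makes the datum nonnegative
  everywhere and changes it on a null set only.\<close>

lemma critical_datum_wstar:
  assumes t0: "t0 > 0"
  obtains T where "T > 0" "critical_datum_continuous (\<lambda>x :: real ^ 'n. if x = 0 then 0 else wstar p u x t0) p T"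
proof -
  let ?W = "\<lambda>x :: real ^ 'n. if x = 0 then 0 else wstar p u x t0"
  have a: "t0 powr (- 1 / (p - 1)) > 0" "1 / sqrt t0 > 0" using t0 by auto
  have rad: "?W x = t0 powr (- 1 / (p - 1)) * u (1 / sqrt t0 * norm x)" if "x \<noteq> 0" for x
    using that by (simp add: wstar_radial)
  note R = a rad
  interpret W: critical_datum ?W p
  proof
    show "p > 1" by (rule p_gt_1)
    show "(p - 1) / p = 2 / real DIM(real ^ 'n)" using n by (simp add: p_def N field_simps)
    show "?W \<in> borel_measurable borel" by (rule radial_measurable[OF R])
    show "0 \<le> ?W x" for x using wstar_pos[OF t0, of x] by (simp add: less_imp_le)
    show "AE x in lborel. 0 < ?W x"
      using AE_lborel_singleton[of "0 :: real ^ 'n"] by eventually_elim (use wstar_pos[OF t0] in simp)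
    show "\<exists>M\<ge>0. (\<integral>\<^sup>+y. ennreal (?W y powr p - M) \<partial>lborel) \<le> ennreal e" if "e > 0" for e
      by (rule radial_tail[OF R that])
  qed
  obtain T where T: "T > 0" "\<And>t x. 0 < t \<Longrightarrow> t \<le> T \<Longrightarrow> t * W.\<phi> t x powr ((p - 1) / p) \<le> 2 powr (- p)"
    by (rule W.\<phi>_small[of "2 powr (- p)"]) (simp, rule that)
  have "critical_datum_continuous ?W p T"
  proof
    show "\<exists>B. uniformly_continuous_on UNIV B \<and> (\<forall>x. 0 \<le> B x \<and> B x \<le> k) \<and> (AE x in lborel. B x = min (?W x) k)" if "k > 0" for k
      by (rule radial_truncation[OF R that])
  qed (use T in auto)
  then show thesis using that T(1) by blast
qed

end

section \<open>The two solutions differ\<close>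

text \<open>Near the origin \<open>g\<close> exceeds \<open>M\<close>, hence \<open>f\<close>, on a
  punctured ball, and a ball has positive measure.\<close>

lemma unbounded_not_AE_eq:
  fixes f g :: "real ^ 'n \<Rightarrow> real"
  assumes f: "\<And>x. f x \<le> M" and g: "filterlim g at_top (at 0)"
  shows "\<not> (AE x in lebesgue. f x = g x)"
proof
  assume "AE x in lebesgue. f x = g x"
  then have ae: "AE x in lborel. f x = g x" by (simp add: AE_completion_iff)
  have "\<forall>\<^sub>F x in at 0. M < g x" using g by (simp add: filterlim_at_top_dense)
  then obtain d where d: "d > 0" "\<And>x. x \<noteq> 0 \<Longrightarrow> dist x 0 < d \<Longrightarrow> M < g x" by (auto simp: eventually_at)
  have "AE x :: real ^ 'n in lborel. x \<notin> ball 0 d"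
    using ae AE_lborel_singleton[of "0 :: real ^ 'n"]
  proof eventually_elim
    case (elim x)
    then show ?case using d(2)[of x] f[of x] by (auto simp: dist_commute)
  qed
  then have "emeasure lborel (ball (0 :: real ^ 'n) d) = 0"
    by (subst (asm) AE_iff_measurable[where N = "ball 0 d"]) auto
  moreover have "emeasure lborel (ball (0 :: real ^ 'n) d) \<noteq> 0"
  proof -
    have "unit_ball_vol (real CARD('n)) \<noteq> 0" using unit_ball_vol_pos[of "real CARD('n)"] by linarith
    then show ?thesis using d(1) by (simp add: emeasure_ball)
  qed
  ultimately show False by simp
qed

theorem corollary1p4:
  fixes u :: "real \<Rightarrow> real" and N p t0 :: real
    and w :: "real ^ 'n \<Rightarrow> real \<Rightarrow> real" and w0 :: "real ^ 'n \<Rightarrow> real"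
  assumes "CARD('n) \<ge> 3"
    and "N = real CARD('n)"
    and "p = N / (N - 2)"
    and "singular_positive_solution N p u"
    and "t0 > 0"
    and "w = (\<lambda>x t. wstar p u x (t + t0))"
    and "w0 = (\<lambda>x. wstar p u x t0)"
  shows "(\<forall>t\<ge>0. filterlim (\<lambda>x. w x t) at_top (at 0)) \<and>
    (\<exists>T>0.
       cauchy_solution p (N / (N - 2)) T (- {0}) w0 w \<and>
       (\<exists>v. cauchy_solution p (N / (N - 2)) T UNIV w0 v \<and>
            (\<exists>t\<in>{0..T}. \<not> (AE x in lebesgue. v x t = w x t))))"
proof -
  interpret singular_profile_space N p u "TYPE('n)"
    by unfold_locales (use assms in auto)
  have top: "filterlim (\<lambda>x. w x t) at_top (at 0)" if "t \<ge> 0" for t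
    unfolding assms(6) by (rule wstar_at_top) (use that assms(5) in simp)
  obtain T where T: "T > 0" "critical_datum_continuous (\<lambda>x :: real ^ 'n. if x = 0 then 0 else wstar p u x t0) p T"
    using critical_datum_wstar[OF assms(5)] by blast
  \<comment> \<open>Half the horizon provides a time strictly below \<open>T\<close>, as the
    construction of \<open>v\<close> requires.\<close>
  obtain v where v: "cauchy_solution p p (T / 2) UNIV w0 v"
    "\<And>t. 0 < t \<Longrightarrow> t \<le> T / 2 \<Longrightarrow> \<exists>M. \<forall>x. v x t \<le> M"
    by (rule critical_datum_cauchy_solution[OF T(2), of "T / 2" w0]) (use T(1) assms(7) in auto)
  obtain M where "\<And>x. v x (T / 2) \<le> M" using v(2)[of "T / 2"] T(1) by auto
  \<comment> \<open>The comparison is made at the final time, where \<open>v\<close> is bounded and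
    \<open>w\<close> is not. Inequality almost everywhere is the relevant notion because elements of
    the space are classes of functions.\<close>
  then have "\<not> (AE x in lebesgue. v x (T / 2) = w x (T / 2))"
    by (rule unbounded_not_AE_eq) (use top T(1) in simp)
  moreover have "cauchy_solution p p (T / 2) (- {0}) w0 w"
    unfolding assms(6,7) by (rule wstar_cauchy_solution[OF assms(5)])
  ultimately show ?thesis
    using top v(1) T(1) unfolding assms(3)[symmetric]
    by (intro conjI allI impI exI[of _ "T / 2"] exI[of _ v] bexI[of _ "T / 2"]) auto
qed

end
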